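(* Let $G=(V,E)$ be a connected, undirected, unweighted graph on $n$ nodes with diameter $D$, and let $S\subseteq V$ be a set of source nodes. Then a $(+2)$-sourcewise spanner of $G$ for $S$ with $O\!\left(n^{5/4}|S|^{1/4}\log^{3/4} n\right)$ edges can be constructed in $O(|S|+D)$ rounds in the CONGEST model, with high probability.
   Context: For a graph $H$, $\delta_H(u,v)$ denotes the distance between $u$ and $v$ in $H$. A subgraph $H$ of $G$ (on the same node set) is a $(+2)$-sourcewise spanner for $S$ if $\delta_H(s,v)\le \delta_G(s,v)+2$ for all $(s,v)\in S\times V$. CONGEST model: the nodes of $G$ are processors with unique $O(\log n)$-bit identifiers; computation proceeds in synchronous rounds, in each of which every node may send a (possibly different) $O(\log n)$-bit message to each of its neighbors in $G$, followed by unbounded local computation. Initially each node knows its own identifier, the identifiers of its neighbors, and whether it belongs to $S$. At the end, each node must know which of its incident edges belong to $H$. "With high probability" means with probability at least $1-n^{-c}$, where $c$ is a constant that can be chosen arbitrarily (in advance). *)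

theory Defs
  imports "HOL-Probability.Probability" "HOL-Probability.Product_PMF" "HOL-Library.Log_Nat"
begin

definition simple_graph :: "'v set \<Rightarrow> 'v set set \<Rightarrow> bool" where
  "simple_graph V E \<longleftrightarrow> finite V \<and> E \<subseteq> {{u, v} | u v. u \<in> V \<and> v \<in> V \<and> u \<noteq> v}"

definition adjacency :: "'v set set \<Rightarrow> ('v \<times> 'v) set" where
  "adjacency E = {(u, v). {u, v} \<in> E}"

definition neighbors :: "'v set set \<Rightarrow> 'v \<Rightarrow> 'v set" where
  "neighbors E v = {u. {u, v} \<in> E}"

definition connected_graph :: "'v set \<Rightarrow> 'v set set \<Rightarrow> bool" where
  "connected_graph V E \<longleftrightarrow>
     simple_graph V E \<and> V \<noteq> {} \<and> (\<forall>u\<in>V. \<forall>v\<in>V. (u, v) \<in> (adjacency E)\<^sup>*)"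

text \<open>Length of a shortest walk; it is \<open>\<infinity>\<close> (the infimum of the empty set) if there is none.\<close>

definition graph_dist :: "'v set set \<Rightarrow> 'v \<Rightarrow> 'v \<Rightarrow> enat" where
  "graph_dist E u v = (INF k \<in> {k. (u, v) \<in> adjacency E ^^ k}. enat k)"

definition graph_diameter :: "'v set \<Rightarrow> 'v set set \<Rightarrow> enat" where
  "graph_diameter V E = (SUP u\<in>V. SUP v\<in>V. graph_dist E u v)"

definition sourcewise_spanner2 ::
  "'v set \<Rightarrow> 'v set set \<Rightarrow> 'v set \<Rightarrow> 'v set set \<Rightarrow> bool" where
  "sourcewise_spanner2 V E S H \<longleftrightarrow>
     H \<subseteq> E \<and> (\<forall>s\<in>S. \<forall>v\<in>V. graph_dist H s v \<le> graph_dist E s v + 2)"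

text \<open>
  Nodes are identified with their identifiers, which are natural numbers. The length bounds
  use \<open>n + 1\<close> instead of \<open>n\<close> so that they do not degenerate to \<open>0\<close> for \<open>n = 1\<close>; for \<open>n \<ge> 2\<close>
  this only changes the constant. The bit length of an identifier \<open>v\<close> is \<open>floorlog 2 v\<close>.
\<close>

definition log_bits :: "nat \<Rightarrow> real" where
  "log_bits n = log 2 (real n + 1)"

definition short_identifiers :: "real \<Rightarrow> nat set \<Rightarrow> bool" where
  "short_identifiers a V \<longleftrightarrow> (\<forall>v\<in>V. real (floorlog 2 v) \<le> a * log_bits (card V))"

type_synonym message = "bool list"

text \<open>
  All nodes run the same algorithm, with states of type \<open>'s\<close> (\<open>nat\<close> is
  general enough, since every countable state type embeds into it). Local computation is an arbitrary
  function, randomised by private coins: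
  \<^item> \<open>alg_init v N b\<close> is the distribution of the initial state of the node with identifier \<open>v\<close>
    and neighbour identifiers \<open>N\<close>, where \<open>b\<close> tells whether it is a source. In particular,
    neither \<open>n\<close> nor \<open>D\<close> nor \<open>|S|\<close> is known initially.
  \<^item> \<open>alg_send s u\<close> is the message (if any) sent to neighbour \<open>u\<close> in a round that starts in
    state \<open>s\<close>.
  \<^item> \<open>alg_receive s i\<close> is the distribution of the next state, where \<open>i u\<close> is the message (if any)
    received from \<open>u\<close>.
  \<^item> \<open>alg_output s\<close> is \<open>None\<close> while the node is still running; \<open>Some F\<close> means that the node has
    terminated and selects its incident edges to the neighbours in \<open>F\<close>.
\<close>

record 's congest_alg =
  alg_init :: "nat \<Rightarrow> nat set \<Rightarrow> bool \<Rightarrow> 's pmf"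
  alg_send :: "'s \<Rightarrow> nat \<Rightarrow> message option"
  alg_receive :: "'s \<Rightarrow> (nat \<Rightarrow> message option) \<Rightarrow> 's pmf"
  alg_output :: "'s \<Rightarrow> nat set option"

text \<open>A terminated node keeps its state (hence its output) and stays silent.\<close>

definition sent_message :: "'s congest_alg \<Rightarrow> 's \<Rightarrow> nat \<Rightarrow> message option" where
  "sent_message A s u = (if alg_output A s = None then alg_send A s u else None)"

definition inbox ::
  "'s congest_alg \<Rightarrow> nat set set \<Rightarrow> (nat \<Rightarrow> 's) \<Rightarrow> nat \<Rightarrow> nat \<Rightarrow> message option" where
  "inbox A E \<sigma> v u = (if u \<in> neighbors E v then sent_message A (\<sigma> u) v else None)"

definition local_step ::
  "'s congest_alg \<Rightarrow> nat set set \<Rightarrow> (nat \<Rightarrow> 's) \<Rightarrow> nat \<Rightarrow> 's pmf" where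
  "local_step A E \<sigma> v =
     (if alg_output A (\<sigma> v) = None then alg_receive A (\<sigma> v) (inbox A E \<sigma> v)
      else return_pmf (\<sigma> v))"

text \<open>
  \<open>congest_run A V E S t\<close> is the distribution of the global configuration after \<open>t\<close> rounds.
  The product distributions express that the coins of different nodes are independent.
\<close>

primrec congest_run ::
  "'s congest_alg \<Rightarrow> nat set \<Rightarrow> nat set set \<Rightarrow> nat set \<Rightarrow> nat \<Rightarrow> (nat \<Rightarrow> 's) pmf" where
  "congest_run A V E S 0 = Pi_pmf V undefined (\<lambda>v. alg_init A v (neighbors E v) (v \<in> S))"
| "congest_run A V E S (Suc t) =
     bind_pmf (congest_run A V E S t) (\<lambda>\<sigma>. Pi_pmf V undefined (local_step A E \<sigma>))"

text \<open>The bandwidth restriction has to hold in every round, whatever the outcome of the coins.\<close>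

definition respects_bandwidth ::
  "real \<Rightarrow> 's congest_alg \<Rightarrow> nat set \<Rightarrow> nat set set \<Rightarrow> nat set \<Rightarrow> bool" where
  "respects_bandwidth B A V E S \<longleftrightarrow>
     (\<forall>t. \<forall>\<sigma> \<in> set_pmf (congest_run A V E S t). \<forall>v\<in>V. \<forall>u \<in> neighbors E v. \<forall>m.
        sent_message A (\<sigma> v) u = Some m \<longrightarrow> real (length m) \<le> B * log_bits (card V))"

definition outputs_subgraph ::
  "'s congest_alg \<Rightarrow> nat set \<Rightarrow> (nat \<Rightarrow> 's) \<Rightarrow> nat set set \<Rightarrow> bool" where
  "outputs_subgraph A V \<sigma> H \<longleftrightarrow> (\<forall>v\<in>V. alg_output A (\<sigma> v) = Some (neighbors H v))"

end

theory Submission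
  imports Defs
begin

text \<open>
  Let \<open>k = |S|\<close> and \<open>h = (n k ln\<^sup>3 n)\<^sup>1\<^sup>/\<^sup>4\<close>, so that \<open>n h\<close> is the target size. If \<open>k \<le> h\<close>, the
  breadth-first search trees of all sources have at most \<open>n h\<close> edges in total. Otherwise, every node
  of degree less than \<open>h\<close> keeps all its edges, about \<open>n ln n / h\<close> random centers are
  adjacent to all other nodes, each of which joins one adjacent center, and the complete trees of
  about \<open>h < k\<close> random roots are added. If the tree path from \<open>s\<close> to \<open>v\<close> contains a neighbour of a
  root (it is covered), the detour through this root costs \<open>2\<close>. For every source and center, the tree
  path from the source to the nearest member of the cluster that is not covered is bought; the detour
  through the center costs \<open>2\<close>. A path with more than \<open>h\<^sup>2 / (k ln n)\<close> missing edges is covered with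
  high probability, since its high-degree nodes have many neighbours.

  Hence \<open>O(k)\<close> breadth-first searches suffice. They are pipelined after a leader has been elected and
  has computed its eccentricity, \<open>n\<close> and \<open>k\<close>, which makes all later phases synchronous with known
  lengths \<open>O(k + D)\<close>. A single geometric coin per node, drawn initially, provides both random sets,
  because only union bounds are needed; everything else is deterministic.
\<close>

section \<open>Distances in a connected graph\<close>

text \<open>The value of \<open>h\<close> balances three costs, up to constants. About
  \<open>h\<close> roots with \<open>n\<close> tree edges each cost \<open>n h\<close>. A path with
  \<open>L\<close> missing edges has about \<open>h L\<close> nodes next to it, and roots have
  density \<open>h / n\<close>; for \<open>L = h^2 / (k ln n)\<close> and
  \<open>h^4 = n k ln^3 n\<close> this gives \<open>ln^2 n\<close> expected roots, so a miss is
  rare. Each pair of one of \<open>k\<close> sources and one of \<open>n ln n / h\<close> centers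
  buys at most one path of \<open>L\<close> edges, again \<open>n h\<close> in total. Since
  \<open>h < k\<close>, the number of roots is \<open>O(k)\<close>, as the round bound requires.

  The number of roots is bounded only with high probability, while the bandwidth bound has to hold
  for every outcome of the coins. Hence soundness of the tables and message sizes are proved without
  a bound on the number of origins; only exactness and scheduling assume
  \<open>card Origin \<le> slack * card S\<close>. Phase lengths are computed from the eccentricity
  and |S| alone, so the nodes stay synchronous for all coins.

  Coverage refers to one fixed tree path, not to all shortest paths; it thereby becomes a single bit
  that is passed down a tree.\<close>

locale net =
  fixes V :: "nat set" and E :: "nat set set"
  assumes conn: "connected_graph V E"
begin

abbreviation N :: "nat \<Rightarrow> nat set" where "N \<equiv> neighbors E"

text \<open>Connectedness makes the set of walk lengths nonempty, so natural numbers suffice;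
  \<open>graph_dist_eq\<close> is the link to the \<open>enat\<close> distance of the
  specification.\<close>

definition dist :: "nat \<Rightarrow> nat \<Rightarrow> nat" where
  "dist u v = (LEAST k. (u, v) \<in> adjacency E ^^ k)"

lemma finite_V [simp]: "finite V"
  using conn by (auto simp: connected_graph_def simple_graph_def)

lemma V_nonempty: "V \<noteq> {}"
  using conn by (auto simp: connected_graph_def)

lemma N_in_V: "u \<in> N v \<Longrightarrow> u \<in> V" "u \<in> N v \<Longrightarrow> v \<in> V"
  using conn by (auto simp: connected_graph_def simple_graph_def neighbors_def doubleton_eq_iff)

lemma N_subset_V: "N v \<subseteq> V"
  using N_in_V by blast

lemma finite_N [simp]: "finite (N v)"
  using N_subset_V finite_V by (rule finite_subset)

lemma N_sym: "u \<in> N v \<longleftrightarrow> v \<in> N u"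
  by (simp add: neighbors_def insert_commute)

lemma walk_step_iff: "(u, v) \<in> adjacency E ^^ Suc k \<longleftrightarrow> (\<exists>w \<in> N v. (u, w) \<in> adjacency E ^^ k)"
  by (auto simp: adjacency_def neighbors_def relcomp_unfold)

lemma ex_walk: "u \<in> V \<Longrightarrow> v \<in> V \<Longrightarrow> \<exists>k. (u, v) \<in> adjacency E ^^ k"
  using conn by (auto simp: connected_graph_def rtrancl_power)

lemma dist_walk: "u \<in> V \<Longrightarrow> v \<in> V \<Longrightarrow> (u, v) \<in> adjacency E ^^ dist u v"
  unfolding dist_def using ex_walk by (rule LeastI_ex)

lemma dist_le_walk: "(u, v) \<in> adjacency E ^^ k \<Longrightarrow> dist u v \<le> k"
  unfolding dist_def by (rule Least_le)

lemma graph_dist_eq: "u \<in> V \<Longrightarrow> v \<in> V \<Longrightarrow> graph_dist E u v = enat (dist u v)"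
  unfolding graph_dist_def
  by (intro antisym INF_lower INF_greatest) (auto intro: dist_walk dist_le_walk)

lemma adjacency_sym: "sym (adjacency E)"
  by (auto simp: sym_def adjacency_def insert_commute)

lemma dist_sym: "u \<in> V \<Longrightarrow> v \<in> V \<Longrightarrow> dist u v = dist v u"
proof -
  have "(x, y) \<in> adjacency E ^^ k \<Longrightarrow> (y, x) \<in> adjacency E ^^ k" for x y k
  proof (induction k arbitrary: x y)
    case (Suc k)
    then obtain z where "(x, z) \<in> adjacency E ^^ k" "(z, y) \<in> adjacency E" by auto
    with Suc.IH[of x z] have "(y, z) \<in> adjacency E" "(z, x) \<in> adjacency E ^^ k"
      using adjacency_sym by (auto dest: symD)
    then show ?case by (metis relpow_Suc_I2)
  qed simp
  then show ?thesis unfolding dist_def by metis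
qed

lemma dist_self [simp]: "dist v v = 0"
  using dist_le_walk[of v v 0] by simp

lemma dist_zero: "u \<in> V \<Longrightarrow> v \<in> V \<Longrightarrow> dist u v = 0 \<Longrightarrow> u = v"
  using dist_walk[of u v] by simp

lemma dist_triangle: "u \<in> V \<Longrightarrow> v \<in> V \<Longrightarrow> w \<in> V \<Longrightarrow> dist u w \<le> dist u v + dist v w"
  by (rule dist_le_walk) (auto simp: relpow_add intro: dist_walk)

lemma dist_N: "u \<in> N v \<Longrightarrow> x \<in> V \<Longrightarrow> dist x v \<le> Suc (dist x u)"
  by (rule dist_le_walk) (use walk_step_iff N_in_V dist_walk in blast)

lemma ex_closer: "x \<in> V \<Longrightarrow> v \<in> V \<Longrightarrow> x \<noteq> v \<Longrightarrow> \<exists>u \<in> N v. dist x v = Suc (dist x u)"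
proof -
  assume "x \<in> V" "v \<in> V" "x \<noteq> v"
  then obtain k where k: "dist x v = Suc k" by (metis dist_zero not0_implies_Suc)
  with \<open>x \<in> V\<close> \<open>v \<in> V\<close> obtain u where u: "u \<in> N v" "(x, u) \<in> adjacency E ^^ k"
    using dist_walk[of x v] walk_step_iff by auto
  with dist_N[OF u(1) \<open>x \<in> V\<close>] dist_le_walk[OF u(2)] k show ?thesis
    by (intro bexI[of _ u]) auto
qed

text \<open>The least identifier breaks ties, which fixes one shortest-path tree per root. A node
  can evaluate it from the distances of its neighbours, and covering, selection and buying all refer
  to the same tree.\<close>

definition par :: "nat \<Rightarrow> nat \<Rightarrow> nat" where
  "par x v = (LEAST u. u \<in> N v \<and> dist x v = Suc (dist x u))"

lemma par:
  assumes "x \<in> V" "v \<in> V" "x \<noteq> v"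
  shows "par x v \<in> N v" "dist x v = Suc (dist x (par x v))"
proof -
  have "\<exists>u. u \<in> N v \<and> dist x v = Suc (dist x u)"
    using ex_closer[OF assms] by blast
  from LeastI_ex[OF this] show "par x v \<in> N v" "dist x v = Suc (dist x (par x v))"
    unfolding par_def by auto
qed

lemma par_iter:
  assumes "x \<in> V" "v \<in> V" "i \<le> dist x v"
  shows "(par x ^^ i) v \<in> V \<and> dist x ((par x ^^ i) v) = dist x v - i"
  using assms(3)
proof (induction i)
  case 0
  then show ?case using assms by simp
next
  case (Suc i)
  then have "(par x ^^ i) v \<in> V" "dist x ((par x ^^ i) v) = dist x v - i" by auto
  moreover from this Suc.prems have "x \<noteq> (par x ^^ i) v" by auto
  ultimately show ?case
    using par[OF assms(1), of "(par x ^^ i) v"] N_in_V by auto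
qed

lemma dist_par_iter:
  assumes "x \<in> V" "v \<in> V" "i \<le> dist x v"
  shows "dist ((par x ^^ i) v) v \<le> i"
  using assms(3)
proof (induction i)
  case (Suc i)
  let ?w = "(par x ^^ i) v"
  from Suc have w: "?w \<in> V" "dist x ?w = dist x v - i" and IH: "dist ?w v \<le> i"
    using par_iter[OF assms(1,2), of i] by auto
  with Suc.prems have "x \<noteq> ?w" by auto
  from par[OF assms(1) w(1) this] have "?w \<in> N (par x ?w)" "par x ?w \<in> V"
    using N_sym N_in_V by blast+
  from dist_N[OF this(1) assms(2)] IH show ?case
    using dist_sym[of v] w \<open>par x ?w \<in> V\<close> assms(2) by simp
qed simp

text \<open>Walking up the tree path from \<open>v\<close> lowers the distance to \<open>x\<close>
  by exactly one per step, so no value is skipped.\<close>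

lemma ex_node_at_dist:
  assumes "x \<in> V" "v \<in> V" "j \<le> dist x v"
  shows "\<exists>w \<in> V. dist x w = j"
  using par_iter[OF assms(1,2), of "dist x v - j"] assms(3) by auto

lemma dist_less_card:
  assumes "x \<in> V" "v \<in> V"
  shows "dist x v < card V"
proof -
  have "{..dist x v} \<subseteq> dist x ` V"
    using ex_node_at_dist[OF assms] by force
  then have "card {..dist x v} \<le> card V"
    by (meson card_image_le card_mono finite_V finite_imageI le_trans)
  then show ?thesis by simp
qed

end

section \<open>Realizing a deterministic machine by node states in the naturals\<close>

fun bits_of_nat :: "nat \<Rightarrow> bool list" where
  "bits_of_nat n = (if n = 0 then [] else odd n # bits_of_nat (n div 2))"

declare bits_of_nat.simps [simp del]

lemma bits_of_nat_0 [simp]: "bits_of_nat 0 = []"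
  by (simp add: bits_of_nat.simps)

definition nat_of_bits :: "bool list \<Rightarrow> nat" where
  "nat_of_bits bs = foldr (\<lambda>b n. of_bool b + 2 * n) bs 0"

lemma nat_of_bits_of_nat [simp]: "nat_of_bits (bits_of_nat n) = n"
proof (induction n rule: bits_of_nat.induct)
  case (1 n)
  then show ?case
    by (cases "n = 0") (auto simp: nat_of_bits_def bits_of_nat.simps[of n] odd_iff_mod_2_eq_one)
qed

lemma length_bits_of_nat: "length (bits_of_nat n) = floorlog 2 n"
proof (induction n rule: bits_of_nat.induct)
  case (1 n)
  then show ?case
    by (cases "n = 0")
      (auto simp: bits_of_nat.simps[of n] compute_floorlog[of 2 n] floorlog_eq_zero_iff)
qed

type_synonym word4 = "nat \<times> nat \<times> nat \<times> nat"

definition encode_word :: "word4 \<Rightarrow> message" where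
  "encode_word = (\<lambda>(p, q, r, s).
     bits_of_nat (prod_encode (prod_encode (p, q), prod_encode (r, s))))"

definition decode_word :: "message \<Rightarrow> word4" where
  "decode_word m = (case prod_decode (nat_of_bits m) of (x, y) \<Rightarrow>
     (fst (prod_decode x), snd (prod_decode x), prod_decode y))"

lemma decode_encode_word [simp]: "decode_word (encode_word w) = w"
  by (cases w) (simp add: decode_word_def encode_word_def)

text \<open>The pairing function grows quadratically, so it doubles the bit length up to an additive
  constant. Two nested pairings then give the bound \<open>2 * (2 * b + 2) + 2 = 4 * b + 6\<close>
  for words.\<close>

lemma prod_encode_less:
  assumes "x < 2 ^ b" "y < 2 ^ b"
  shows "prod_encode (x, y) < 2 ^ (2 * b + 2)"
proof -
  define s where "s = x + y"
  have "triangle s + x \<le> s * Suc s + s"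
    by (simp add: triangle_def s_def)
  also have "\<dots> < Suc s * Suc s" by simp
  also have "\<dots> \<le> 2 ^ Suc b * 2 ^ Suc b"
    using assms by (intro mult_mono) (auto simp: s_def)
  also have "\<dots> = 2 ^ (2 * b + 2)"
    by (simp add: power_add power_mult power2_eq_square algebra_simps)
  finally show ?thesis by (simp add: prod_encode_def s_def)
qed

lemma length_encode_word:
  assumes "floorlog 2 p \<le> b" "floorlog 2 q \<le> b" "floorlog 2 r \<le> b" "floorlog 2 s \<le> b"
  shows "length (encode_word (p, q, r, s)) \<le> 4 * b + 6"
proof -
  have "p < 2 ^ b" "q < 2 ^ b" "r < 2 ^ b" "s < 2 ^ b"
    using assms by (auto dest: floorlog_leD)
  then have "prod_encode (prod_encode (p, q), prod_encode (r, s)) < 2 ^ (2 * (2 * b + 2) + 2)"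
    by (intro prod_encode_less)
  then have "floorlog 2 (prod_encode (prod_encode (p, q), prod_encode (r, s))) \<le> 2 * (2 * b + 2) + 2"
    by (intro floorlog_leI) auto
  then show ?thesis by (simp add: encode_word_def length_bits_of_nat)
qed

text \<open>A deterministic machine uses a single coin per node, drawn before the first round. Its
  states may have any type: a node can store the initial data and the received messages instead,
  and recompute the state from them.\<close>

record 'd machine =
  mach_init :: "nat \<Rightarrow> nat set \<Rightarrow> bool \<Rightarrow> nat \<Rightarrow> 'd"
  mach_send :: "'d \<Rightarrow> nat \<Rightarrow> word4 option"
  mach_receive :: "'d \<Rightarrow> (nat \<Rightarrow> word4 option) \<Rightarrow> 'd"
  mach_output :: "'d \<Rightarrow> nat set option"

definition mach_sent :: "'d machine \<Rightarrow> 'd \<Rightarrow> nat \<Rightarrow> word4 option" where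
  "mach_sent M d u = (if mach_output M d = None then mach_send M d u else None)"

primrec mach_run ::
  "'d machine \<Rightarrow> nat set set \<Rightarrow> nat set \<Rightarrow> (nat \<Rightarrow> nat) \<Rightarrow> nat \<Rightarrow> nat \<Rightarrow> 'd" where
  "mach_run M E S \<omega> 0 = (\<lambda>v. mach_init M v (neighbors E v) (v \<in> S) (\<omega> v))"
| "mach_run M E S \<omega> (Suc t) = (\<lambda>v.
     if mach_output M (mach_run M E S \<omega> t v) = None
     then mach_receive M (mach_run M E S \<omega> t v)
       (\<lambda>u. if u \<in> neighbors E v then mach_sent M (mach_run M E S \<omega> t u) v else None)
     else mach_run M E S \<omega> t v)"

text \<open>Neighbours and inboxes are stored as lists because \<open>to_nat\<close> needs a
  countable type; sets of naturals and functions on naturals are not countable. An inbox is listed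
  in the order of the neighbours.\<close>

type_synonym view = "nat \<times> nat list \<times> bool \<times> nat \<times> message option list list"

definition mail :: "nat list \<Rightarrow> message option list \<Rightarrow> nat \<Rightarrow> word4 option" where
  "mail ns h u = (case map_of (zip ns h) u of Some (Some m) \<Rightarrow> Some (decode_word m) | _ \<Rightarrow> None)"

definition interpret_view :: "'d machine \<Rightarrow> view \<Rightarrow> 'd" where
  "interpret_view M = (\<lambda>(v, ns, b, g, hs).
     foldl (\<lambda>d h. mach_receive M d (mail ns h)) (mach_init M v (set ns) b g) hs)"

definition extend_view :: "view \<Rightarrow> (nat \<Rightarrow> message option) \<Rightarrow> view" where
  "extend_view = (\<lambda>(v, ns, b, g, hs) i. (v, ns, b, g, hs @ [map i ns]))"

definition realize :: "nat pmf \<Rightarrow> 'd machine \<Rightarrow> nat congest_alg" where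
  "realize \<mu> M =
     \<lparr>alg_init = (\<lambda>v N b. map_pmf (\<lambda>g. to_nat ((v, sorted_list_of_set N, b, g, []) :: view)) \<mu>),
      alg_send = (\<lambda>s u. map_option encode_word (mach_send M (interpret_view M (from_nat s)) u)),
      alg_receive = (\<lambda>s i. return_pmf (to_nat (extend_view (from_nat s) i))),
      alg_output = (\<lambda>s. mach_output M (interpret_view M (from_nat s)))\<rparr>"

primrec view_run ::
  "'d machine \<Rightarrow> nat set set \<Rightarrow> nat set \<Rightarrow> (nat \<Rightarrow> nat) \<Rightarrow> nat \<Rightarrow> nat \<Rightarrow> view" where
  "view_run M E S \<omega> 0 = (\<lambda>v. (v, sorted_list_of_set (neighbors E v), v \<in> S, \<omega> v, []))"
| "view_run M E S \<omega> (Suc t) = (\<lambda>v.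
     if mach_output M (interpret_view M (view_run M E S \<omega> t v)) = None
     then extend_view (view_run M E S \<omega> t v)
       (\<lambda>u. if u \<in> neighbors E v
            then map_option encode_word (mach_sent M (interpret_view M (view_run M E S \<omega> t u)) v)
            else None)
     else view_run M E S \<omega> t v)"

text \<open>The value outside \<open>V\<close> is the default of \<open>Pi_pmf\<close> in
  \<open>congest_run\<close>, so that configurations agree as functions.\<close>

definition code_run ::
  "'d machine \<Rightarrow> nat set \<Rightarrow> nat set set \<Rightarrow> nat set \<Rightarrow> (nat \<Rightarrow> nat) \<Rightarrow> nat \<Rightarrow> nat \<Rightarrow> nat" where
  "code_run M V E S \<omega> t v = (if v \<in> V then to_nat (view_run M E S \<omega> t v) else undefined)"

lemma view_run_neighbors: "fst (snd (view_run M E S \<omega> t v)) = sorted_list_of_set (neighbors E v)"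
  by (induction t) (auto simp: extend_view_def split: prod.splits)

lemma interpret_extend_view:
  "fst (snd w) = ns \<Longrightarrow>
    interpret_view M (extend_view w i) = mach_receive M (interpret_view M w) (mail ns (map i ns))"
  by (auto simp: interpret_view_def extend_view_def split: prod.splits)

lemma mail_map:
  "mail ns (map i ns) u = (if u \<in> set ns then map_option decode_word (i u) else None)"
proof -
  have "map_of (zip ns (map i ns)) u = (if u \<in> set ns then Some (i u) else None)"
    by (induction ns) auto
  then show ?thesis by (simp add: mail_def split: option.split)
qed

context net
begin

lemma interpret_view_run: "interpret_view M (view_run M E S \<omega> t v) = mach_run M E S \<omega> t v"
proof (induction t arbitrary: v)
  case 0
  then show ?case by (simp add: interpret_view_def)
next
  case (Suc t)
  have "mail (sorted_list_of_set (N v)) (map (\<lambda>u. if u \<in> N v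
      then map_option encode_word (mach_sent M (mach_run M E S \<omega> t u) v) else None)
        (sorted_list_of_set (N v)))
    = (\<lambda>u. if u \<in> N v then mach_sent M (mach_run M E S \<omega> t u) v else None)"
    by (auto simp: fun_eq_iff mail_map option.map_comp o_def option.map_ident)
  then show ?case
    by (simp add: Suc interpret_extend_view[OF view_run_neighbors] cong: if_cong)
qed

lemma output_code_run:
  "v \<in> V \<Longrightarrow> alg_output (realize \<mu> M) (code_run M V E S \<omega> t v) = mach_output M (mach_run M E S \<omega> t v)"
  by (simp add: realize_def code_run_def interpret_view_run)

lemma sent_code_run:
  "v \<in> V \<Longrightarrow> sent_message (realize \<mu> M) (code_run M V E S \<omega> t v) u
    = map_option encode_word (mach_sent M (mach_run M E S \<omega> t v) u)"
  by (simp add: realize_def code_run_def interpret_view_run sent_message_def mach_sent_def)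

text \<open>All randomness sits in the initial coins and every later step is a point distribution.
  Statements about runs thereby reduce to statements about coin vectors.\<close>

lemma congest_run_realize:
  "congest_run (realize \<mu> M) V E S t
    = map_pmf (\<lambda>\<omega>. code_run M V E S \<omega> t) (Pi_pmf V 0 (\<lambda>_. \<mu>))"
proof (induction t)
  case 0
  have "Pi_pmf V undefined (\<lambda>v. map_pmf (f v) \<mu>)
    = map_pmf (\<lambda>\<omega> v. if v \<in> V then f v (\<omega> v) else undefined) (Pi_pmf V 0 (\<lambda>_. \<mu>))" for f :: "nat \<Rightarrow> nat \<Rightarrow> nat"
    unfolding map_pmf_def by (subst Pi_pmf_bind[where d' = 0]) auto
  then show ?case
    by (simp add: realize_def code_run_def cong: if_cong)
next
  case (Suc t)
  have inbox: "inbox (realize \<mu> M) E (code_run M V E S \<omega> t) v =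
     (\<lambda>u. if u \<in> N v then map_option encode_word (mach_sent M (mach_run M E S \<omega> t u) v) else None)"
    for \<omega> v
    by (auto simp: inbox_def sent_code_run N_in_V)
  have "Pi_pmf V undefined (local_step (realize \<mu> M) E (code_run M V E S \<omega> t))
    = return_pmf (code_run M V E S \<omega> (Suc t))" for \<omega>
  proof -
    have "Pi_pmf V undefined (local_step (realize \<mu> M) E (code_run M V E S \<omega> t))
      = Pi_pmf V undefined (\<lambda>v. return_pmf (to_nat (view_run M E S \<omega> (Suc t) v)))"
      by (intro Pi_pmf_cong refl)
        (auto simp: local_step_def output_code_run inbox interpret_view_run,
         auto simp: realize_def code_run_def interpret_view_run cong: if_cong)
    then show ?thesis by (simp add: code_run_def fun_eq_iff)
  qed
  then show ?case
    by (simp only: congest_run.simps Suc bind_map_pmf) (simp add: map_pmf_def)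
qed

end

section \<open>Machines that run in phases\<close>

record 'd phase =
  ph_send :: "nat \<Rightarrow> 'd \<Rightarrow> nat \<Rightarrow> word4 option"
  ph_receive :: "nat \<Rightarrow> 'd \<Rightarrow> (nat \<Rightarrow> word4 option) \<Rightarrow> 'd"
  ph_over :: "nat \<Rightarrow> 'd \<Rightarrow> bool"

definition phased :: "(nat \<Rightarrow> nat set \<Rightarrow> bool \<Rightarrow> nat \<Rightarrow> 'd) \<Rightarrow> 'd phase list \<Rightarrow> ('d \<Rightarrow> nat set)
    \<Rightarrow> (nat \<times> nat \<times> 'd) machine" where
  "phased ini phs out =
     \<lparr>mach_init = (\<lambda>v N b g. (0, 0, ini v N b g)),
      mach_send = (\<lambda>(p, c, d). ph_send (phs ! p) c d),
      mach_receive = (\<lambda>(p, c, d) i. let d' = ph_receive (phs ! p) c d i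
        in if ph_over (phs ! p) (Suc c) d' then (Suc p, 0, d') else (p, Suc c, d')),
      mach_output = (\<lambda>(p, c, d). if p < length phs then None else Some (out d))\<rparr>"

primrec exec :: "nat set set \<Rightarrow> 'd phase \<Rightarrow> (nat \<Rightarrow> 'd) \<Rightarrow> nat \<Rightarrow> nat \<Rightarrow> 'd" where
  "exec E ph d 0 = d"
| "exec E ph d (Suc j) = (\<lambda>v. ph_receive ph j (exec E ph d j v)
     (\<lambda>u. if u \<in> neighbors E v then ph_send ph j (exec E ph d j u) v else None))"

lemma exec_invariant:
  assumes "\<And>c d i. f (ph_receive ph c d i) = f d"
  shows "f (exec E ph d j v) = f (d v)"
  by (induction j) (simp_all add: assms)

primrec exec_phases ::
  "nat set set \<Rightarrow> 'd phase list \<Rightarrow> (nat \<Rightarrow> nat) \<Rightarrow> (nat \<Rightarrow> 'd) \<Rightarrow> nat \<Rightarrow> nat \<Rightarrow> 'd" where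
  "exec_phases E phs len d 0 = d"
| "exec_phases E phs len d (Suc p) = exec E (phs ! p) (exec_phases E phs len d p) (len p)"

context net
begin

text \<open>By \<open>over\<close>, the local test of each node succeeds for the first time in round
  \<open>len p\<close>. So all nodes change phases simultaneously although nobody coordinates the
  change.\<close>

context
  fixes ini :: "nat \<Rightarrow> nat set \<Rightarrow> bool \<Rightarrow> nat \<Rightarrow> 'd" and phs :: "'d phase list"
    and out :: "'d \<Rightarrow> nat set" and len :: "nat \<Rightarrow> nat" and S :: "nat set" and \<omega> :: "nat \<Rightarrow> nat"
  assumes over: "\<And>p j v. p < length phs \<Longrightarrow> 0 < j \<Longrightarrow> j \<le> len p \<Longrightarrow> v \<in> V \<Longrightarrow>
      ph_over (phs ! p) j (exec E (phs ! p) (exec_phases E phs len (\<lambda>v. ini v (N v) (v \<in> S) (\<omega> v)) p) j v)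
        \<longleftrightarrow> j = len p"
    and len_pos: "\<And>p. p < length phs \<Longrightarrow> 0 < len p"
begin

private abbreviation "start \<equiv> exec_phases E phs len (\<lambda>v. ini v (N v) (v \<in> S) (\<omega> v))"

private abbreviation "run \<equiv> mach_run (phased ini phs out) E S \<omega>"

private lemma within_phase:
  assumes "p < length phs" "\<And>v. v \<in> V \<Longrightarrow> run t v = (p, 0, start p v)" "j \<le> len p" "v \<in> V"
  shows "run (t + j) v = (if j = len p then (Suc p, 0, start (Suc p) v)
    else (p, j, exec E (phs ! p) (start p) j v))"
  using assms(3,4)
proof (induction j arbitrary: v)
  case 0
  then show ?case using assms(1,2) len_pos[of p] by auto
next
  case (Suc j)
  then have IH: "u \<in> V \<Longrightarrow> run (t + j) u = (p, j, exec E (phs ! p) (start p) j u)" for u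
    using Suc.IH[of u] by auto
  have "mach_output (phased ini phs out) (p, j, d) = None" for d
    using assms(1) by (simp add: phased_def)
  moreover have "mach_sent (phased ini phs out) (run (t + j) u) v
      = ph_send (phs ! p) j (exec E (phs ! p) (start p) j u) v" if "u \<in> N v" for u
    using IH[of u] that N_in_V assms(1) by (simp add: phased_def mach_sent_def)
  ultimately have "run (Suc (t + j)) v = mach_receive (phased ini phs out)
     (p, j, exec E (phs ! p) (start p) j v)
     (\<lambda>u. if u \<in> N v then ph_send (phs ! p) j (exec E (phs ! p) (start p) j u) v else None)"
    using IH[OF \<open>v \<in> V\<close>] \<open>v \<in> V\<close> by (simp cong: if_cong)
  also have "\<dots> = (if Suc j = len p then (Suc p, 0, exec E (phs ! p) (start p) (Suc j) v)
      else (p, Suc j, exec E (phs ! p) (start p) (Suc j) v))"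
  proof -
    have "mach_receive (phased ini phs out) (p, j, exec E (phs ! p) (start p) j v)
       (\<lambda>u. if u \<in> N v then ph_send (phs ! p) j (exec E (phs ! p) (start p) j u) v else None)
      = (if ph_over (phs ! p) (Suc j) (exec E (phs ! p) (start p) (Suc j) v)
         then (Suc p, 0, exec E (phs ! p) (start p) (Suc j) v)
         else (p, Suc j, exec E (phs ! p) (start p) (Suc j) v))"
      by (simp add: phased_def Let_def)
    then show ?thesis
      using over[of p "Suc j" v] Suc.prems assms(1) by (simp only: zero_less_Suc)
  qed
  also have "\<dots> = (if Suc j = len p then (Suc p, 0, start (Suc p) v)
      else (p, Suc j, exec E (phs ! p) (start p) (Suc j) v))"
    by (simp only: exec_phases.simps cong: if_cong)
  finally show ?case by simp
qed

private lemma phase_start: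
  "p \<le> length phs \<Longrightarrow> v \<in> V \<Longrightarrow> run (\<Sum>q<p. len q) v = (p, 0, start p v)"
proof (induction p arbitrary: v)
  case 0
  then show ?case by (simp add: phased_def)
next
  case (Suc p)
  then have "run ((\<Sum>q<p. len q) + len p) v = (Suc p, 0, start (Suc p) v)"
    by (subst within_phase[of p]) auto
  then show ?case by simp
qed

lemma phased_result:
  assumes "(\<Sum>q<length phs. len q) \<le> t" "v \<in> V"
  shows "mach_output (phased ini phs out) (run t v) = Some (out (start (length phs) v))"
proof -
  have "run ((\<Sum>q<length phs. len q) + i) v = (length phs, 0, start (length phs) v)" for i
  proof (induction i)
    case 0
    then show ?case using phase_start[of "length phs" v] assms by simp
  next
    case (Suc i)
    then show ?case by (simp add: phased_def)
  qed
  from this[of "t - (\<Sum>q<length phs. len q)"] assms show ?thesis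
    by (simp add: phased_def)
qed

text \<open>A terminated node is silent, and before termination the state is that of a phase in
  progress; message sizes can thus be bounded phase by phase.\<close>

lemma phased_sent:
  assumes "mach_sent (phased ini phs out) (run t v) u = Some m" "v \<in> V"
  shows "\<exists>p < length phs. \<exists>j < len p. ph_send (phs ! p) j (exec E (phs ! p) (start p) j v) u = Some m"
proof -
  have "t < (\<Sum>q<length phs. len q)"
    using phased_result[of t v] assms by (auto simp: mach_sent_def not_less[symmetric] split: if_splits)
  moreover have "p \<le> length phs \<Longrightarrow> t < (\<Sum>q<p. len q) \<Longrightarrow>
      \<exists>p' < p. \<exists>j < len p'. run t v = (p', j, exec E (phs ! p') (start p') j v)" for p
  proof (induction p)
    case (Suc p)
    show ?case
    proof (cases "t < (\<Sum>q<p. len q)")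
      case True
      with Suc show ?thesis by (auto intro: less_SucI)
    next
      case False
      define j where "j = t - (\<Sum>q<p. len q)"
      from False Suc.prems have j: "t = (\<Sum>q<p. len q) + j" "j < len p"
        by (auto simp: j_def)
      have "run t v = (p, j, exec E (phs ! p) (start p) j v)"
        unfolding j(1) using Suc.prems j(2) assms(2) phase_start[of p]
        by (subst within_phase[of p]) auto
      with j(2) show ?thesis by auto
    qed
  qed simp
  ultimately obtain p j where "p < length phs" "j < len p"
      "run t v = (p, j, exec E (phs ! p) (start p) j v)" by blast
  with assms show ?thesis by (auto simp: mach_sent_def phased_def split: if_splits)
qed

end

end

declare exec.simps(2) [simp del]

section \<open>The algorithm\<close>

text \<open>\<open>lev\<close> is the distance to the current leader and \<open>nlev\<close> the
  levels last reported by the neighbours. \<open>tbl d u x\<close> is the least distance to origin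
  \<open>x\<close> announced by neighbour \<open>u\<close>, \<open>told\<close> holds the pairs
  announced so far, and \<open>kfull\<close> the origins known to be full. \<open>ncov\<close> holds
  the cover bits of the neighbours, \<open>sel\<close> the origins for which an adjacent center
  selected this node, and \<open>chl\<close> the pairs of a child and an origin whose tree edge to
  this node is bought.\<close>

record node =
  self :: nat
  nbrs :: "nat set"
  src :: bool
  coin :: nat
  ldr :: nat
  lev :: nat
  alive :: bool
  ecc :: "nat option"
  nlev :: "nat \<Rightarrow> nat"
  cnt :: nat
  scnt :: nat
  tot :: "(nat \<times> nat) option"
  nlow :: "nat \<Rightarrow> bool"
  ncen :: "nat \<Rightarrow> bool"
  nroot :: "nat \<Rightarrow> bool"
  mems :: "nat set"
  tbl :: "nat \<Rightarrow> nat \<Rightarrow> nat option"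
  told :: "(nat \<times> nat) set"
  kfull :: "nat set"
  ncov :: "nat \<Rightarrow> nat \<Rightarrow> bool"
  sel :: "nat set"
  chl :: "(nat \<times> nat) set"

definition init_node :: "nat \<Rightarrow> nat set \<Rightarrow> bool \<Rightarrow> nat \<Rightarrow> node" where
  "init_node v A b g = \<lparr>self = v, nbrs = A, src = b, coin = g, ldr = v, lev = 0, alive = True,
     ecc = None, nlev = (\<lambda>_. 0), cnt = 1, scnt = of_bool b, tot = None,
     nlow = (\<lambda>_. False), ncen = (\<lambda>_. False), nroot = (\<lambda>_. False), mems = {},
     tbl = (\<lambda>_ _. None), told = {}, kfull = {}, ncov = (\<lambda>_ _. False), sel = {}, chl = {}\<rparr>"

definition blank :: "node \<Rightarrow> bool" where
  "blank d \<longleftrightarrow> tbl d = (\<lambda>_ _. None) \<and> told d = {} \<and> kfull d = {} \<and> ncov d = (\<lambda>_ _. False)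
     \<and> sel d = {} \<and> chl d = {}"

text \<open>The least identifier is flooded. A node adopting a new leader at level \<open>j\<close>, hence at time
  \<open>j\<close>, sends an \<^emph>\<open>alive\<close> bit back towards it, which arrives at time \<open>2 j\<close>. A node that is still its
  own leader at time \<open>2 j\<close> and does not receive the bit has eccentricity \<open>j - 1\<close>.\<close>

definition new_leader :: "node \<Rightarrow> (nat \<Rightarrow> word4 option) \<Rightarrow> nat" where
  "new_leader d i = (LEAST m. m = ldr d \<or> (\<exists>u\<in>nbrs d. \<exists>w. i u = Some (m, w)))"

definition new_alive :: "node \<Rightarrow> (nat \<Rightarrow> word4 option) \<Rightarrow> bool" where
  "new_alive d i \<longleftrightarrow> new_leader d i < ldr d \<or>
    (\<exists>u\<in>nbrs d. \<exists>w. i u = Some (ldr d, Suc (lev d), 1, w))"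

text \<open>The leader learns its eccentricity \<open>e\<close> at time \<open>2 * e + 2\<close> and
  spreads it, coded as \<open>Suc e\<close> with \<open>0\<close> for unknown. All nodes know it by
  time \<open>3 * e + 2\<close>, so the common stopping time \<open>3 * e + 3\<close> can be
  recognized by each node alone.\<close>

definition leader_phase :: "node phase" where
  "leader_phase = \<lparr>
     ph_send = (\<lambda>c d u. Some (ldr d, lev d, of_bool (alive d),
       case ecc d of None \<Rightarrow> 0 | Some e \<Rightarrow> Suc e)),
     ph_receive = (\<lambda>c d i. d\<lparr>
       ldr := new_leader d i,
       lev := (if new_leader d i < ldr d then Suc c else lev d),
       alive := new_alive d i,
       ecc := (if ecc d \<noteq> None then ecc d
         else if new_leader d i = self d \<and> even (Suc c) \<and> \<not> new_alive d i
           then Some (Suc c div 2 - 1)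
         else if \<exists>u\<in>nbrs d. \<exists>p q r w. i u = Some (p, q, r, Suc w)
           then Some (LEAST w. \<exists>u\<in>nbrs d. \<exists>p q r. i u = Some (p, q, r, Suc w))
         else None),
       nlev := (\<lambda>u. case i u of Some (p, l, w) \<Rightarrow> l | None \<Rightarrow> 0)\<rparr>),
     ph_over = (\<lambda>c d. \<exists>e. ecc d = Some e \<and> 3 * e + 3 \<le> c)\<rparr>"

abbreviation ecc_of :: "node \<Rightarrow> nat" where "ecc_of d \<equiv> the (ecc d)"

definition tree_parent :: "node \<Rightarrow> nat" where
  "tree_parent d = (LEAST u. u \<in> nbrs d \<and> lev d = Suc (nlev d u))"

text \<open>Convergecast by level: with eccentricity \<open>e\<close>, a node at level
  \<open>l\<close> sends in round \<open>e - l\<close>, one round after its children.\<close>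

definition sum_phase :: "node phase" where
  "sum_phase = \<lparr>
     ph_send = (\<lambda>c d u. if c + lev d = ecc_of d \<and> 0 < lev d \<and> u = tree_parent d
       then Some (cnt d, scnt d, 0, 0) else None),
     ph_receive = (\<lambda>c d i. d\<lparr>
       cnt := cnt d + (\<Sum>u\<in>nbrs d. case i u of Some (p, w) \<Rightarrow> p | None \<Rightarrow> 0),
       scnt := scnt d + (\<Sum>u\<in>nbrs d. case i u of Some (p, q, w) \<Rightarrow> q | None \<Rightarrow> 0)\<rparr>),
     ph_over = (\<lambda>c d. ecc_of d + 1 \<le> c)\<rparr>"

definition known_total :: "node \<Rightarrow> (nat \<times> nat) option" where
  "known_total d = (if lev d = 0 then Some (cnt d, scnt d) else tot d)"

definition broadcast_phase :: "node phase" where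
  "broadcast_phase = \<lparr>
     ph_send = (\<lambda>c d u. case known_total d of None \<Rightarrow> None | Some (n, k) \<Rightarrow> Some (n, k, 0, 0)),
     ph_receive = (\<lambda>c d i. d\<lparr>tot :=
       (if known_total d \<noteq> None then known_total d
        else if \<exists>u\<in>nbrs d. i u \<noteq> None
        then (let w = the (i (LEAST u. u \<in> nbrs d \<and> i u \<noteq> None)) in Some (fst w, fst (snd w)))
        else None)\<rparr>),
     ph_over = (\<lambda>c d. ecc_of d + 1 \<le> c)\<rparr>"

abbreviation nodes_of :: "node \<Rightarrow> nat" where "nodes_of d \<equiv> fst (the (tot d))"
abbreviation sources_of :: "node \<Rightarrow> nat" where "sources_of d \<equiv> snd (the (tot d))"

definition lex_less :: "nat \<times> nat \<Rightarrow> nat \<times> nat \<Rightarrow> bool" where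
  "lex_less p q \<longleftrightarrow> fst p < fst q \<or> fst p = fst q \<and> snd p < snd q"

definition coded_bool :: "nat \<Rightarrow> bool" where "coded_bool b \<longleftrightarrow> b = 1"

lemma coded_bool_of_bool [simp]: "coded_bool (of_bool b) = b"
  by (simp add: coded_bool_def)

text \<open>The rules are parameters that take \<open>n\<close> and \<open>|S|\<close> as arguments,
  since their thresholds become computable only after the broadcast. The protocol is analysed for
  arbitrary rules; \<open>slack\<close> is the intended bound on the number of origins per
  source.\<close>

locale spanner_algorithm =
  fixes low_rule :: "nat \<Rightarrow> nat \<Rightarrow> nat \<Rightarrow> bool"
    and center_rule root_rule :: "nat \<Rightarrow> nat \<Rightarrow> nat \<Rightarrow> bool"
    and full_rule :: "nat \<Rightarrow> nat \<Rightarrow> bool"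
    and slack :: nat
begin

definition is_low :: "node \<Rightarrow> bool" where
  "is_low d = low_rule (nodes_of d) (sources_of d) (card (nbrs d))"
definition is_center :: "node \<Rightarrow> bool" where
  "is_center d = center_rule (nodes_of d) (sources_of d) (coin d)"
definition is_root :: "node \<Rightarrow> bool" where
  "is_root d = root_rule (nodes_of d) (sources_of d) (coin d)"
definition is_origin :: "node \<Rightarrow> bool" where
  "is_origin d \<longleftrightarrow> src d \<or> is_root d"
definition is_full :: "node \<Rightarrow> bool" where
  "is_full d \<longleftrightarrow> is_root d \<or> src d \<and> full_rule (nodes_of d) (sources_of d)"

definition flag_phase :: "node phase" where
  "flag_phase = \<lparr>
     ph_send = (\<lambda>c d u. Some (of_bool (is_low d), of_bool (is_center d), of_bool (is_root d), 0)),
     ph_receive = (\<lambda>c d i. d\<lparr>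
       nlow := (\<lambda>u. \<exists>w. i u = Some (1, w)),
       ncen := (\<lambda>u. \<exists>p w. i u = Some (p, 1, w)),
       nroot := (\<lambda>u. \<exists>p q w. i u = Some (p, q, 1, w))\<rparr>),
     ph_over = (\<lambda>c d. 1 \<le> c)\<rparr>"

definition center_of :: "node \<Rightarrow> nat option" where
  "center_of d = (if \<not> is_low d \<and> (\<exists>u\<in>nbrs d. ncen d u)
     then Some (LEAST u. u \<in> nbrs d \<and> ncen d u) else None)"

definition join_phase :: "node phase" where
  "join_phase = \<lparr>
     ph_send = (\<lambda>c d u. if center_of d = Some u then Some (0, 0, 0, 0) else None),
     ph_receive = (\<lambda>c d i. d\<lparr>mems := {u \<in> nbrs d. i u \<noteq> None}\<rparr>),
     ph_over = (\<lambda>c d. 1 \<le> c)\<rparr>"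

text \<open>Distances are at most twice the eccentricity, and a rank is at most the number of
  origins; if the latter is at most \<open>slack * |S|\<close>, every time slot is smaller than this
  length.\<close>

definition wave_len :: "node \<Rightarrow> nat" where
  "wave_len d = 2 * ecc_of d + slack * sources_of d + 1"

definition best :: "node \<Rightarrow> nat \<Rightarrow> nat option" where
  "best d x = (if x = self d \<and> is_origin d then Some 0
     else if \<exists>u\<in>nbrs d. tbl d u x \<noteq> None
     then Some (Suc (LEAST k. \<exists>u\<in>nbrs d. tbl d u x = Some k)) else None)"

definition knows_full :: "node \<Rightarrow> nat \<Rightarrow> bool" where
  "knows_full d x \<longleftrightarrow> x = self d \<and> is_full d \<or> x \<in> kfull d"

definition pending :: "node \<Rightarrow> (nat \<times> nat) set" where
  "pending d = {(k, x). best d x = Some k \<and> (k, x) \<notin> told d}"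

definition next_pair :: "node \<Rightarrow> nat \<times> nat" where
  "next_pair d = (let k = (LEAST k. \<exists>x. (k, x) \<in> pending d) in (k, LEAST x. (k, x) \<in> pending d))"

text \<open>In every round a node announces the lexicographically least pair of distance and origin that it
  has not announced yet. The correct pair for \<open>x\<close> is announced in round \<open>slot x\<close> at the latest, so
  the slots are a collision-free schedule for the later waves along the same trees.\<close>

definition bfs_phase :: "node phase" where
  "bfs_phase = \<lparr>
     ph_send = (\<lambda>c d u. if pending d = {} then None
       else Some (snd (next_pair d), fst (next_pair d), of_bool (knows_full d (snd (next_pair d))), 0)),
     ph_receive = (\<lambda>c d i. d\<lparr>
       tbl := (\<lambda>u x. case i u of None \<Rightarrow> tbl d u x
         | Some (y, k, w) \<Rightarrow> if x \<noteq> y then tbl d u x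
             else Some (case tbl d u x of None \<Rightarrow> k | Some k' \<Rightarrow> min k k')),
       told := (if pending d = {} then told d else insert (next_pair d) (told d)),
       kfull := kfull d \<union> {x. \<exists>u\<in>nbrs d. \<exists>k w. i u = Some (x, k, 1, w)}\<rparr>),
     ph_over = (\<lambda>c d. wave_len d \<le> c)\<rparr>"

definition slot :: "node \<Rightarrow> nat \<Rightarrow> nat" where
  "slot d x = the (best d x) +
     card {y. best d y \<noteq> None \<and> lex_less (the (best d y), y) (the (best d x), x)}"

definition bfs_parent :: "node \<Rightarrow> nat \<Rightarrow> nat" where
  "bfs_parent d x = (LEAST u. u \<in> nbrs d \<and> best d x = Some (Suc (the (tbl d u x))))"

definition covered :: "node \<Rightarrow> nat \<Rightarrow> bool" where
  "covered d x \<longleftrightarrow> (\<exists>u\<in>nbrs d. nroot d u) \<or> x \<noteq> self d \<and> ncov d (bfs_parent d x) x"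

definition slot_at :: "node \<Rightarrow> nat \<Rightarrow> nat \<Rightarrow> bool" where
  "slot_at d c x \<longleftrightarrow> best d x \<noteq> None \<and> slot d x = c"

definition cover_phase :: "node phase" where
  "cover_phase = \<lparr>
     ph_send = (\<lambda>c d u. if \<exists>x. slot_at d c x
       then let x = (LEAST x. slot_at d c x) in Some (x, of_bool (covered d x), 0, 0) else None),
     ph_receive = (\<lambda>c d i. d\<lparr>ncov := (\<lambda>u x. case i u of
         Some (y, b, w) \<Rightarrow> if x = y then coded_bool b else ncov d u x | None \<Rightarrow> ncov d u x)\<rparr>),
     ph_over = (\<lambda>c d. wave_len d \<le> c)\<rparr>"

text \<open>With the nearest uncovered member, the detour through the center is short for every
  other uncovered member as well. Full origins need no path, as their whole tree is kept.\<close>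

definition choice :: "node \<Rightarrow> nat \<Rightarrow> nat option" where
  "choice d x = (let A = {z \<in> mems d. \<not> ncov d z x} in
     if A = {} \<or> knows_full d x then None
     else Some (LEAST z. z \<in> A \<and> (\<forall>z' \<in> A. the (tbl d z x) \<le> the (tbl d z' x))))"

definition choose_phase :: "node phase" where
  "choose_phase = \<lparr>
     ph_send = (\<lambda>c d u. if \<exists>x. slot_at d c x \<and> choice d x = Some u
       then Some (LEAST x. slot_at d c x, 0, 0, 0) else None),
     ph_receive = (\<lambda>c d i. d\<lparr>sel := sel d \<union> {x. \<exists>u\<in>nbrs d. \<exists>w. i u = Some (x, w)}\<rparr>),
     ph_over = (\<lambda>c d. wave_len d \<le> c)\<rparr>"

definition buys :: "node \<Rightarrow> nat \<Rightarrow> bool" where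
  "buys d x \<longleftrightarrow> knows_full d x \<or> x \<in> sel d \<or> (\<exists>u. (u, x) \<in> chl d)"

definition upcast_at :: "node \<Rightarrow> nat \<Rightarrow> nat \<Rightarrow> bool" where
  "upcast_at d c x \<longleftrightarrow> best d x \<noteq> None \<and> slot d x + Suc c = wave_len d"

text \<open>The schedule is reversed in time: the slot of a node follows that of its parent.\<close>

definition upcast_phase :: "node phase" where
  "upcast_phase = \<lparr>
     ph_send = (\<lambda>c d u. if \<exists>x. upcast_at d c x \<and> x \<noteq> self d \<and> buys d x \<and> u = bfs_parent d x
       then Some (LEAST x. upcast_at d c x, 0, 0, 0) else None),
     ph_receive = (\<lambda>c d i. d\<lparr>chl := chl d \<union> {(u, x). u \<in> nbrs d \<and> (\<exists>w. i u = Some (x, w))}\<rparr>),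
     ph_over = (\<lambda>c d. wave_len d \<le> c)\<rparr>"

text \<open>Every reason for keeping an edge is listed from both ends: \<open>is_low\<close> and
  \<open>nlow\<close>, \<open>center_of\<close> and \<open>mems\<close>, \<open>bfs_parent\<close>
  and \<open>chl\<close>. This makes the outputs of the two endpoints consistent.\<close>

definition result :: "node \<Rightarrow> nat set" where
  "result d = {u \<in> nbrs d. is_low d \<or> nlow d u} \<union> {u. center_of d = Some u} \<union> mems d
     \<union> {bfs_parent d x | x. best d x \<noteq> None \<and> x \<noteq> self d \<and> buys d x} \<union> fst ` chl d"

definition phases :: "node phase list" where
  "phases = [leader_phase, sum_phase, broadcast_phase, flag_phase, join_phase, bfs_phase,
     cover_phase, choose_phase, upcast_phase]"

end

section \<open>Leader election\<close>

lemma leader_send: "ph_send leader_phase c d u = Some (ldr d, lev d, of_bool (alive d),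
    case ecc d of None \<Rightarrow> 0 | Some e \<Rightarrow> Suc e)"
  by (simp add: leader_phase_def)

lemma leader_over: "ph_over leader_phase c d \<longleftrightarrow> (\<exists>e. ecc d = Some e \<and> 3 * e + 3 \<le> c)"
  by (simp add: leader_phase_def)

lemma leader_receive:
  "ldr (ph_receive leader_phase c d i) = new_leader d i"
  "lev (ph_receive leader_phase c d i) = (if new_leader d i < ldr d then Suc c else lev d)"
  "alive (ph_receive leader_phase c d i) = new_alive d i"
  "ecc (ph_receive leader_phase c d i) = (if ecc d \<noteq> None then ecc d
    else if new_leader d i = self d \<and> even (Suc c) \<and> \<not> new_alive d i
      then Some (Suc c div 2 - 1)
    else if \<exists>u\<in>nbrs d. \<exists>p q r w. i u = Some (p, q, r, Suc w)
      then Some (LEAST w. \<exists>u\<in>nbrs d. \<exists>p q r. i u = Some (p, q, r, Suc w))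
    else None)"
  "nlev (ph_receive leader_phase c d i) u = (case i u of Some (p, l, w) \<Rightarrow> l | None \<Rightarrow> 0)"
  unfolding leader_phase_def by simp_all

section \<open>Least identifiers in growing balls\<close>

context net
begin

definition min_within :: "nat \<Rightarrow> nat \<Rightarrow> nat" where
  "min_within t v = (LEAST u. u \<in> V \<and> dist u v \<le> t)"

lemma min_within:
  assumes "v \<in> V"
  shows "min_within t v \<in> V" "dist (min_within t v) v \<le> t"
proof -
  have "\<exists>u. u \<in> V \<and> dist u v \<le> t" using assms by (intro exI[of _ v]) auto
  from LeastI_ex[OF this] show "min_within t v \<in> V" "dist (min_within t v) v \<le> t"
    by (auto simp: min_within_def)
qed

lemma min_within_le: "u \<in> V \<Longrightarrow> dist u v \<le> t \<Longrightarrow> min_within t v \<le> u"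
  unfolding min_within_def by (rule Least_le) auto

lemma min_within_antimono: "v \<in> V \<Longrightarrow> s \<le> t \<Longrightarrow> min_within t v \<le> min_within s v"
  using min_within[of v s] by (intro min_within_le) auto

lemma min_within_0: "v \<in> V \<Longrightarrow> min_within 0 v = v"
  using min_within[of v 0] dist_zero by simp

text \<open>The ball of radius \<open>Suc t\<close> around \<open>v\<close> is the union of the
  balls of radius \<open>t\<close> around \<open>v\<close> and its neighbours, so a round of
  flooding advances the radius by one.\<close>

lemma min_within_Suc:
  assumes "v \<in> V"
  shows "(LEAST m. m = min_within t v \<or> (\<exists>u \<in> N v. m = min_within t u)) = min_within (Suc t) v"
proof (rule Least_equality)
  let ?m = "min_within (Suc t) v"
  have m: "?m \<in> V" "dist ?m v \<le> Suc t" using min_within[OF assms] by auto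
  have le: "?m \<le> min_within t v" using min_within_antimono[OF assms] by simp
  have le': "?m \<le> min_within t u" if "u \<in> N v" for u
    using min_within[of u t] N_in_V[OF that] dist_N[OF that, of "min_within t u"]
    by (intro min_within_le) auto
  show "?m = min_within t v \<or> (\<exists>u \<in> N v. ?m = min_within t u)"
  proof (cases "dist ?m v \<le> t")
    case True
    then show ?thesis using min_within_le[OF m(1) True] le by simp
  next
    case False
    then have "?m \<noteq> v" by auto
    with ex_closer[OF m(1) assms] m(2) obtain u where u: "u \<in> N v" "dist ?m u \<le> t" by auto
    then show ?thesis using min_within_le[OF m(1) u(2)] le'[OF u(1)] by (intro disjI2 bexI[of _ u]) auto
  qed
  show "?m \<le> y" if "y = min_within t v \<or> (\<exists>u \<in> N v. y = min_within t u)" for y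
    using that le le' by auto
qed

text \<open>The ball of radius \<open>s\<close> around \<open>x\<close> contains \<open>r\<close>
  and lies inside the ball of radius \<open>T\<close> around \<open>r\<close>, where
  \<open>r\<close> is least.\<close>

lemma min_within_eqI:
  assumes "min_within T r = r" "r \<in> V" "x \<in> V" "dist r x \<le> s" "s + dist r x \<le> T"
  shows "min_within s x = r"
proof (rule antisym)
  show "min_within s x \<le> r" using assms by (intro min_within_le) auto
  let ?m = "min_within s x"
  have m: "?m \<in> V" "dist ?m x \<le> s" using min_within[OF assms(3)] by auto
  have "dist ?m r \<le> T"
    using dist_triangle[of ?m x r] dist_sym[of x r] m assms by simp
  from min_within_le[OF m(1) this] assms(1) show "r \<le> ?m" by simp
qed

definition leader :: nat where "leader = (LEAST u. u \<in> V)"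

lemma leader_in_V [simp]: "leader \<in> V"
  unfolding leader_def using V_nonempty by (meson LeastI ex_in_conv)

lemma leader_le: "u \<in> V \<Longrightarrow> leader \<le> u"
  unfolding leader_def by (rule Least_le)

lemma min_within_leader_iff: "v \<in> V \<Longrightarrow> min_within t v = leader \<longleftrightarrow> dist leader v \<le> t"
  using min_within[of v t] min_within_le[of leader v t] leader_le[of "min_within t v"] by force

definition radius :: nat where "radius = Max (dist leader ` V)"

lemma dist_le_radius: "v \<in> V \<Longrightarrow> dist leader v \<le> radius"
  unfolding radius_def by simp

lemma ex_at_radius: "\<exists>v \<in> V. dist leader v = radius"
  unfolding radius_def using Max_in[of "dist leader ` V"] V_nonempty by fastforce

section \<open>Flooding, echo and eccentricity\<close>

context
  fixes d :: "nat \<Rightarrow> node"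
  assumes init: "\<And>v. v \<in> V \<Longrightarrow> self (d v) = v \<and> nbrs (d v) = N v \<and> ldr (d v) = v \<and> lev (d v) = 0
    \<and> alive (d v) \<and> ecc (d v) = None"
begin

private abbreviation "st \<equiv> exec E leader_phase d"

lemma leader_phase_frame:
  "self (st t v) = self (d v)" "nbrs (st t v) = nbrs (d v)" "src (st t v) = src (d v)"
  "coin (st t v) = coin (d v)" "cnt (st t v) = cnt (d v)" "scnt (st t v) = scnt (d v)"
  "tot (st t v) = tot (d v)" "blank (st t v) = blank (d v)"
  by (rule exec_invariant; simp add: leader_phase_def blank_def)+

lemma leader_phase_ldr: "v \<in> V \<Longrightarrow> ldr (st t v) = min_within t v"
proof (induction t arbitrary: v)
  case 0
  then show ?case using init by (simp add: min_within_0)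
next
  case (Suc t)
  have "(LEAST m. m = ldr (st t v) \<or> (\<exists>u\<in>N v. m = ldr (st t u)))
    = (LEAST m. m = min_within t v \<or> (\<exists>u\<in>N v. m = min_within t u))"
    using Suc N_in_V by (metis (no_types, lifting))
  moreover have "new_leader (st t v) (\<lambda>u. if u \<in> N v then Some (ldr (st t u), g u) else None)
      = (LEAST m. m = ldr (st t v) \<or> (\<exists>u\<in>N v. m = ldr (st t u)))"
    for g :: "nat \<Rightarrow> nat \<times> nat \<times> nat"
    unfolding new_leader_def using leader_phase_frame(2)[of t v] init[OF Suc.prems]
    by (intro arg_cong[where f = Least] ext) (auto, (metis surj_pair)+)
  ultimately show ?case
    using min_within_Suc[OF Suc.prems, of t]
    by (simp add: leader_receive leader_send exec.simps(2) cong: if_cong)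
qed

lemma st_Suc:
  assumes "v \<in> V"
  shows "lev (st (Suc t) v) = (if min_within (Suc t) v < min_within t v then Suc t else lev (st t v))"
    "alive (st (Suc t) v) \<longleftrightarrow> min_within (Suc t) v < min_within t v \<or>
      (\<exists>u\<in>N v. min_within t u = min_within t v \<and> lev (st t u) = Suc (lev (st t v)) \<and> alive (st t u))"
    "ecc (st (Suc t) v) = (if ecc (st t v) \<noteq> None then ecc (st t v)
       else if min_within (Suc t) v = v \<and> even (Suc t) \<and> \<not> alive (st (Suc t) v)
         then Some (Suc t div 2 - 1)
       else if \<exists>u\<in>N v. ecc (st t u) \<noteq> None then Some (LEAST w. \<exists>u\<in>N v. ecc (st t u) = Some w)
       else None)"
proof -
  have V: "\<And>u. u \<in> N v \<Longrightarrow> u \<in> V" using N_in_V by blast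
  have step: "st (Suc t) v = ph_receive leader_phase t (st t v)
     (\<lambda>u. if u \<in> N v then Some (ldr (st t u), lev (st t u), of_bool (alive (st t u)),
       case ecc (st t u) of None \<Rightarrow> 0 | Some e \<Rightarrow> Suc e) else None)"
    by (simp only: leader_send exec.simps)
  define i :: "nat \<Rightarrow> word4 option" where
    "i = (\<lambda>u. if u \<in> N v then Some (ldr (st t u), lev (st t u), of_bool (alive (st t u)),
       case ecc (st t u) of None \<Rightarrow> 0 | Some e \<Rightarrow> Suc e) else None)"
  have m: "(LEAST m. m = ldr (st t v) \<or> (\<exists>u\<in>N v. \<exists>w. i u = Some (m, w))) = min_within (Suc t) v"
    using leader_phase_ldr[OF assms, of "Suc t"] leader_phase_frame(2)[of t v] init[OF assms]
    unfolding step i_def[symmetric] by (simp add: leader_receive(1) new_leader_def)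
  have a: "(\<exists>u\<in>N v. \<exists>w. i u = Some (min_within t v, Suc (lev (st t v)), 1, w)) \<longleftrightarrow>
      (\<exists>u\<in>N v. min_within t u = min_within t v \<and> lev (st t u) = Suc (lev (st t v)) \<and> alive (st t u))"
    by (auto simp: i_def leader_phase_ldr V of_bool_def)
  have e: "(\<exists>u\<in>N v. \<exists>p q r. i u = Some (p, q, r, Suc w)) \<longleftrightarrow> (\<exists>u\<in>N v. ecc (st t u) = Some w)" for w
    by (auto simp: i_def split: option.splits)
  have e': "(\<exists>u\<in>N v. \<exists>p q r w. i u = Some (p, q, r, Suc w)) \<longleftrightarrow> (\<exists>u\<in>N v. ecc (st t u) \<noteq> None)"
    using e by blast
  have frame: "self (st t v) = v" "nbrs (st t v) = N v" "ldr (st t v) = min_within t v"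
    using leader_phase_frame(1,2)[of t v] init[OF assms] leader_phase_ldr[OF assms] by auto
  have l: "new_leader (st t v) i = min_within (Suc t) v"
    using m frame by (simp add: new_leader_def)
  have l': "new_alive (st t v) i \<longleftrightarrow> min_within (Suc t) v < min_within t v \<or>
      (\<exists>u\<in>N v. min_within t u = min_within t v \<and> lev (st t u) = Suc (lev (st t v)) \<and> alive (st t u))"
    by (simp only: new_alive_def l frame a)
  show "lev (st (Suc t) v) = (if min_within (Suc t) v < min_within t v then Suc t else lev (st t v))"
    unfolding step i_def[symmetric] leader_receive(2) l frame by (rule refl)
  show "alive (st (Suc t) v) \<longleftrightarrow> min_within (Suc t) v < min_within t v \<or>
      (\<exists>u\<in>N v. min_within t u = min_within t v \<and> lev (st t u) = Suc (lev (st t v)) \<and> alive (st t u))"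
    unfolding step i_def[symmetric] by (simp only: leader_receive(3) l')
  show "ecc (st (Suc t) v) = (if ecc (st t v) \<noteq> None then ecc (st t v)
       else if min_within (Suc t) v = v \<and> even (Suc t) \<and> \<not> alive (st (Suc t) v)
         then Some (Suc t div 2 - 1)
       else if \<exists>u\<in>N v. ecc (st t u) \<noteq> None then Some (LEAST w. \<exists>u\<in>N v. ecc (st t u) = Some w)
       else None)"
    unfolding step i_def[symmetric] by (simp only: leader_receive(3,4) l frame e e')
qed

lemma leader_phase_lev: "v \<in> V \<Longrightarrow> lev (st t v) = dist (min_within t v) v"
proof (induction t)
  case 0
  then show ?case using init by (simp add: min_within_0)
next
  case (Suc t)
  show ?case
  proof (cases "min_within (Suc t) v < min_within t v")
    case True
    \<comment> \<open>A smaller identifier found in round \<open>Suc t\<close> cannot lie within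
      distance \<open>t\<close>, so its distance is exactly the round number stored as the
      level.\<close>
    then have "\<not> dist (min_within (Suc t) v) v \<le> t"
      using min_within_le[of "min_within (Suc t) v" v t] min_within[OF Suc.prems, of "Suc t"] by auto
    with min_within(2)[OF Suc.prems, of "Suc t"] True show ?thesis
      by (simp add: st_Suc[OF Suc.prems])
  next
    case False
    with min_within_antimono[OF Suc.prems, of t "Suc t"]
    have "min_within (Suc t) v = min_within t v" by simp
    then show ?thesis using Suc by (simp add: st_Suc[OF Suc.prems])
  qed
qed

text \<open>Echo: \<open>w\<close> adopts \<open>r\<close> exactly at time \<open>J\<close> and
  becomes alive (for \<open>J = 0\<close> by initialization). The bit climbs the tree path one node
  per round and arrives at time \<open>2 * J\<close>. Meanwhile \<open>r\<close> remains the leader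
  on the path, because it is least in its ball of radius \<open>2 * J\<close>.\<close>

lemma alive_complete:
  assumes r: "r \<in> V" "min_within (2 * J) r = r" and w: "w \<in> V" "dist r w = J"
  shows "alive (st (2 * J) r)"
proof -
  have "k \<le> J \<Longrightarrow> alive (st (J + k) ((par r ^^ k) w))" for k
  proof (induction k)
    case 0
    show ?case
    proof (cases J)
      case 0
      then show ?thesis using init[OF w(1)] by simp
    next
      case (Suc j)
      have "min_within J w = r" using assms by (simp add: min_within_eqI[of "2 * J" r])
      moreover have "min_within j w \<noteq> r" using min_within(2)[OF w(1), of j] w(2) Suc by auto
      ultimately have "min_within (Suc j) w < min_within j w"
        using min_within_antimono[OF w(1), of j "Suc j"] Suc by simp
      then show ?thesis using st_Suc(2)[OF w(1), of j] Suc by simp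
    qed
  next
    case (Suc k)
    let ?x = "(par r ^^ k) w" and ?y = "(par r ^^ Suc k) w"
    have x: "?x \<in> V" "dist r ?x = J - k" using par_iter[OF r(1) w(1), of k] Suc.prems w by auto
    have y: "?y \<in> V" "dist r ?y = J - Suc k" using par_iter[OF r(1) w(1), of "Suc k"] Suc.prems w by auto
    from x Suc.prems have "r \<noteq> ?x" by auto
    with par[OF r(1) x(1)] have xy: "?x \<in> N ?y" using N_sym by auto
    have m: "min_within (J + k) ?x = r" "min_within (J + k) ?y = r"
      using assms x y Suc.prems by (simp_all add: min_within_eqI[of "2 * J" r] del: funpow.simps)
    have "lev (st (J + k) ?x) = Suc (lev (st (J + k) ?y))"
      unfolding leader_phase_lev[OF x(1)] leader_phase_lev[OF y(1)] m x(2) y(2) using Suc.prems by simp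
    moreover have "alive (st (J + k) ?x)" using Suc by simp
    ultimately have "\<exists>u\<in>N ?y. min_within (J + k) u = min_within (J + k) ?y \<and>
        lev (st (J + k) u) = Suc (lev (st (J + k) ?y)) \<and> alive (st (J + k) u)"
      using xy m by (metis (no_types, lifting))
    then show ?case using st_Suc(2)[OF y(1), of "J + k"] unfolding add_Suc_right by blast
  qed
  from this[of J] have "alive (st (2 * J) ((par r ^^ J) w))" by (simp add: mult_2)
  moreover have "(par r ^^ J) w = r" using par_iter[OF r(1) w(1), of J] w r dist_zero by force
  ultimately show ?thesis by simp
qed

text \<open>Each hop of the bit costs one round and lowers the distance to the leader by one, so
  \<open>t + dist leader v\<close> is constant along its route. At the adopting node, time and
  distance are equal and at most \<open>radius\<close>.\<close>

lemma alive_sound: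
  "v \<in> V \<Longrightarrow> min_within t v = leader \<Longrightarrow> alive (st t v) \<Longrightarrow> t + dist leader v \<le> 2 * radius"
proof (induction t arbitrary: v)
  case 0
  then show ?case by (simp add: min_within_0)
next
  case (Suc t)
  consider "min_within (Suc t) v < min_within t v"
    | u where "\<not> min_within (Suc t) v < min_within t v" "u \<in> N v" "min_within t u = min_within t v"
      "lev (st t u) = Suc (lev (st t v))" "alive (st t u)"
    using Suc.prems(3) st_Suc(2)[OF Suc.prems(1)] by blast
  then show ?case
  proof cases
    case 1
    then have "dist leader v = Suc t"
      using Suc.prems min_within_leader_iff[of v t] min_within_leader_iff[of v "Suc t"] by auto
    then show ?thesis using dist_le_radius[OF Suc.prems(1)] by simp
  next
    case 2
    then have "min_within t v = leader"
      using min_within_antimono[OF Suc.prems(1), of t "Suc t"] Suc.prems by simp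
    with 2 Suc.IH[of u] Suc.prems N_in_V[OF 2(2)] show ?thesis by (simp add: leader_phase_lev)
  qed
qed

lemma leader_phase_ecc:
  "v \<in> V \<Longrightarrow> ecc (st t v) = (if 2 * radius + 2 + dist leader v \<le> t then Some radius else None)"
proof (induction t arbitrary: v)
  case 0
  then show ?case using init by simp
next
  case (Suc t)
  have nb: "ecc (st t u) = (if 2 * radius + 2 + dist leader u \<le> t then Some radius else None)"
    if "u \<in> N v" for u using Suc.IH that N_in_V by blast
  show ?case
  proof (cases "2 * radius + 2 + dist leader v \<le> t")
    case True
    then show ?thesis using Suc by (simp add: st_Suc(3))
  next
    case no: False
    then have none: "ecc (st t v) = None" using Suc by simp
    show ?thesis
    proof (cases "v = leader")
      case True
      have "\<not> (\<exists>u\<in>N v. ecc (st t u) \<noteq> None)"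
        using nb no True by auto
      moreover have "min_within (Suc t) v = v" using min_within_leader_iff[of v "Suc t"] True by simp
      moreover have "even (Suc t) \<and> \<not> alive (st (Suc t) v) \<longleftrightarrow> Suc t = 2 * radius + 2"
      proof
        assume t: "Suc t = 2 * radius + 2"
        then have "\<not> alive (st (Suc t) v)"
          using alive_sound[of v "Suc t"] \<open>min_within (Suc t) v = v\<close> True by auto
        with t show "even (Suc t) \<and> \<not> alive (st (Suc t) v)" by simp
      next
        assume a: "even (Suc t) \<and> \<not> alive (st (Suc t) v)"
        then obtain J where J: "Suc t = 2 * J" by blast
        \<comment> \<open>Some node lies at each distance up to \<open>radius\<close>, and its echo
          keeps the bit alive at the corresponding even time.\<close>
        have "\<not> J \<le> radius"
        proof
          assume "J \<le> radius"
          then obtain w where "w \<in> V" "dist leader w = J"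
            using ex_at_radius ex_node_at_dist[of leader] by (metis leader_in_V)
          with alive_complete[of v J w] J a True \<open>min_within (Suc t) v = v\<close> show False by auto
        qed
        with J no True show "Suc t = 2 * radius + 2" by auto
      qed
      ultimately show ?thesis using none no True Suc.prems
        by (auto simp: st_Suc(3))
    next
      case False
      \<comment> \<open>A node that wrongly considers itself leader at time \<open>2 * J\<close> has
        the true leader beyond distance \<open>2 * J\<close>, hence some node at distance
        \<open>J\<close>. The echo of that node prevents a false eccentricity.\<close>
      have "\<not> (min_within (Suc t) v = v \<and> even (Suc t) \<and> \<not> alive (st (Suc t) v))"
      proof
        assume a: "min_within (Suc t) v = v \<and> even (Suc t) \<and> \<not> alive (st (Suc t) v)"
        then obtain J where J: "Suc t = 2 * J" by blast
        have "\<not> dist leader v \<le> Suc t"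
          using min_within_leader_iff[OF Suc.prems, of "Suc t"] a False by auto
        then have "J \<le> dist v leader" using J dist_sym[of v leader] Suc.prems by simp
        then obtain w where "w \<in> V" "dist v w = J"
          using ex_node_at_dist[OF Suc.prems leader_in_V] by blast
        with alive_complete[of v J w] J a Suc.prems show False by auto
      qed
      moreover have "(\<exists>u\<in>N v. ecc (st t u) \<noteq> None) \<longleftrightarrow> 2 * radius + 2 + dist leader v \<le> Suc t"
      proof
        assume "\<exists>u\<in>N v. ecc (st t u) \<noteq> None"
        then obtain u where u: "u \<in> N v" "2 * radius + 2 + dist leader u \<le> t" using nb by (auto split: if_splits)
        with dist_N[OF u(1), of leader] show "2 * radius + 2 + dist leader v \<le> Suc t" by simp
      next
        assume "2 * radius + 2 + dist leader v \<le> Suc t"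
        with ex_closer[of leader v] False Suc.prems obtain u
          where "u \<in> N v" "2 * radius + 2 + dist leader u \<le> t" by auto
        with nb show "\<exists>u\<in>N v. ecc (st t u) \<noteq> None" by force
      qed
      moreover have "(LEAST w. \<exists>u\<in>N v. ecc (st t u) = Some w) = radius" if "\<exists>u\<in>N v. ecc (st t u) \<noteq> None"
        using that nb by (intro Least_equality) (auto split: if_splits)
      ultimately show ?thesis using none Suc.prems by (auto simp: st_Suc(3))
    qed
  qed
qed

lemma leader_phase_over:
  assumes "0 < j" "j \<le> 3 * radius + 3" "v \<in> V"
  shows "ph_over leader_phase j (st j v) \<longleftrightarrow> j = 3 * radius + 3"
  using assms dist_le_radius[of v] leader_phase_ecc[of v j] by (auto simp: leader_over)

lemma leader_phase_final:
  assumes "v \<in> V"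
  shows "ecc (st (3 * radius + 3) v) = Some radius"
    "lev (st (3 * radius + 3) v) = dist leader v"
    "u \<in> N v \<Longrightarrow> nlev (st (3 * radius + 3) v) u = dist leader u"
proof -
  have far: "min_within t u = leader" if "radius \<le> t" "u \<in> V" for t u
    using that dist_le_radius[of u] min_within_leader_iff[of u t] by simp
  show "ecc (st (3 * radius + 3) v) = Some radius"
    using assms dist_le_radius[of v] leader_phase_ecc[of v "3 * radius + 3"] by simp
  show "lev (st (3 * radius + 3) v) = dist leader v"
    using assms by (simp add: leader_phase_lev far)
  \<comment> \<open>\<open>nlev\<close> is one round old, but all levels are final from round
    \<open>radius\<close> on.\<close>
  have "nlev (st (Suc t) v) u = lev (st t u)" if "u \<in> N v" for t
    using that by (simp add: leader_receive(5) leader_send exec.simps(2))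
  from this[of "3 * radius + 2"] show "nlev (st (3 * radius + 3) v) u = dist leader u" if "u \<in> N v"
    using that N_in_V(1)[OF that] by (simp add: numeral_3_eq_3 leader_phase_lev far)
qed

lemma leader_phase_message:
  assumes "v \<in> V" "ph_send leader_phase j (st j v) u = Some (p, q, r, s)"
  shows "p \<in> V \<and> q \<le> card V \<and> r \<le> 1 \<and> s \<le> card V"
proof -
  have "radius < card V" using ex_at_radius dist_less_card[of leader] by fastforce
  moreover have "dist (min_within j v) v < card V"
    using assms(1) min_within dist_less_card by auto
  ultimately show ?thesis
    using assms min_within[OF assms(1), of j]
    by (auto simp: leader_send leader_phase_ldr leader_phase_lev leader_phase_ecc of_bool_def)
qed

end

end

section \<open>Counting, flags and clusters\<close>

lemma sum_frame [simp]:
  "self (exec E sum_phase d j v) = self (d v)" "nbrs (exec E sum_phase d j v) = nbrs (d v)"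
  "src (exec E sum_phase d j v) = src (d v)" "coin (exec E sum_phase d j v) = coin (d v)"
  "lev (exec E sum_phase d j v) = lev (d v)" "ecc (exec E sum_phase d j v) = ecc (d v)"
  "nlev (exec E sum_phase d j v) = nlev (d v)" "tot (exec E sum_phase d j v) = tot (d v)"
  "blank (exec E sum_phase d j v) = blank (d v)"
  by (rule exec_invariant; simp add: sum_phase_def blank_def)+

lemma broadcast_frame [simp]:
  "self (exec E broadcast_phase d j v) = self (d v)"
  "nbrs (exec E broadcast_phase d j v) = nbrs (d v)"
  "src (exec E broadcast_phase d j v) = src (d v)"
  "coin (exec E broadcast_phase d j v) = coin (d v)"
  "lev (exec E broadcast_phase d j v) = lev (d v)" "ecc (exec E broadcast_phase d j v) = ecc (d v)"
  "cnt (exec E broadcast_phase d j v) = cnt (d v)"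
  "scnt (exec E broadcast_phase d j v) = scnt (d v)"
  "blank (exec E broadcast_phase d j v) = blank (d v)"
  by (rule exec_invariant; simp add: broadcast_phase_def blank_def)+

lemma sum_send: "ph_send sum_phase c d u =
    (if c + lev d = ecc_of d \<and> 0 < lev d \<and> u = tree_parent d then Some (cnt d, scnt d, 0, 0) else None)"
  by (simp add: sum_phase_def)

lemma sum_receive:
  "cnt (ph_receive sum_phase c d i) = cnt d + (\<Sum>u\<in>nbrs d. case i u of Some (p, w) \<Rightarrow> p | None \<Rightarrow> 0)"
  "scnt (ph_receive sum_phase c d i) = scnt d + (\<Sum>u\<in>nbrs d. case i u of Some (p, q, w) \<Rightarrow> q | None \<Rightarrow> 0)"
  by (simp_all add: sum_phase_def)

lemma broadcast_send: "ph_send broadcast_phase c d u =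
    (case known_total d of None \<Rightarrow> None | Some (n, k) \<Rightarrow> Some (n, k, 0, 0))"
  by (simp add: broadcast_phase_def)

lemma broadcast_receive: "tot (ph_receive broadcast_phase c d i) =
    (if known_total d \<noteq> None then known_total d
     else if \<exists>u\<in>nbrs d. i u \<noteq> None
     then (let w = the (i (LEAST u. u \<in> nbrs d \<and> i u \<noteq> None)) in Some (fst w, fst (snd w)))
     else None)"
  by (simp add: broadcast_phase_def)

context spanner_algorithm
begin

lemma flag_frame [simp]:
  "self (exec E flag_phase d j v) = self (d v)" "nbrs (exec E flag_phase d j v) = nbrs (d v)"
  "src (exec E flag_phase d j v) = src (d v)" "coin (exec E flag_phase d j v) = coin (d v)"
  "ecc (exec E flag_phase d j v) = ecc (d v)" "tot (exec E flag_phase d j v) = tot (d v)"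
  "mems (exec E flag_phase d j v) = mems (d v)" "blank (exec E flag_phase d j v) = blank (d v)"
  by (rule exec_invariant; simp add: flag_phase_def blank_def)+

lemma join_frame [simp]:
  "self (exec E join_phase d j v) = self (d v)" "nbrs (exec E join_phase d j v) = nbrs (d v)"
  "src (exec E join_phase d j v) = src (d v)" "coin (exec E join_phase d j v) = coin (d v)"
  "ecc (exec E join_phase d j v) = ecc (d v)" "tot (exec E join_phase d j v) = tot (d v)"
  "nlow (exec E join_phase d j v) = nlow (d v)" "ncen (exec E join_phase d j v) = ncen (d v)"
  "nroot (exec E join_phase d j v) = nroot (d v)" "blank (exec E join_phase d j v) = blank (d v)"
  by (rule exec_invariant; simp add: join_phase_def blank_def)+

end

locale spanner_run = net V E + spanner_algorithm low_rule center_rule root_rule full_rule slack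
  for V E low_rule center_rule root_rule full_rule slack +
  fixes S :: "nat set" and \<omega> :: "nat \<Rightarrow> nat"
  assumes S_subset: "S \<subseteq> V"
begin

definition d0 :: "nat \<Rightarrow> node" where "d0 v = init_node v (N v) (v \<in> S) (\<omega> v)"
definition d1 :: "nat \<Rightarrow> node" where "d1 = exec E leader_phase d0 (3 * radius + 3)"
definition d2 :: "nat \<Rightarrow> node" where "d2 = exec E sum_phase d1 (radius + 1)"
definition d3 :: "nat \<Rightarrow> node" where "d3 = exec E broadcast_phase d2 (radius + 1)"
definition d4 :: "nat \<Rightarrow> node" where "d4 = exec E flag_phase d3 1"
definition d5 :: "nat \<Rightarrow> node" where "d5 = exec E join_phase d4 1"

lemma d0_simps [simp]:
  "self (d0 v) = v" "nbrs (d0 v) = N v" "src (d0 v) \<longleftrightarrow> v \<in> S" "coin (d0 v) = \<omega> v"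
  "ldr (d0 v) = v" "lev (d0 v) = 0" "alive (d0 v)" "ecc (d0 v) = None" "cnt (d0 v) = 1"
  "scnt (d0 v) = of_bool (v \<in> S)" "tot (d0 v) = None" "blank (d0 v)"
  by (simp_all add: d0_def init_node_def blank_def)

lemma d1_simps [simp]:
  "self (d1 v) = v" "nbrs (d1 v) = N v" "src (d1 v) \<longleftrightarrow> v \<in> S" "coin (d1 v) = \<omega> v"
  "cnt (d1 v) = 1" "scnt (d1 v) = of_bool (v \<in> S)" "tot (d1 v) = None" "blank (d1 v)"
  by (simp_all add: d1_def leader_phase_frame)

lemma d1_leader [simp]:
  assumes "v \<in> V"
  shows "ecc (d1 v) = Some radius" "lev (d1 v) = dist leader v"
    "u \<in> N v \<Longrightarrow> nlev (d1 v) u = dist leader u"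
  using leader_phase_final[of d0 v] assms by (auto simp: d1_def)

lemma tree_parent_eq:
  assumes "v \<in> V" "nbrs d = N v" "lev d = lev (d1 v)" "nlev d = nlev (d1 v)"
  shows "tree_parent d = par leader v"
  unfolding tree_parent_def par_def using assms by (simp cong: conj_cong)

text \<open>Sum over the descendants of \<open>v\<close> down to depth \<open>i\<close> in the
  leader's tree; for \<open>i = radius - dist leader v\<close> this is the whole subtree.\<close>

primrec tree_sum :: "(nat \<Rightarrow> nat) \<Rightarrow> nat \<Rightarrow> nat \<Rightarrow> nat" where
  "tree_sum f 0 v = f v"
| "tree_sum f (Suc i) v = f v +
     (\<Sum>u | u \<in> N v \<and> dist leader u = Suc (dist leader v) \<and> par leader u = v. tree_sum f i u)"

text \<open>Every deeper node has exactly one ancestor on a given level. The induction moves up by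
  one level and groups the nodes of the level below by their parents.\<close>

lemma tree_sum_total:
  "i \<le> radius \<Longrightarrow> (\<Sum>v | v \<in> V \<and> dist leader v = radius - i. tree_sum f i v)
    = (\<Sum>v | v \<in> V \<and> radius - i \<le> dist leader v. f v)"
proof (induction i)
  case 0
  have "{v. v \<in> V \<and> dist leader v = radius} = {v. v \<in> V \<and> radius \<le> dist leader v}"
    using dist_le_radius by force
  then show ?case by simp
next
  case (Suc i)
  let ?A = "\<lambda>i. {v. v \<in> V \<and> dist leader v = radius - i}"
  have lv: "radius - i = Suc (radius - Suc i)" using Suc.prems by simp
  have child: "{u. u \<in> N v \<and> dist leader u = Suc (dist leader v) \<and> par leader u = v}
      = {u \<in> ?A i. par leader u = v}" if "v \<in> ?A (Suc i)" for v
  proof (intro Collect_cong iffI)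
    fix u assume "u \<in> N v \<and> dist leader u = Suc (dist leader v) \<and> par leader u = v"
    then show "u \<in> ?A i \<and> par leader u = v" using that lv N_in_V by auto
  next
    fix u assume u: "u \<in> ?A i \<and> par leader u = v"
    then have "u \<noteq> leader" using lv by auto
    then show "u \<in> N v \<and> dist leader u = Suc (dist leader v) \<and> par leader u = v"
      using par[of leader u] u that lv N_sym by auto
  qed
  have sub: "par leader ` ?A i \<subseteq> ?A (Suc i)"
  proof
    fix v assume "v \<in> par leader ` ?A i"
    then obtain u where u: "u \<in> V" "dist leader u = Suc (radius - Suc i)" "v = par leader u"
      using lv by auto
    then have "u \<noteq> leader" by auto
    with par[of leader u] u show "v \<in> ?A (Suc i)" using N_in_V by auto
  qed
  have "(\<Sum>v \<in> ?A (Suc i). tree_sum f (Suc i) v) = (\<Sum>v \<in> ?A (Suc i). f v)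
      + (\<Sum>v \<in> ?A (Suc i). \<Sum>u | u \<in> ?A i \<and> par leader u = v. tree_sum f i u)"
    by (simp only: tree_sum.simps sum.distrib child cong: sum.cong)
  also have "(\<Sum>v \<in> ?A (Suc i). \<Sum>u | u \<in> ?A i \<and> par leader u = v. tree_sum f i u)
      = (\<Sum>u \<in> ?A i. tree_sum f i u)"
    by (rule sum.group) (use sub in auto)
  also have "\<dots> = (\<Sum>v | v \<in> V \<and> radius - i \<le> dist leader v. f v)"
    using Suc by simp
  also have "(\<Sum>v \<in> ?A (Suc i). f v) + \<dots>
      = (\<Sum>v \<in> ?A (Suc i) \<union> {v. v \<in> V \<and> radius - i \<le> dist leader v}. f v)"
    by (subst sum.union_disjoint) (use lv in auto)
  also have "?A (Suc i) \<union> {v. v \<in> V \<and> radius - i \<le> dist leader v}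
      = {v. v \<in> V \<and> radius - Suc i \<le> dist leader v}"
    using lv by auto
  finally show ?case .
qed

lemma tree_sum_leader: "tree_sum f radius leader = (\<Sum>v\<in>V. f v)"
proof -
  have "{v. v \<in> V \<and> dist leader v = 0} = {leader}" using dist_zero[of leader] by auto
  then show ?thesis using tree_sum_total[of radius f] by simp
qed

text \<open>Children of \<open>v\<close> send only in round
  \<open>radius - dist leader v - 1\<close>, and then with complete sums; so the value of
  \<open>v\<close> changes once, from \<open>f v\<close> to its subtree sum. Both counters are
  instances.\<close>

lemma accumulate_tree_sum:
  assumes "\<And>v. v \<in> V \<Longrightarrow> a 0 v = f v"
    and step: "\<And>j v. v \<in> V \<Longrightarrow> a (Suc j) v = a j v +
      (\<Sum>u\<in>N v. if j + dist leader u = radius \<and> 0 < dist leader u \<and> v = par leader u then a j u else 0)"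
  shows "v \<in> V \<Longrightarrow>
    a j v = (if radius \<le> dist leader v + j then tree_sum f (radius - dist leader v) v else f v)"
proof (induction j arbitrary: v)
  case 0
  then show ?case using assms(1) dist_le_radius[of v] by auto
next
  case (Suc j)
  let ?C = "{u. u \<in> N v \<and> dist leader u = Suc (dist leader v) \<and> par leader u = v}"
  have child: "u \<in> N v \<and> j + dist leader u = radius \<and> 0 < dist leader u \<and> v = par leader u
      \<longleftrightarrow> u \<in> ?C \<and> radius = dist leader v + Suc j" for u
    using par[of leader u] N_in_V by force
  have "(\<Sum>u\<in>N v. if j + dist leader u = radius \<and> 0 < dist leader u \<and> v = par leader u then a j u else 0)
      = (\<Sum>u | u \<in> N v \<and> j + dist leader u = radius \<and> 0 < dist leader u \<and> v = par leader u. a j u)"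
    by (simp add: sum.inter_filter)
  also have "\<dots> = (if radius = dist leader v + Suc j then \<Sum>u\<in>?C. tree_sum f j u else 0)"
    unfolding child using Suc.IH N_in_V by (auto intro!: sum.cong)
  finally show ?case
    using Suc step[OF Suc.prems, of j] by auto
qed

lemma sum_phase_exec:
  assumes "v \<in> V"
  shows "cnt (exec E sum_phase d1 j v) = (if radius \<le> dist leader v + j
      then tree_sum (\<lambda>_. 1) (radius - dist leader v) v else 1)"
    "scnt (exec E sum_phase d1 j v) = (if radius \<le> dist leader v + j
      then tree_sum (\<lambda>v. of_bool (v \<in> S)) (radius - dist leader v) v else of_bool (v \<in> S))"
proof -
  have V: "u \<in> N v \<Longrightarrow> u \<in> V" for u v using N_in_V by blast
  have send: "ph_send sum_phase j (exec E sum_phase d1 j u) v =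
      (if j + dist leader u = radius \<and> 0 < dist leader u \<and> v = par leader u
       then Some (cnt (exec E sum_phase d1 j u), scnt (exec E sum_phase d1 j u), 0, 0) else None)"
    if "u \<in> V" for u v j
    using that tree_parent_eq[of u "exec E sum_phase d1 j u"] by (simp add: sum_send)
  have step: "cnt (exec E sum_phase d1 (Suc j) v) = cnt (exec E sum_phase d1 j v) +
      (\<Sum>u\<in>N v. if j + dist leader u = radius \<and> 0 < dist leader u \<and> v = par leader u
        then cnt (exec E sum_phase d1 j u) else 0)"
    "scnt (exec E sum_phase d1 (Suc j) v) = scnt (exec E sum_phase d1 j v) +
      (\<Sum>u\<in>N v. if j + dist leader u = radius \<and> 0 < dist leader u \<and> v = par leader u
        then scnt (exec E sum_phase d1 j u) else 0)" if "v \<in> V" for j v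
    using that by (auto simp: exec.simps(2) sum_receive V send intro!: sum.cong)
  show "cnt (exec E sum_phase d1 j v) = (if radius \<le> dist leader v + j
      then tree_sum (\<lambda>_. 1) (radius - dist leader v) v else 1)"
    by (rule accumulate_tree_sum) (use step assms in auto)
  show "scnt (exec E sum_phase d1 j v) = (if radius \<le> dist leader v + j
      then tree_sum (\<lambda>v. of_bool (v \<in> S)) (radius - dist leader v) v else of_bool (v \<in> S))"
    by (rule accumulate_tree_sum) (use step assms in auto)
qed

lemma tree_sum_le: "v \<in> V \<Longrightarrow> (\<And>u. u \<in> V \<Longrightarrow> f u \<le> 1) \<Longrightarrow> tree_sum f (radius - dist leader v) v \<le> card V"
proof -
  assume v: "v \<in> V" and f: "\<And>u. u \<in> V \<Longrightarrow> f u \<le> 1"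
  let ?i = "radius - dist leader v"
  have "radius - ?i = dist leader v" using dist_le_radius[OF v] by simp
  then have "tree_sum f ?i v \<le> (\<Sum>w | w \<in> V \<and> dist leader w = radius - ?i. tree_sum f ?i w)"
    using v by (intro member_le_sum) auto
  also have "\<dots> = (\<Sum>w | w \<in> V \<and> radius - ?i \<le> dist leader w. f w)"
    by (rule tree_sum_total) simp
  also have "\<dots> \<le> (\<Sum>w\<in>V. f w)" by (intro sum_mono2) auto
  also have "\<dots> \<le> card V" using sum_mono[of V f "\<lambda>_. 1"] f by simp
  finally show ?thesis .
qed

lemma sum_phase_message:
  assumes "v \<in> V" "ph_send sum_phase j (exec E sum_phase d1 j v) u = Some (p, q, r, s)"
  shows "p \<le> card V \<and> q \<le> card V \<and> r = 0 \<and> s = 0"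
proof -
  have "cnt (exec E sum_phase d1 j v) \<le> card V" "scnt (exec E sum_phase d1 j v) \<le> card V"
    using tree_sum_le[OF assms(1), of "\<lambda>_. 1"] tree_sum_le[OF assms(1), of "\<lambda>v. of_bool (v \<in> S)"]
      V_nonempty finite_V assms(1)
    by (auto simp: sum_phase_exec Suc_le_eq card_gt_0_iff of_bool_def)
  with assms(2) show ?thesis by (auto simp: sum_send split: if_splits)
qed

lemma d2_simps [simp]:
  "self (d2 v) = v" "nbrs (d2 v) = N v" "src (d2 v) \<longleftrightarrow> v \<in> S" "coin (d2 v) = \<omega> v"
  "tot (d2 v) = None" "blank (d2 v)" "v \<in> V \<Longrightarrow> ecc (d2 v) = Some radius" "v \<in> V \<Longrightarrow> lev (d2 v) = dist leader v"
  by (simp_all add: d2_def)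

lemma d2_leader: "cnt (d2 leader) = card V" "scnt (d2 leader) = card S"
proof -
  have "(\<Sum>v\<in>V. of_bool (v \<in> S)) = card S"
    using S_subset by (simp add: sum.inter_restrict[symmetric] of_bool_def Int_absorb1 flip: sum.inter_filter)
  then show "cnt (d2 leader) = card V" "scnt (d2 leader) = card S"
    by (simp_all add: d2_def sum_phase_exec tree_sum_leader)
qed

text \<open>The condition \<open>1 \<le> j\<close> concerns the leader, which sends the totals from
  the start but stores them in \<open>tot\<close> only in its first round.\<close>

lemma broadcast_phase_exec:
  assumes "v \<in> V"
  shows "tot (exec E broadcast_phase d2 j v) =
    (if 1 \<le> j \<and> dist leader v \<le> j then Some (card V, card S) else None)"
  using assms
proof (induction j arbitrary: v)
  case 0
  then show ?case by simp
next
  case (Suc j)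
  let ?st = "exec E broadcast_phase d2 j"
  have known: "known_total (?st u) = (if dist leader u \<le> j then Some (card V, card S) else None)"
    if "u \<in> V" for u
    using that Suc.IH[of u] d2_leader dist_zero[of leader u] by (auto simp: known_total_def)
  define i :: "nat \<Rightarrow> word4 option" where
    "i = (\<lambda>u. if u \<in> N v then ph_send broadcast_phase j (?st u) v else None)"
  have i: "i u = (if u \<in> N v \<and> dist leader u \<le> j then Some (card V, card S, 0, 0) else None)" for u
    using known[of u] N_in_V(1)[of u v] by (auto simp: i_def broadcast_send)
  have near: "(\<exists>u\<in>N v. i u \<noteq> None) \<longleftrightarrow> (\<exists>u\<in>N v. dist leader u \<le> j)" by (auto simp: i)
  have "(if dist leader v \<le> j then True else \<exists>u\<in>N v. dist leader u \<le> j) \<longleftrightarrow> dist leader v \<le> Suc j"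
    using dist_N[of _ v leader] ex_closer[of leader v] Suc.prems by (cases "v = leader") force+
  moreover have "the (i (LEAST u. u \<in> N v \<and> i u \<noteq> None)) = (card V, card S, 0, 0)"
    if "\<exists>u\<in>N v. i u \<noteq> None"
  proof -
    from that have "\<exists>u. u \<in> N v \<and> i u \<noteq> None" by blast
    from LeastI_ex[OF this] show ?thesis by (auto simp: i split: if_splits)
  qed
  moreover have "tot (exec E broadcast_phase d2 (Suc j) v) = (if known_total (?st v) \<noteq> None then known_total (?st v)
        else if \<exists>u\<in>N v. i u \<noteq> None
        then (let w = the (i (LEAST u. u \<in> N v \<and> i u \<noteq> None)) in Some (fst w, fst (snd w)))
        else None)"
  proof -
    have "exec E broadcast_phase d2 (Suc j) v = ph_receive broadcast_phase j (?st v) i"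
      by (simp add: exec.simps(2) i_def)
    then show ?thesis by (simp add: broadcast_receive)
  qed
  ultimately show ?case
    using known[OF Suc.prems] near by (auto simp: Let_def split: if_splits)
qed

lemma broadcast_phase_message:
  assumes "v \<in> V" "ph_send broadcast_phase j (exec E broadcast_phase d2 j v) u = Some (p, q, r, s)"
  shows "p \<le> card V \<and> q \<le> card V \<and> r = 0 \<and> s = 0"
proof -
  have "card S \<le> card V" using S_subset by (simp add: card_mono)
  moreover have "lev (d2 v) = 0 \<Longrightarrow> v = leader" using assms(1) dist_zero[of leader v] by simp
  ultimately show ?thesis
    using assms d2_leader
    by (auto simp: broadcast_send known_total_def broadcast_phase_exec split: if_splits)
qed

lemma d3_simps [simp]:
  "self (d3 v) = v" "nbrs (d3 v) = N v" "src (d3 v) \<longleftrightarrow> v \<in> S" "coin (d3 v) = \<omega> v"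
  "blank (d3 v)" "v \<in> V \<Longrightarrow> ecc (d3 v) = Some radius"
  "v \<in> V \<Longrightarrow> tot (d3 v) = Some (card V, card S)"
  using dist_le_radius[of v] by (simp_all add: d3_def broadcast_phase_exec)

section \<open>Flags and clusters as functions of the coins\<close>

definition Low :: "nat \<Rightarrow> bool" where "Low v = low_rule (card V) (card S) (card (N v))"
definition Center :: "nat \<Rightarrow> bool" where "Center v = center_rule (card V) (card S) (\<omega> v)"
definition Root :: "nat \<Rightarrow> bool" where "Root v = root_rule (card V) (card S) (\<omega> v)"
definition Origin :: "nat set" where "Origin = {v \<in> V. v \<in> S \<or> Root v}"
definition Full :: "nat set" where "Full = {v \<in> V. Root v \<or> v \<in> S \<and> full_rule (card V) (card S)}"

lemma Full_subset: "Full \<subseteq> Origin"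
  by (auto simp: Full_def Origin_def)

lemma Origin_subset: "Origin \<subseteq> V"
  by (auto simp: Origin_def)

definition ctr :: "nat \<Rightarrow> nat option" where
  "ctr v = (if \<not> Low v \<and> (\<exists>u\<in>N v. Center u) then Some (LEAST u. u \<in> N v \<and> Center u) else None)"

lemma local_flags:
  assumes "v \<in> V" "self d = v" "nbrs d = N v" "src d \<longleftrightarrow> v \<in> S" "coin d = \<omega> v" "tot d = Some (card V, card S)"
  shows "is_low d = Low v" "is_center d = Center v" "is_root d = Root v"
    "is_origin d \<longleftrightarrow> v \<in> Origin" "is_full d \<longleftrightarrow> v \<in> Full"
  using assms by (simp_all add: is_low_def is_center_def is_root_def is_origin_def is_full_def
      Low_def Center_def Root_def Origin_def Full_def)

lemma d4_simps [simp]: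
  "self (d4 v) = v" "nbrs (d4 v) = N v" "src (d4 v) \<longleftrightarrow> v \<in> S" "coin (d4 v) = \<omega> v"
  "blank (d4 v)" "v \<in> V \<Longrightarrow> ecc (d4 v) = Some radius"
  "v \<in> V \<Longrightarrow> tot (d4 v) = Some (card V, card S)"
  by (simp_all add: d4_def)

lemma d4_flags [simp]:
  assumes "v \<in> V"
  shows "nlow (d4 v) u \<longleftrightarrow> u \<in> N v \<and> Low u" "ncen (d4 v) u \<longleftrightarrow> u \<in> N v \<and> Center u"
    "nroot (d4 v) u \<longleftrightarrow> u \<in> N v \<and> Root u"
proof -
  have flags: "u \<in> N v \<Longrightarrow> is_low (d3 u) = Low u \<and> is_center (d3 u) = Center u \<and> is_root (d3 u) = Root u" for u
    using local_flags[of u "d3 u"] N_in_V by simp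
  show "nlow (d4 v) u \<longleftrightarrow> u \<in> N v \<and> Low u" "ncen (d4 v) u \<longleftrightarrow> u \<in> N v \<and> Center u"
    "nroot (d4 v) u \<longleftrightarrow> u \<in> N v \<and> Root u"
    using flags[of u] by (auto simp: d4_def exec.simps(2) flag_phase_def of_bool_def)
qed

lemma flag_phase_message:
  assumes "ph_send flag_phase j d u = Some (p, q, r, s)"
  shows "p \<le> 1 \<and> q \<le> 1 \<and> r \<le> 1 \<and> s = 0"
  using assms by (auto simp: flag_phase_def of_bool_def)

lemma d5_simps [simp]:
  "self (d5 v) = v" "nbrs (d5 v) = N v" "src (d5 v) \<longleftrightarrow> v \<in> S" "coin (d5 v) = \<omega> v" "v \<in> V \<Longrightarrow> ecc (d5 v) = Some radius"
  "v \<in> V \<Longrightarrow> tot (d5 v) = Some (card V, card S)"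
  "v \<in> V \<Longrightarrow> nlow (d5 v) u \<longleftrightarrow> u \<in> N v \<and> Low u"
  "v \<in> V \<Longrightarrow> ncen (d5 v) u \<longleftrightarrow> u \<in> N v \<and> Center u"
  "v \<in> V \<Longrightarrow> nroot (d5 v) u \<longleftrightarrow> u \<in> N v \<and> Root u"
  by (simp_all add: d5_def)

lemma d5_blank [simp]:
  "tbl (d5 v) = (\<lambda>_ _. None)" "told (d5 v) = {}" "kfull (d5 v) = {}" "ncov (d5 v) = (\<lambda>_ _. False)"
  "sel (d5 v) = {}" "chl (d5 v) = {}"
proof -
  have "blank (d5 v)" by (simp add: d5_def)
  then show "tbl (d5 v) = (\<lambda>_ _. None)" "told (d5 v) = {}" "kfull (d5 v) = {}"
    "ncov (d5 v) = (\<lambda>_ _. False)" "sel (d5 v) = {}" "chl (d5 v) = {}"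
    by (simp_all add: blank_def)
qed

lemma local_center:
  assumes "v \<in> V" "self d = v" "nbrs d = N v" "src d \<longleftrightarrow> v \<in> S" "coin d = \<omega> v" "tot d = Some (card V, card S)"
    "ncen d = ncen (d4 v)"
  shows "center_of d = ctr v"
proof -
  have "(LEAST u. u \<in> N v \<and> u \<in> N v \<and> Center u) = (LEAST u. u \<in> N v \<and> Center u)"
    by (rule arg_cong[where f = Least]) auto
  then show ?thesis
    using assms local_flags(1)[OF assms(1-6)] by (auto simp: center_of_def ctr_def)
qed

lemma d5_mems [simp]: "v \<in> V \<Longrightarrow> mems (d5 v) = {u \<in> N v. ctr u = Some v}"
proof -
  assume "v \<in> V"
  have "u \<in> N v \<Longrightarrow> center_of (d4 u) = ctr u" for u
    by (rule local_center) (auto simp: N_in_V)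
  then show ?thesis by (auto simp: d5_def exec.simps(2) join_phase_def split: if_splits)
qed

lemma join_phase_message:
  assumes "ph_send join_phase j d u = Some (p, q, r, s)"
  shows "p = 0 \<and> q = 0 \<and> r = 0 \<and> s = 0"
  using assms by (auto simp: join_phase_def split: if_splits)

end

section \<open>Pipelined breadth-first search\<close>

lemma lex_less_irrefl: "\<not> lex_less p p"
  by (simp add: lex_less_def)

lemma lex_less_trans: "lex_less p q \<Longrightarrow> lex_less q r \<Longrightarrow> lex_less p r"
  by (auto simp: lex_less_def)

context spanner_algorithm
begin

lemma bfs_frame [simp]:
  "self (exec E bfs_phase d j v) = self (d v)" "nbrs (exec E bfs_phase d j v) = nbrs (d v)"
  "src (exec E bfs_phase d j v) = src (d v)" "coin (exec E bfs_phase d j v) = coin (d v)"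
  "ecc (exec E bfs_phase d j v) = ecc (d v)" "tot (exec E bfs_phase d j v) = tot (d v)"
  "nlow (exec E bfs_phase d j v) = nlow (d v)" "ncen (exec E bfs_phase d j v) = ncen (d v)"
  "nroot (exec E bfs_phase d j v) = nroot (d v)" "mems (exec E bfs_phase d j v) = mems (d v)"
  "ncov (exec E bfs_phase d j v) = ncov (d v)" "sel (exec E bfs_phase d j v) = sel (d v)"
  "chl (exec E bfs_phase d j v) = chl (d v)"
  by (rule exec_invariant; simp add: bfs_phase_def)+

lemma cover_frame [simp]:
  "self (exec E cover_phase d j v) = self (d v)" "nbrs (exec E cover_phase d j v) = nbrs (d v)"
  "src (exec E cover_phase d j v) = src (d v)" "coin (exec E cover_phase d j v) = coin (d v)"
  "ecc (exec E cover_phase d j v) = ecc (d v)" "tot (exec E cover_phase d j v) = tot (d v)"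
  "nlow (exec E cover_phase d j v) = nlow (d v)" "ncen (exec E cover_phase d j v) = ncen (d v)"
  "nroot (exec E cover_phase d j v) = nroot (d v)" "mems (exec E cover_phase d j v) = mems (d v)"
  "tbl (exec E cover_phase d j v) = tbl (d v)" "told (exec E cover_phase d j v) = told (d v)"
  "kfull (exec E cover_phase d j v) = kfull (d v)" "sel (exec E cover_phase d j v) = sel (d v)"
  "chl (exec E cover_phase d j v) = chl (d v)"
  by (rule exec_invariant; simp add: cover_phase_def)+

lemma choose_frame [simp]:
  "self (exec E choose_phase d j v) = self (d v)" "nbrs (exec E choose_phase d j v) = nbrs (d v)"
  "src (exec E choose_phase d j v) = src (d v)" "coin (exec E choose_phase d j v) = coin (d v)"
  "ecc (exec E choose_phase d j v) = ecc (d v)" "tot (exec E choose_phase d j v) = tot (d v)"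
  "nlow (exec E choose_phase d j v) = nlow (d v)" "ncen (exec E choose_phase d j v) = ncen (d v)"
  "nroot (exec E choose_phase d j v) = nroot (d v)" "mems (exec E choose_phase d j v) = mems (d v)"
  "tbl (exec E choose_phase d j v) = tbl (d v)" "told (exec E choose_phase d j v) = told (d v)"
  "kfull (exec E choose_phase d j v) = kfull (d v)" "ncov (exec E choose_phase d j v) = ncov (d v)"
  "chl (exec E choose_phase d j v) = chl (d v)"
  by (rule exec_invariant; simp add: choose_phase_def)+

lemma upcast_frame [simp]:
  "self (exec E upcast_phase d j v) = self (d v)" "nbrs (exec E upcast_phase d j v) = nbrs (d v)"
  "src (exec E upcast_phase d j v) = src (d v)" "coin (exec E upcast_phase d j v) = coin (d v)"
  "ecc (exec E upcast_phase d j v) = ecc (d v)" "tot (exec E upcast_phase d j v) = tot (d v)"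
  "nlow (exec E upcast_phase d j v) = nlow (d v)" "ncen (exec E upcast_phase d j v) = ncen (d v)"
  "nroot (exec E upcast_phase d j v) = nroot (d v)" "mems (exec E upcast_phase d j v) = mems (d v)"
  "tbl (exec E upcast_phase d j v) = tbl (d v)" "told (exec E upcast_phase d j v) = told (d v)"
  "kfull (exec E upcast_phase d j v) = kfull (d v)" "ncov (exec E upcast_phase d j v) = ncov (d v)"
  "sel (exec E upcast_phase d j v) = sel (d v)"
  by (rule exec_invariant; simp add: upcast_phase_def)+

lemma bfs_send: "ph_send bfs_phase c d u = (if pending d = {} then None
    else Some (snd (next_pair d), fst (next_pair d), of_bool (knows_full d (snd (next_pair d))), 0))"
  by (simp add: bfs_phase_def)

lemma bfs_receive:
  "tbl (ph_receive bfs_phase c d i) u x = (case i u of None \<Rightarrow> tbl d u x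
     | Some (y, k, w) \<Rightarrow> if x \<noteq> y then tbl d u x
         else Some (case tbl d u x of None \<Rightarrow> k | Some k' \<Rightarrow> min k k'))"
  "told (ph_receive bfs_phase c d i) = (if pending d = {} then told d else insert (next_pair d) (told d))"
  "kfull (ph_receive bfs_phase c d i) = kfull d \<union> {x. \<exists>u\<in>nbrs d. \<exists>k w. i u = Some (x, k, 1, w)}"
  by (simp_all add: bfs_phase_def)

lemma cover_send: "ph_send cover_phase c d u = (if \<exists>x. slot_at d c x
    then let x = (LEAST x. slot_at d c x) in Some (x, of_bool (covered d x), 0, 0) else None)"
  by (simp add: cover_phase_def)

lemma cover_receive: "ncov (ph_receive cover_phase c d i) u x = (case i u of
    Some (y, b, w) \<Rightarrow> if x = y then coded_bool b else ncov d u x | None \<Rightarrow> ncov d u x)"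
  by (simp add: cover_phase_def)

lemma choose_send: "ph_send choose_phase c d u = (if \<exists>x. slot_at d c x \<and> choice d x = Some u
    then Some (LEAST x. slot_at d c x, 0, 0, 0) else None)"
  by (simp add: choose_phase_def)

lemma choose_receive: "sel (ph_receive choose_phase c d i)
    = sel d \<union> {x. \<exists>u\<in>nbrs d. \<exists>w. i u = Some (x, w)}"
  by (simp add: choose_phase_def)

lemma upcast_send: "ph_send upcast_phase c d u =
    (if \<exists>x. upcast_at d c x \<and> x \<noteq> self d \<and> buys d x \<and> u = bfs_parent d x
     then Some (LEAST x. upcast_at d c x, 0, 0, 0) else None)"
  by (simp add: upcast_phase_def)

lemma upcast_receive: "chl (ph_receive upcast_phase c d i)
    = chl d \<union> {(u, x). u \<in> nbrs d \<and> (\<exists>w. i u = Some (x, w))}"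
  by (simp add: upcast_phase_def)

lemma next_pair_in: "pending d \<noteq> {} \<Longrightarrow> next_pair d \<in> pending d"
proof -
  assume "pending d \<noteq> {}"
  then have "\<exists>k x. (k, x) \<in> pending d" by auto
  from LeastI_ex[OF this] show ?thesis
    unfolding next_pair_def Let_def by (rule LeastI_ex)
qed

lemma next_pair_least:
  assumes "p \<in> pending d"
  shows "\<not> lex_less p (next_pair d)"
proof -
  obtain k x where p: "p = (k, x)" by force
  let ?k = "LEAST k. \<exists>x. (k, x) \<in> pending d"
  have "?k \<le> k" by (rule Least_le) (use assms p in auto)
  moreover have "k = ?k \<Longrightarrow> (LEAST x. (?k, x) \<in> pending d) \<le> x"
    by (rule Least_le) (use assms p in auto)
  ultimately show ?thesis by (auto simp: p lex_less_def next_pair_def Let_def)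
qed

end

section \<open>Time slots and exactness of the distance tables\<close>

context spanner_run
begin

definition len :: nat where "len = 2 * radius + slack * card S + 1"
definition d6 :: "nat \<Rightarrow> node" where "d6 = exec E bfs_phase d5 len"
definition d7 :: "nat \<Rightarrow> node" where "d7 = exec E cover_phase d6 len"
definition d8 :: "nat \<Rightarrow> node" where "d8 = exec E choose_phase d7 len"
definition d9 :: "nat \<Rightarrow> node" where "d9 = exec E upcast_phase d8 len"

definition rank :: "nat \<Rightarrow> nat \<Rightarrow> nat" where
  "rank v x = card {y \<in> Origin. lex_less (dist y v, y) (dist x v, x)}"

text \<open>The rank makes the slots at a node strictly increasing in the lexicographic order of
  distance and identifier, hence distinct.\<close>

definition time_slot :: "nat \<Rightarrow> nat \<Rightarrow> nat" where
  "time_slot v x = dist x v + rank v x"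

lemma finite_Origin [simp]: "finite Origin"
  using Origin_subset finite_V by (rule finite_subset)

lemma time_slot_less:
  assumes "y \<in> Origin" "lex_less (dist y v, y) (dist x v, x)"
  shows "time_slot v y < time_slot v x"
proof -
  have "rank v y < rank v x"
    unfolding rank_def
  proof (intro psubset_card_mono psubsetI)
    show "{z \<in> Origin. lex_less (dist z v, z) (dist y v, y)}
        \<noteq> {z \<in> Origin. lex_less (dist z v, z) (dist x v, x)}"
      using assms lex_less_irrefl by blast
  qed (use assms(2) in \<open>auto intro: lex_less_trans\<close>)
  moreover have "dist y v \<le> dist x v" using assms(2) by (auto simp: lex_less_def)
  ultimately show ?thesis by (simp add: time_slot_def)
qed

lemma time_slot_inj:
  assumes "x \<in> Origin" "y \<in> Origin" "time_slot v x = time_slot v y"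
  shows "x = y"
proof (rule ccontr)
  assume "x \<noteq> y"
  then have "lex_less (dist y v, y) (dist x v, x) \<or> lex_less (dist x v, x) (dist y v, y)"
    by (auto simp: lex_less_def)
  with time_slot_less assms show False by (metis less_irrefl)
qed

text \<open>Moving one step towards \<open>x\<close> cannot increase the rank of \<open>x\<close>: the distance to \<open>x\<close> decreases
  by one, and every other distance by at most one.\<close>

lemma time_slot_par:
  assumes "x \<in> Origin" "v \<in> V" "x \<noteq> v"
  shows "time_slot (par x v) x < time_slot v x"
proof -
  have x: "x \<in> V" using assms Origin_subset by blast
  note p = par[OF x assms(2,3)]
  have "rank (par x v) x \<le> rank v x"
    unfolding rank_def
  proof (rule card_mono)
    show "{y \<in> Origin. lex_less (dist y (par x v), y) (dist x (par x v), x)}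
      \<subseteq> {y \<in> Origin. lex_less (dist y v, y) (dist x v, x)}"
      using p(2) dist_N[OF p(1)] Origin_subset by (fastforce simp: lex_less_def)
  qed simp
  with p(2) show ?thesis by (simp add: time_slot_def)
qed

text \<open>The detour over the leader bounds distances by \<open>2 * radius\<close>. This is where
  the bound on the number of origins enters: without it a wave could be cut off.\<close>

lemma time_slot_less_len:
  assumes "card Origin \<le> slack * card S" "x \<in> Origin" "v \<in> V"
  shows "time_slot v x < len"
proof -
  have x: "x \<in> V" using assms Origin_subset by blast
  have "rank v x \<le> card Origin"
    unfolding rank_def by (rule card_mono) auto
  moreover have "dist x v \<le> 2 * radius"
    using dist_triangle[of x leader v] dist_sym[of x leader] dist_le_radius[of x] dist_le_radius[of v]
      x assms(3) by simp
  ultimately show ?thesis using assms(1) by (simp add: time_slot_def len_def)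
qed

text \<open>The components in this definition never change after the join phase.\<close>

definition settled :: "nat \<Rightarrow> node \<Rightarrow> bool" where
  "settled v d \<longleftrightarrow> self d = v \<and> nbrs d = N v \<and> (src d \<longleftrightarrow> v \<in> S) \<and> coin d = \<omega> v
     \<and> ecc d = Some radius \<and> tot d = Some (card V, card S) \<and> nlow d = nlow (d5 v)
     \<and> ncen d = ncen (d4 v) \<and> nroot d = nroot (d5 v) \<and> mems d = mems (d5 v)"

lemma settled_exec [simp]:
  assumes "v \<in> V"
  shows "settled v (d5 v)" "settled v (exec E bfs_phase d5 j v)"
    "settled v (exec E cover_phase d6 j v)" "settled v (exec E choose_phase d7 j v)"
    "settled v (exec E upcast_phase d8 j v)" "settled v (d6 v)" "settled v (d7 v)"
    "settled v (d8 v)" "settled v (d9 v)"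
  using assms by (simp_all add: settled_def d6_def d7_def d8_def d9_def d5_def del: d5_mems)

lemma settled_flags:
  assumes "v \<in> V" "settled v d"
  shows "is_low d = Low v" "is_origin d \<longleftrightarrow> v \<in> Origin" "is_full d \<longleftrightarrow> v \<in> Full"
    "center_of d = ctr v" "self d = v" "nbrs d = N v" "wave_len d = len"
    "nlow d u \<longleftrightarrow> u \<in> N v \<and> Low u" "nroot d u \<longleftrightarrow> u \<in> N v \<and> Root u"
    "mems d = {u \<in> N v. ctr u = Some v}"
  using assms local_flags[of v d] local_center[of v d]
  by (simp_all add: settled_def wave_len_def len_def)

abbreviation "bfs_run \<equiv> exec E bfs_phase d5"

lemma best_SomeD:
  assumes "best d x = Some k"
  shows "x = self d \<and> is_origin d \<and> k = 0 \<or> (\<exists>u\<in>nbrs d. \<exists>k'. tbl d u x = Some k' \<and> k = Suc k')"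
proof (cases "x = self d \<and> is_origin d")
  case False
  with assms have "\<exists>k'. \<exists>u\<in>nbrs d. tbl d u x = Some k'"
    and k: "k = Suc (LEAST k. \<exists>u\<in>nbrs d. tbl d u x = Some k)"
    by (auto simp: best_def split: if_splits)
  from LeastI_ex[OF this(1)] k show ?thesis by blast
qed (use assms in \<open>auto simp: best_def\<close>)

lemma best_sound_aux:
  assumes "v \<in> V" "settled v d" "\<And>u x k. tbl d u x = Some k \<Longrightarrow> x \<in> Origin \<and> dist x u \<le> k \<and> k < j"
    "best d x = Some k"
  shows "x \<in> Origin \<and> dist x v \<le> k \<and> k \<le> j"
  using best_SomeD[OF assms(4)]
proof (elim disjE)
  assume "x = self d \<and> is_origin d \<and> k = 0"
  then show ?thesis using settled_flags[OF assms(1,2)] by simp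
next
  assume "\<exists>u\<in>nbrs d. \<exists>k'. tbl d u x = Some k' \<and> k = Suc k'"
  then obtain u k' where u: "u \<in> N v" "tbl d u x = Some k'" "k = Suc k'"
    using settled_flags[OF assms(1,2)] by auto
  with assms(3)[OF u(2)] dist_N[OF u(1), of x] Origin_subset show ?thesis by fastforce
qed

text \<open>Announcements start with \<open>0\<close> at an origin and grow by one per hop, so an
  entry may be too large for a while but never undercuts the true distance. The bound by
  \<open>j\<close> limits message sizes for all coins.\<close>

lemma tbl_sound:
  "v \<in> V \<Longrightarrow> tbl (bfs_run j v) u x = Some k \<Longrightarrow> u \<in> N v \<and> x \<in> Origin \<and> dist x u \<le> k \<and> k < j"
proof (induction j arbitrary: v u x k)
  case 0
  then show ?case by simp
next
  case (Suc j)
  show ?case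
  proof (cases "tbl (bfs_run j v) u x = Some k")
    case True
    then show ?thesis using Suc.IH[OF Suc.prems(1) True] by simp
  next
    case False
    with Suc.prems(2) have u: "u \<in> N v" and np: "pending (bfs_run j u) \<noteq> {}" "x = snd (next_pair (bfs_run j u))"
      and k: "k = fst (next_pair (bfs_run j u))"
      by (auto simp: exec.simps(2) bfs_receive bfs_send min_def split: if_splits option.splits)
    have "best (bfs_run j u) x = Some k"
      using next_pair_in[OF np(1)] np(2) k by (auto simp: pending_def split: prod.splits)
    with best_sound_aux[of u "bfs_run j u" j x k] u N_in_V(1)[OF u] Suc.IH show ?thesis by auto
  qed
qed

lemma best_sound:
  "v \<in> V \<Longrightarrow> best (bfs_run j v) x = Some k \<Longrightarrow> x \<in> Origin \<and> dist x v \<le> k \<and> k \<le> j"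
  using tbl_sound by (intro best_sound_aux[of v "bfs_run j v"]) auto

text \<open>Tables keep the minimum of all announcements, so later messages can only improve an
  entry.\<close>

lemma told_received:
  "v \<in> V \<Longrightarrow> (k, x) \<in> told (bfs_run j v) \<Longrightarrow> w \<in> N v \<Longrightarrow> \<exists>k' \<le> k. tbl (bfs_run j w) v x = Some k'"
proof (induction j)
  case 0
  then show ?case by simp
next
  case (Suc j)
  have vw: "v \<in> N w" using Suc.prems N_sym by blast
  consider "(k, x) \<in> told (bfs_run j v)" | "pending (bfs_run j v) \<noteq> {}" "next_pair (bfs_run j v) = (k, x)"
    using Suc.prems(2) by (auto simp: exec.simps(2) bfs_receive split: if_splits)
  then show ?case
  proof cases
    case 1
    with Suc obtain k' where "k' \<le> k" "tbl (bfs_run j w) v x = Some k'" by blast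
    then show ?thesis using vw
      by (auto simp: exec.simps(2) bfs_receive bfs_send min_le_iff_disj)
  next
    case 2
    then show ?thesis using vw
      by (auto simp: exec.simps(2) bfs_receive bfs_send split: option.splits)
  qed
qed

lemma told_received_dist:
  assumes "v \<in> V" "(dist x v, x) \<in> told (bfs_run j v)" "w \<in> N v"
  shows "tbl (bfs_run j w) v x = Some (dist x v)"
  using told_received[OF assms] tbl_sound[of w j v x] N_in_V(1)[OF assms(3)] by force

text \<open>The tree parent of \<open>v\<close> has an earlier slot, so its exact distance has
  arrived by round \<open>j\<close>. The announcements in earlier slots are a hypothesis because the
  lemma is applied inside the induction that establishes them.\<close>

lemma best_exact_aux:
  assumes "x \<in> Origin" "v \<in> V" "time_slot v x \<le> j"
    and told: "\<And>u. u \<in> V \<Longrightarrow> time_slot u x < j \<Longrightarrow> (dist x u, x) \<in> told (bfs_run j u)"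
  shows "best (bfs_run j v) x = Some (dist x v)"
proof (cases "x = v")
  case True
  then show ?thesis using settled_flags[OF assms(2) settled_exec(2)[OF assms(2), of j]] assms(1)
    by (simp add: best_def)
next
  case False
  have x: "x \<in> V" using assms Origin_subset by blast
  let ?p = "par x v"
  note p = par[OF x assms(2) False]
  have pV: "?p \<in> V" using p N_in_V by blast
  have "time_slot ?p x < j" using time_slot_par[OF assms(1,2) False] assms(3) by simp
  from told[OF pV this] have t: "tbl (bfs_run j v) ?p x = Some (dist x ?p)"
    using told_received_dist[OF pV] p(1) N_sym by blast
  have "(LEAST k. \<exists>u\<in>N v. tbl (bfs_run j v) u x = Some k) = dist x ?p"
  proof (rule Least_equality)
    show "\<exists>u\<in>N v. tbl (bfs_run j v) u x = Some (dist x ?p)" using t p by blast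
    show "dist x ?p \<le> k" if "\<exists>u\<in>N v. tbl (bfs_run j v) u x = Some k" for k
    proof -
      from that obtain u where u: "u \<in> N v" "tbl (bfs_run j v) u x = Some k" by blast
      with tbl_sound[OF assms(2) u(2)] dist_N[OF u(1) x] p(2) show ?thesis by simp
    qed
  qed
  then show ?thesis using t p False settled_flags[OF assms(2) settled_exec(2)[OF assms(2), of j]]
    by (auto simp: best_def)
qed

text \<open>The core of the pipelining. A pending pair preceding \<open>(dist x v, x)\<close>
  overestimates the distance to its origin if anything, so that origin has an earlier slot. By
  induction its exact pair is already told, and by exactness of \<open>best\<close> the pending pair
  is that pair, a contradiction.\<close>

lemma told_complete:
  "x \<in> Origin \<Longrightarrow> v \<in> V \<Longrightarrow> time_slot v x < j \<Longrightarrow> (dist x v, x) \<in> told (bfs_run j v)"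
proof (induction j arbitrary: v x)
  case 0
  then show ?case by simp
next
  case (Suc j)
  have mono: "told (bfs_run j v) \<subseteq> told (bfs_run (Suc j) v)"
    by (auto simp: exec.simps(2) bfs_receive)
  show ?case
  proof (cases "(dist x v, x) \<in> told (bfs_run j v)")
    case True
    then show ?thesis using mono by blast
  next
    case False
    with Suc have slot: "time_slot v x = j" by fastforce
    have exact: "best (bfs_run j v) y = Some (dist y v)" if "y \<in> Origin" "time_slot v y \<le> j" for y
      using that Suc by (intro best_exact_aux) auto
    from exact[OF Suc.prems(1)] slot False have p: "(dist x v, x) \<in> pending (bfs_run j v)"
      by (simp add: pending_def)
    then have "next_pair (bfs_run j v) \<in> pending (bfs_run j v)" by (intro next_pair_in) auto
    then obtain k y where y: "next_pair (bfs_run j v) = (k, y)" "best (bfs_run j v) y = Some k"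
        "(k, y) \<notin> told (bfs_run j v)"
      by (cases "next_pair (bfs_run j v)") (auto simp: pending_def)
    have ys: "y \<in> Origin" "dist y v \<le> k" using best_sound[OF Suc.prems(2) y(2)] by auto
    have nl: "\<not> lex_less (dist x v, x) (k, y)" using next_pair_least[OF p] y(1) by simp
    have "y = x"
    proof (rule ccontr)
      assume "y \<noteq> x"
      with nl ys(2) have "lex_less (dist y v, y) (dist x v, x)" by (auto simp: lex_less_def)
      then have "time_slot v y < j" using time_slot_less[OF ys(1)] slot by blast
      with Suc.IH[OF ys(1) Suc.prems(2)] exact[OF ys(1)] y show False by auto
    qed
    with y exact[OF Suc.prems(1)] slot have "next_pair (bfs_run j v) = (dist x v, x)" by simp
    then show ?thesis using p by (auto simp: exec.simps(2) bfs_receive)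
  qed
qed

lemma kfull_subset: "v \<in> V \<Longrightarrow> kfull (bfs_run j v) \<subseteq> Full"
proof (induction j arbitrary: v)
  case 0
  then show ?case by simp
next
  case (Suc j)
  show ?case
  proof
    fix x assume "x \<in> kfull (bfs_run (Suc j) v)"
    then consider "x \<in> kfull (bfs_run j v)" | u where "u \<in> N v" "knows_full (bfs_run j u) x"
      using Suc.prems by (auto simp: exec.simps(2) bfs_receive bfs_send of_bool_def split: if_splits)
    then show "x \<in> Full"
    proof cases
      case 2
      then show ?thesis using Suc.IH[of u] N_in_V(1)[OF 2(1)] settled_flags[of u "bfs_run j u"]
        by (auto simp: knows_full_def)
    qed (use Suc in auto)
  qed
qed

text \<open>The flag travels with each announcement: whoever announces \<open>x\<close> either is
  \<open>x\<close> or has a table entry for \<open>x\<close>, which came together with the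
  flag.\<close>

lemma kfull_complete:
  "v \<in> V \<Longrightarrow> x \<in> Full \<Longrightarrow> tbl (bfs_run j v) u x \<noteq> None \<Longrightarrow> x \<in> kfull (bfs_run j v)"
proof (induction j arbitrary: v u)
  case 0
  then show ?case by simp
next
  case (Suc j)
  show ?case
  proof (cases "tbl (bfs_run j v) u x = None")
    case False
    then show ?thesis using Suc by (auto simp: exec.simps(2) bfs_receive)
  next
    case True
    with Suc.prems have u: "u \<in> N v" and np: "pending (bfs_run j u) \<noteq> {}" "x = snd (next_pair (bfs_run j u))"
      by (auto simp: exec.simps(2) bfs_receive bfs_send split: if_splits option.splits)
    have uV: "u \<in> V" using N_in_V(1)[OF u] .
    have "best (bfs_run j u) x \<noteq> None"
      using next_pair_in[OF np(1)] np(2) by (auto simp: pending_def split: prod.splits)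
    then obtain k where "best (bfs_run j u) x = Some k" by blast
    from best_SomeD[OF this] have "knows_full (bfs_run j u) x"
      using Suc.IH[OF uV Suc.prems(2)] Suc.prems(2) settled_flags[OF uV settled_exec(2)[OF uV, of j]]
      by (auto simp: knows_full_def)
    then show ?thesis using u np Suc.prems(1) by (auto simp: exec.simps(2) bfs_receive bfs_send)
  qed
qed

lemma bfs_phase_message:
  assumes "v \<in> V" "ph_send bfs_phase j (bfs_run j v) u = Some (p, q, r, s)"
  shows "p \<in> V \<and> q \<le> j \<and> r \<le> 1 \<and> s = 0"
proof -
  from assms(2) have np: "pending (bfs_run j v) \<noteq> {}" "next_pair (bfs_run j v) = (q, p)" "r \<le> 1" "s = 0"
    by (auto simp: bfs_send of_bool_def split: if_splits)
  from next_pair_in[OF np(1)] np(2) have "best (bfs_run j v) p = Some q" by (auto simp: pending_def)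
  with best_sound[OF assms(1)] np Origin_subset show ?thesis by blast
qed

definition informed :: "nat \<Rightarrow> node \<Rightarrow> bool" where
  "informed v d \<longleftrightarrow> settled v d \<and> tbl d = tbl (d6 v) \<and> kfull d = kfull (d6 v)"

lemma informed_exec [simp]:
  assumes "v \<in> V"
  shows "informed v (exec E cover_phase d6 j v)" "informed v (exec E choose_phase d7 j v)"
    "informed v (exec E upcast_phase d8 j v)" "informed v (d6 v)" "informed v (d7 v)"
    "informed v (d8 v)" "informed v (d9 v)"
  using assms by (simp_all add: informed_def, simp_all add: d7_def d8_def d9_def)

lemma informed_best: "v \<in> V \<Longrightarrow> informed v d \<Longrightarrow> best d x = Some k \<Longrightarrow> x \<in> Origin"
  using best_sound_aux[of v d len x k] tbl_sound[of v len] by (auto simp: informed_def d6_def)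

text \<open>With too many origins, slots cannot be trusted, but the identifier sent is still that of
  an origin. This keeps messages short for all coins.\<close>

lemma least_slot_in_V:
  assumes "v \<in> V" "informed v d" "\<exists>x. P x" "\<And>x. P x \<Longrightarrow> best d x \<noteq> None"
  shows "(LEAST x. P x) \<in> V"
proof -
  have "best d (LEAST x. P x) \<noteq> None" using assms(3,4) by (metis LeastI_ex)
  then show ?thesis using informed_best[OF assms(1,2)] Origin_subset by blast
qed

lemma cover_phase_message:
  assumes "v \<in> V" "ph_send cover_phase j (exec E cover_phase d6 j v) u = Some (p, q, r, s)"
  shows "p \<in> V \<and> q \<le> 1 \<and> r = 0 \<and> s = 0"
  using assms(2) least_slot_in_V[OF assms(1) informed_exec(1)[OF assms(1)], of "slot_at (exec E cover_phase d6 j v) j" j]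
  by (auto simp: cover_send Let_def of_bool_def slot_at_def split: if_splits)

lemma choose_phase_message:
  assumes "v \<in> V" "ph_send choose_phase j (exec E choose_phase d7 j v) u = Some (p, q, r, s)"
  shows "p \<in> V \<and> q = 0 \<and> r = 0 \<and> s = 0"
  using assms(2) least_slot_in_V[OF assms(1) informed_exec(2)[OF assms(1)], of "slot_at (exec E choose_phase d7 j v) j" j]
  by (auto simp: choose_send slot_at_def split: if_splits)

lemma upcast_phase_message:
  assumes "v \<in> V" "ph_send upcast_phase j (exec E upcast_phase d8 j v) u = Some (p, q, r, s)"
  shows "p \<in> V \<and> q = 0 \<and> r = 0 \<and> s = 0"
  using assms(2) least_slot_in_V[OF assms(1) informed_exec(3)[OF assms(1)], of "upcast_at (exec E upcast_phase d8 j v) j" j]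
  by (auto simp: upcast_send upcast_at_def split: if_splits)

end

section \<open>Covering, selection and buying\<close>

context spanner_run
begin

definition Cov :: "nat \<Rightarrow> nat \<Rightarrow> bool" where
  "Cov x v \<longleftrightarrow> (\<exists>i \<le> dist x v. \<exists>u \<in> N ((par x ^^ i) v). Root u)"

definition Cand :: "nat \<Rightarrow> nat \<Rightarrow> nat set" where
  "Cand v x = {z \<in> N v. ctr z = Some v \<and> \<not> Cov x z}"

definition Choice :: "nat \<Rightarrow> nat \<Rightarrow> nat option" where
  "Choice v x = (if Cand v x = {} \<or> x \<in> Full then None
     else Some (LEAST z. z \<in> Cand v x \<and> (\<forall>z' \<in> Cand v x. dist x z \<le> dist x z')))"

definition Sel :: "nat \<Rightarrow> nat \<Rightarrow> bool" where
  "Sel x v \<longleftrightarrow> x \<in> Origin \<and> (\<exists>u \<in> N v. Choice u x = Some v)"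

text \<open>\<open>Buy x v\<close> stands for the tree edge from \<open>v\<close> to
  \<open>par x v\<close>.\<close>

definition Buy :: "nat \<Rightarrow> nat \<Rightarrow> bool" where
  "Buy x v \<longleftrightarrow> x \<in> Full \<or> (\<exists>w \<in> V. Sel x w \<and> (\<exists>i \<le> dist x w. (par x ^^ i) w = v))"

text \<open>Deliberately asymmetric: \<open>v\<close> is the endpoint responsible for the edge, as
  low node, cluster member or child in a tree.\<close>

definition keeps :: "nat \<Rightarrow> nat \<Rightarrow> bool" where
  "keeps v u \<longleftrightarrow> Low v \<or> ctr v = Some u \<or> (\<exists>x \<in> Origin. x \<noteq> v \<and> Buy x v \<and> u = par x v)"

definition spanner :: "nat set set" where
  "spanner = {{u, v} | u v. u \<in> N v \<and> keeps v u}"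

lemma edge_spanner_iff: "{u, v} \<in> spanner \<longleftrightarrow> u \<in> N v \<and> (keeps v u \<or> keeps u v)"
  using N_sym[of u v] by (auto simp: spanner_def doubleton_eq_iff)

text \<open>Peeling off the first path node gives a recursion on the parent, which a wave away from
  \<open>x\<close> can evaluate.\<close>

lemma Cov_step:
  assumes "x \<in> V" "v \<in> V"
  shows "Cov x v \<longleftrightarrow> (\<exists>u \<in> N v. Root u) \<or> x \<noteq> v \<and> Cov x (par x v)"
proof (cases "x = v")
  case True
  then show ?thesis by (simp add: Cov_def)
next
  case False
  with par(2)[OF assms] have d: "dist x v = Suc (dist x (par x v))" by simp
  have "(\<exists>i \<le> Suc k. P i) \<longleftrightarrow> P 0 \<or> (\<exists>i \<le> k. P (Suc i))" for k and P :: "nat \<Rightarrow> bool"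
    by (metis Suc_le_mono not0_implies_Suc zero_le)
  then show ?thesis using False d by (simp add: Cov_def funpow_swap1)
qed

text \<open>The dual recursion, over the children of \<open>v\<close>, is the one a wave towards
  \<open>x\<close> evaluates.\<close>

lemma Buy_step:
  assumes "x \<in> Origin" "v \<in> V"
  shows "Buy x v \<longleftrightarrow> x \<in> Full \<or> Sel x v \<or> (\<exists>u \<in> N v. x \<noteq> u \<and> par x u = v \<and> Buy x u)"
proof
  have x: "x \<in> V" using assms Origin_subset by blast
  assume "Buy x v"
  then consider "x \<in> Full" | w i where "w \<in> V" "Sel x w" "i \<le> dist x w" "(par x ^^ i) w = v"
    by (auto simp: Buy_def)
  then show "x \<in> Full \<or> Sel x v \<or> (\<exists>u \<in> N v. x \<noteq> u \<and> par x u = v \<and> Buy x u)"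
  proof cases
    case 2
    show ?thesis
    proof (cases i)
      case (Suc i')
      let ?u = "(par x ^^ i') w"
      have u: "?u \<in> V" "dist x ?u = dist x w - i'" using par_iter[OF x 2(1), of i'] 2 Suc by auto
      then have ne: "x \<noteq> ?u" using 2 Suc by auto
      moreover have "par x ?u = v" using 2 Suc by simp
      moreover have "?u \<in> N v" using par(1)[OF x u(1) ne] \<open>par x ?u = v\<close> N_sym by blast
      moreover have "Buy x ?u" using 2 Suc unfolding Buy_def by (intro disjI2 bexI[of _ w] conjI exI[of _ i']) auto
      ultimately show ?thesis by blast
    qed (use 2 in auto)
  qed simp
next
  have x: "x \<in> V" using assms Origin_subset by blast
  assume "x \<in> Full \<or> Sel x v \<or> (\<exists>u \<in> N v. x \<noteq> u \<and> par x u = v \<and> Buy x u)"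
  then consider "x \<in> Full" | "Sel x v"
    | u w i where "x \<noteq> u" "par x u = v" "w \<in> V" "Sel x w" "i \<le> dist x w" "(par x ^^ i) w = u"
    by (auto simp: Buy_def)
  then show "Buy x v"
  proof cases
    case 2
    have "(par x ^^ 0) v = v" by simp
    with 2 assms(2) show ?thesis unfolding Buy_def by blast
  next
    case 3
    have "u \<in> V" "dist x u = dist x w - i" using par_iter[OF x 3(3,5)] 3(6) by auto
    with 3(1,5) dist_zero[OF x] have "Suc i \<le> dist x w" by (metis Suc_leI diff_self_eq_0 le_neq_implies_less)
    moreover have "(par x ^^ Suc i) w = v" using 3 by simp
    ultimately show ?thesis using 3 unfolding Buy_def by blast
  qed (simp add: Buy_def)
qed

section \<open>The waves compute this spanner\<close>

context
  assumes few: "card Origin \<le> slack * card S"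
begin

lemma informed_tables:
  assumes "v \<in> V" "informed v d"
  shows "best d x = (if x \<in> Origin then Some (dist x v) else None)"
    "x \<in> Origin \<Longrightarrow> u \<in> N v \<Longrightarrow> tbl d u x = Some (dist x u)"
    "knows_full d x \<longleftrightarrow> x \<in> Full"
proof -
  have s: "settled v d" and d: "tbl d = tbl (d6 v)" "kfull d = kfull (d6 v)"
    using assms by (auto simp: informed_def)
  note flags = settled_flags[OF assms(1) s] settled_flags[OF assms(1) settled_exec(6)[OF assms(1)]]
  have same: "best d = best (d6 v)" "knows_full d = knows_full (d6 v)"
    using flags(2,3,5,6,12,13,15,16) d by (auto simp: best_def knows_full_def fun_eq_iff)
  have told: "(dist y u, y) \<in> told (bfs_run len u)" if "y \<in> Origin" "u \<in> V" for y u
    using told_complete[OF that] time_slot_less_len[OF few that] by simp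
  have b: "best (d6 v) y = Some (dist y v)" if "y \<in> Origin" for y
    unfolding d6_def using that assms(1) told time_slot_less_len[OF few that assms(1)]
    by (intro best_exact_aux) auto
  then show best: "best d x = (if x \<in> Origin then Some (dist x v) else None)"
    using informed_best[OF assms] same by (metis not_None_eq)
  show "tbl d u x = Some (dist x u)" if "x \<in> Origin" "u \<in> N v"
    using told_received_dist[OF N_in_V(1)[OF that(2)] told, of x v] that N_in_V(1)[OF that(2)] N_sym
    by (simp add: d d6_def)
  show "knows_full d x \<longleftrightarrow> x \<in> Full"
  proof
    assume "knows_full d x"
    then show "x \<in> Full" using flags(3,5) kfull_subset[OF assms(1), of len] d by (auto simp: knows_full_def d6_def simp del: settled_exec)
  next
    assume x: "x \<in> Full"
    then have "best (d6 v) x = Some (dist x v)" using b Full_subset by blast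
    from best_SomeD[OF this] consider "x = v"
      | u k where "tbl (d6 v) u x = Some k"
      using flags(15,16) by blast
    then show "knows_full d x"
    proof cases
      case 1
      then show ?thesis using flags(3,5) x by (simp add: knows_full_def)
    next
      case 2
      then have "x \<in> kfull d" using kfull_complete[OF assms(1) x, of len u] d by (simp add: d6_def)
      then show ?thesis by (simp add: knows_full_def)
    qed
  qed
qed

lemma informed_slots:
  assumes "v \<in> V" "informed v d"
  shows "x \<in> Origin \<Longrightarrow> slot d x = time_slot v x"
    "slot_at d c x \<longleftrightarrow> x \<in> Origin \<and> time_slot v x = c"
    "x \<in> Origin \<Longrightarrow> x \<noteq> v \<Longrightarrow> bfs_parent d x = par x v"
    "upcast_at d c x \<longleftrightarrow> x \<in> Origin \<and> time_slot v x + Suc c = len"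
proof -
  have s: "settled v d" using assms by (auto simp: informed_def)
  note t = informed_tables[OF assms]
  have "{y. best d y \<noteq> None \<and> lex_less (the (best d y), y) (dist x v, x)}
    = {y \<in> Origin. lex_less (dist y v, y) (dist x v, x)}"
    by (auto simp: t(1))
  then show slot: "x \<in> Origin \<Longrightarrow> slot d x = time_slot v x" for x
    by (simp add: slot_def time_slot_def rank_def t(1) cong: conj_cong split: if_splits)
      (metis (no_types, lifting) option.distinct(1) option.sel)
  show "slot_at d c x \<longleftrightarrow> x \<in> Origin \<and> time_slot v x = c"
    using slot[of x] by (auto simp: slot_at_def t(1))
  show "upcast_at d c x \<longleftrightarrow> x \<in> Origin \<and> time_slot v x + Suc c = len"
    using slot[of x] settled_flags[OF assms(1) s] by (auto simp: upcast_at_def t(1))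
  show "bfs_parent d x = par x v" if "x \<in> Origin" "x \<noteq> v"
    unfolding bfs_parent_def par_def using settled_flags[OF assms(1) s] that
    by (intro arg_cong[where f = Least] ext) (auto simp: t(1,2))
qed

lemma least_slot: "x \<in> Origin \<Longrightarrow> (LEAST y. y \<in> Origin \<and> time_slot v y = time_slot v x) = x"
  using time_slot_inj by (intro Least_equality) auto

text \<open>The slot of the tree parent is earlier, so its bit is known at \<open>u\<close> when
  \<open>u\<close> has to speak. Distinct origins have distinct slots, so the one message of a round
  concerns the right origin.\<close>

lemma cover_phase_exec:
  "x \<in> Origin \<Longrightarrow> v \<in> V \<Longrightarrow> u \<in> N v \<Longrightarrow> time_slot u x < j
    \<Longrightarrow> ncov (exec E cover_phase d6 j v) u x = Cov x u"
proof (induction j arbitrary: x v u)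
  case 0
  then show ?case by simp
next
  case (Suc j)
  let ?st = "exec E cover_phase d6 j"
  have u: "u \<in> V" using N_in_V(1)[OF Suc.prems(3)] .
  note inf = informed_exec(1)[OF u, of j]
  have cov: "covered (?st u) y = Cov y u" if y: "y \<in> Origin" "time_slot u y = j" for y
  proof -
    have yV: "y \<in> V" using y Origin_subset by blast
    have "ncov (?st u) (par y u) y = Cov y (par y u)" if "y \<noteq> u"
      using Suc.IH[OF y(1) u par(1)[OF yV u that]] time_slot_par[OF y(1) u that] y(2) by simp
    moreover have "(\<exists>w\<in>N u. nroot (?st u) w) \<longleftrightarrow> (\<exists>w\<in>N u. Root w)"
      using settled_flags(9)[OF u settled_exec(3)[OF u, of j]] by blast
    ultimately show ?thesis
      using Cov_step[OF yV u] settled_flags(5,6)[OF u settled_exec(3)[OF u, of j]] informed_slots(3)[OF u inf y(1)]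
      by (auto simp: covered_def)
  qed
  have msg: "ph_send cover_phase j (?st u) v = (if \<exists>y \<in> Origin. time_slot u y = j
      then let y = (LEAST y. y \<in> Origin \<and> time_slot u y = j) in Some (y, of_bool (covered (?st u) y), 0, 0)
      else None)"
  proof -
    have "slot_at (?st u) j = (\<lambda>y. y \<in> Origin \<and> time_slot u y = j)"
      using informed_slots(2)[OF u inf] by (simp add: fun_eq_iff)
    then show ?thesis by (simp only: cover_send Bex_def)
  qed
  have step: "ncov (exec E cover_phase d6 (Suc j) v) u x = (case ph_send cover_phase j (?st u) v of
    Some (y, b, w) \<Rightarrow> if x = y then coded_bool b else ncov (?st v) u x | None \<Rightarrow> ncov (?st v) u x)"
    using Suc.prems(3) by (simp add: exec.simps(2) cover_receive)
  show ?case
  proof (cases "time_slot u x = j")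
    case True
    then show ?thesis
      using step msg cov[OF Suc.prems(1) True] least_slot[OF Suc.prems(1), of u] Suc.prems(1) by auto
  next
    case False
    then have old: "ncov (?st v) u x = Cov x u" using Suc by simp
    show ?thesis
    proof (cases "\<exists>y \<in> Origin. time_slot u y = j")
      case True
      then obtain y where y: "y \<in> Origin" "time_slot u y = j" by blast
      then have "y \<noteq> x" using False by auto
      then show ?thesis using step msg y least_slot[OF y(1), of u] old by auto
    qed (use step msg old in simp)
  qed
qed

definition judged :: "nat \<Rightarrow> node \<Rightarrow> bool" where
  "judged v d \<longleftrightarrow> informed v d \<and> ncov d = ncov (d7 v)"

lemma judged_exec [simp]:
  assumes "v \<in> V"
  shows "judged v (exec E choose_phase d7 j v)" "judged v (exec E upcast_phase d8 j v)" "judged v (d9 v)"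
  using assms by (simp_all add: judged_def, simp_all add: d8_def d9_def)

lemma judged_choice:
  assumes "v \<in> V" "judged v d" "x \<in> Origin"
  shows "choice d x = Choice v x"
proof -
  have inf: "informed v d" and nc: "ncov d = ncov (d7 v)" using assms(2) by (auto simp: judged_def)
  then have s: "settled v d" by (simp add: informed_def)
  have "ncov d z x = Cov x z" if "z \<in> N v" for z
    using cover_phase_exec[OF assms(3,1) that, of len] time_slot_less_len[OF few assms(3) N_in_V(1)[OF that]] nc
    by (simp add: d7_def)
  then have A: "{z \<in> mems d. \<not> ncov d z x} = Cand v x"
    unfolding Cand_def settled_flags(10)[OF assms(1) s] by auto
  have "the (tbl d z x) = dist x z" if "z \<in> Cand v x" for z
    using informed_tables(2)[OF assms(1) inf assms(3)] that by (simp add: Cand_def)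
  then have "(LEAST z. z \<in> Cand v x \<and> (\<forall>z' \<in> Cand v x. the (tbl d z x) \<le> the (tbl d z' x)))
      = (LEAST z. z \<in> Cand v x \<and> (\<forall>z' \<in> Cand v x. dist x z \<le> dist x z'))"
    by (intro arg_cong[where f = Least] ext) auto
  then show ?thesis
    using A informed_tables(3)[OF assms(1) inf] by (auto simp: choice_def Choice_def Let_def)
qed

lemma choose_phase_exec:
  "v \<in> V \<Longrightarrow> sel (exec E choose_phase d7 j v)
    = {x \<in> Origin. \<exists>u \<in> N v. time_slot u x < j \<and> Choice u x = Some v}"
proof (induction j arbitrary: v)
  case 0
  then show ?case by (simp add: d7_def d6_def)
next
  case (Suc j)
  let ?st = "exec E choose_phase d7 j"
  have msg: "(\<exists>w. ph_send choose_phase j (?st u) v = Some (x, w)) \<longleftrightarrow>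
      x \<in> Origin \<and> time_slot u x = j \<and> Choice u x = Some v" if "u \<in> N v" for u x
  proof -
    have u: "u \<in> V" using N_in_V(1)[OF that] .
    have eq: "slot_at (?st u) j = (\<lambda>y. y \<in> Origin \<and> time_slot u y = j)"
      using informed_slots(2)[OF u informed_exec(2)[OF u]] by (simp add: fun_eq_iff)
    have ch: "y \<in> Origin \<Longrightarrow> choice (?st u) y = Choice u y" for y
      using judged_choice[OF u judged_exec(1)[OF u]] .
    have least: "(LEAST y. y \<in> Origin \<and> time_slot u y = j) = x"
      if "x \<in> Origin" "time_slot u x = j" for x
      using that time_slot_inj by (intro Least_equality) auto
    have ex: "(\<exists>y. slot_at (?st u) j y \<and> choice (?st u) y = Some v)
        \<longleftrightarrow> (\<exists>y. y \<in> Origin \<and> time_slot u y = j \<and> Choice u y = Some v)"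
      unfolding eq using ch by metis
    show ?thesis
      unfolding choose_send ex unfolding eq using least by auto
  qed
  have "sel (exec E choose_phase d7 (Suc j) v) = sel (?st v) \<union>
      {x. \<exists>u \<in> N v. \<exists>w. ph_send choose_phase j (?st u) v = Some (x, w)}"
    using settled_flags(6)[OF Suc.prems settled_exec(4)[OF Suc.prems, of j]]
    by (simp add: exec.simps(2) choose_receive cong: bex_cong)
  then show ?case using Suc msg by (auto simp: less_Suc_eq cong: bex_cong)
qed

lemma d8_sel: "v \<in> V \<Longrightarrow> x \<in> sel (d8 v) \<longleftrightarrow> Sel x v"
  using time_slot_less_len[OF few] N_in_V by (auto simp: d8_def choose_phase_exec Sel_def)

text \<open>Children have later slots, so in reversed time they report before their parent decides.
  Decisions and messages depend on each other: the decision is first proved relative to the current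
  \<open>chl\<close>, then used in the induction on rounds.\<close>

lemma upcast_phase_exec:
  "v \<in> V \<Longrightarrow> chl (exec E upcast_phase d8 j v)
    = {(u, x). u \<in> N v \<and> x \<in> Origin \<and> x \<noteq> u \<and> par x u = v \<and> Buy x u \<and> len \<le> time_slot u x + j}"
  and buys_exec: "v \<in> V \<Longrightarrow> x \<in> Origin \<Longrightarrow> len \<le> time_slot v x + Suc j \<Longrightarrow>
    buys (exec E upcast_phase d8 j v) x \<longleftrightarrow> Buy x v"
proof -
  have buys: "buys (exec E upcast_phase d8 j v) x \<longleftrightarrow> Buy x v"
    if v: "v \<in> V" and x: "x \<in> Origin" and slot: "len \<le> time_slot v x + Suc j"
      and chl: "chl (exec E upcast_phase d8 j v)
        = {(u, x). u \<in> N v \<and> x \<in> Origin \<and> x \<noteq> u \<and> par x u = v \<and> Buy x u \<and> len \<le> time_slot u x + j}"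
    for v x j
  proof -
    have "len \<le> time_slot u x + j" if "u \<in> N v" "x \<noteq> u" "par x u = v" for u
      using time_slot_par[OF x N_in_V(1)[OF that(1)] that(2)] that(3) slot by simp
    then have "(\<exists>u. (u, x) \<in> chl (exec E upcast_phase d8 j v)) \<longleftrightarrow>
        (\<exists>u \<in> N v. x \<noteq> u \<and> par x u = v \<and> Buy x u)"
      unfolding chl mem_Collect_eq prod.case using x by blast
    moreover have "x \<in> sel (exec E upcast_phase d8 j v) \<longleftrightarrow> Sel x v"
      by (simp add: d8_sel[OF v])
    ultimately show ?thesis
      unfolding buys_def Buy_step[OF x v] informed_tables(3)[OF v informed_exec(3)[OF v]] by simp
  qed
  show *: "v \<in> V \<Longrightarrow> chl (exec E upcast_phase d8 j v)
    = {(u, x). u \<in> N v \<and> x \<in> Origin \<and> x \<noteq> u \<and> par x u = v \<and> Buy x u \<and> len \<le> time_slot u x + j}" for v j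
  proof (induction j arbitrary: v)
    case 0
    have "\<not> len \<le> time_slot u x" if "u \<in> N v" "x \<in> Origin" for u x
      using time_slot_less_len[OF few that(2) N_in_V(1)[OF that(1)]] by simp
    then show ?case by (auto simp: d8_def d7_def d6_def)
  next
    case (Suc j)
    let ?st = "exec E upcast_phase d8 j"
    have msg: "(\<exists>w. ph_send upcast_phase j (?st u) v = Some (x, w)) \<longleftrightarrow>
        x \<in> Origin \<and> x \<noteq> u \<and> par x u = v \<and> Buy x u \<and> time_slot u x + Suc j = len" if "u \<in> N v" for u x
    proof -
      have u: "u \<in> V" using N_in_V(1)[OF that] .
      have eq: "upcast_at (?st u) j = (\<lambda>y. y \<in> Origin \<and> time_slot u y + Suc j = len)"
        using informed_slots(4)[OF u informed_exec(3)[OF u]] by (simp add: fun_eq_iff)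
      have b: "y \<in> Origin \<Longrightarrow> time_slot u y + Suc j = len \<Longrightarrow> buys (?st u) y \<longleftrightarrow> Buy y u" for y
        using buys[OF u _ _ Suc.IH[OF u]] by simp
      have p: "y \<in> Origin \<Longrightarrow> y \<noteq> u \<Longrightarrow> bfs_parent (?st u) y = par y u" for y
        using informed_slots(3)[OF u informed_exec(3)[OF u]] .
      have sf: "self (?st u) = u" using settled_flags(5)[OF u settled_exec(5)[OF u]] .
      have least: "(LEAST y. y \<in> Origin \<and> time_slot u y + Suc j = len) = x"
        if "x \<in> Origin" "time_slot u x + Suc j = len" for x
      proof (rule Least_equality)
        fix y assume "y \<in> Origin \<and> time_slot u y + Suc j = len"
        with that have "y = x" using time_slot_inj[of y x u] by simp
        then show "x \<le> y" by simp
      qed (rule conjI[OF that])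
      have ex: "(\<exists>y. upcast_at (?st u) j y \<and> y \<noteq> self (?st u) \<and> buys (?st u) y \<and> v = bfs_parent (?st u) y)
          \<longleftrightarrow> (\<exists>y. y \<in> Origin \<and> time_slot u y + Suc j = len \<and> y \<noteq> u \<and> Buy y u \<and> v = par y u)"
        unfolding eq sf using b p by metis
      show ?thesis
        unfolding upcast_send ex unfolding eq using least by auto
    qed
    have eq: "chl (exec E upcast_phase d8 (Suc j) v) = chl (?st v) \<union>
        {(u, x). u \<in> N v \<and> (\<exists>w. ph_send upcast_phase j (?st u) v = Some (x, w))}"
      using settled_flags(6)[OF Suc.prems settled_exec(5)[OF Suc.prems, of j]]
      by (auto simp: exec.simps(2) upcast_receive)
    have le: "len \<le> t + Suc j \<longleftrightarrow> len \<le> t + j \<or> t + Suc j = len" for t by auto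
    show ?case
    proof (rule set_eqI)
      fix p :: "nat \<times> nat"
      obtain u x where p: "p = (u, x)" by force
      show "p \<in> chl (exec E upcast_phase d8 (Suc j) v) \<longleftrightarrow>
        p \<in> {(u, x). u \<in> N v \<and> x \<in> Origin \<and> x \<noteq> u \<and> par x u = v \<and> Buy x u \<and> len \<le> time_slot u x + Suc j}"
        unfolding eq Suc.IH[OF Suc.prems] p Un_iff mem_Collect_eq prod.case le using msg[of u x] by blast
    qed
  qed
  show "v \<in> V \<Longrightarrow> x \<in> Origin \<Longrightarrow> len \<le> time_slot v x + Suc j \<Longrightarrow>
    buys (exec E upcast_phase d8 j v) x \<longleftrightarrow> Buy x v"
    by (rule buys[OF _ _ _ *])
qed

lemma result_eq:
  assumes v: "v \<in> V"
  shows "result (d9 v) = neighbors spanner v"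
proof -
  have flags: "is_low (d9 v) = Low v" "center_of (d9 v) = ctr v" "self (d9 v) = v" "nbrs (d9 v) = N v"
    "\<And>u. nlow (d9 v) u \<longleftrightarrow> u \<in> N v \<and> Low u" "mems (d9 v) = {u \<in> N v. ctr u = Some v}"
    using settled_flags[OF v settled_exec(9)[OF v]] by auto
  have best: "best (d9 v) x \<noteq> None \<longleftrightarrow> x \<in> Origin" for x
    by (simp add: informed_tables(1)[OF v informed_exec(7)[OF v]])
  have p: "x \<in> Origin \<Longrightarrow> x \<noteq> v \<Longrightarrow> bfs_parent (d9 v) x = par x v" for x
    using informed_slots(3)[OF v informed_exec(7)[OF v]] .
  have b: "x \<in> Origin \<Longrightarrow> buys (d9 v) x = Buy x v" for x
    unfolding d9_def using buys_exec[OF v] by simp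
  have up: "{bfs_parent (d9 v) x | x. best (d9 v) x \<noteq> None \<and> x \<noteq> self (d9 v) \<and> buys (d9 v) x}
      = {par x v | x. x \<in> Origin \<and> x \<noteq> v \<and> Buy x v}"
    unfolding best flags(3) using p b by (intro Collect_cong) metis
  have down: "fst ` chl (d9 v) = {u \<in> N v. \<exists>x \<in> Origin. x \<noteq> u \<and> Buy x u \<and> v = par x u}"
    unfolding d9_def upcast_phase_exec[OF v] by force
  have res: "result (d9 v) = {u \<in> N v. Low v \<or> Low u} \<union> {u. ctr v = Some u} \<union> {u \<in> N v. ctr u = Some v}
     \<union> {par x v | x. x \<in> Origin \<and> x \<noteq> v \<and> Buy x v} \<union> {u \<in> N v. \<exists>x \<in> Origin. x \<noteq> u \<and> Buy x u \<and> v = par x u}"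
    unfolding result_def up down unfolding flags by auto
  have ctrN: "u \<in> N w" if "ctr w = Some u" for u w
  proof -
    from that have "\<exists>u. u \<in> N w \<and> Center u" "u = (LEAST u. u \<in> N w \<and> Center u)"
      by (auto simp: ctr_def split: if_splits)
    then show ?thesis by (metis (no_types, lifting) LeastI_ex)
  qed
  have parN: "par x w \<in> N w" if "x \<in> Origin" "x \<noteq> w" "w \<in> V" for x w
    using par(1) that Origin_subset by blast
  have nb: "neighbors spanner v = {u. u \<in> N v \<and> (keeps v u \<or> keeps u v)}"
    by (simp add: neighbors_def[of spanner] edge_spanner_iff)
  show ?thesis
  proof (rule set_eqI)
    show "u \<in> result (d9 v) \<longleftrightarrow> u \<in> neighbors spanner v" for u
      unfolding res nb keeps_def Un_iff mem_Collect_eq using ctrN[of v u] parN[of _ v] v by blast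
  qed
qed

end

end

section \<open>Correctness and size of the spanner\<close>

definition (in spanner_algorithm) spanner_machine :: "(nat \<times> nat \<times> node) machine" where
  "spanner_machine = phased init_node phases result"

section \<open>Rounds and message sizes of the whole machine\<close>

context spanner_run
begin

definition phase_len :: "nat \<Rightarrow> nat" where
  "phase_len p = [3 * radius + 3, radius + 1, radius + 1, 1, 1, len, len, len, len] ! p"

lemma phase_starts:
  "exec_phases E phases phase_len d0 0 = d0" "exec_phases E phases phase_len d0 1 = d1"
  "exec_phases E phases phase_len d0 2 = d2" "exec_phases E phases phase_len d0 3 = d3"
  "exec_phases E phases phase_len d0 4 = d4" "exec_phases E phases phase_len d0 5 = d5"
  "exec_phases E phases phase_len d0 6 = d6" "exec_phases E phases phase_len d0 7 = d7"
  "exec_phases E phases phase_len d0 8 = d8" "exec_phases E phases phase_len d0 9 = d9"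
  by (simp_all add: phases_def phase_len_def eval_nat_numeral d1_def d2_def d3_def d4_def d5_def
      d6_def d7_def d8_def d9_def exec.simps(2))

lemma phase_cases:
  assumes "p < length phases"
  shows "p = 0 \<or> p = 1 \<or> p = 2 \<or> p = 3 \<or> p = 4 \<or> p = 5 \<or> p = 6 \<or> p = 7 \<or> p = 8"
  using assms by (auto simp: phases_def)

lemma phases_nth:
  "phases ! 0 = leader_phase" "phases ! 1 = sum_phase" "phases ! 2 = broadcast_phase"
  "phases ! 3 = flag_phase" "phases ! 4 = join_phase" "phases ! 5 = bfs_phase"
  "phases ! 6 = cover_phase" "phases ! 7 = choose_phase" "phases ! 8 = upcast_phase"
  by (simp_all add: phases_def)

lemma phase_len_nth:
  "phase_len 0 = 3 * radius + 3" "phase_len 1 = radius + 1" "phase_len 2 = radius + 1"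
  "phase_len 3 = 1" "phase_len 4 = 1" "phase_len 5 = len" "phase_len 6 = len"
  "phase_len 7 = len" "phase_len 8 = len"
  by (simp_all add: phase_len_def)

lemma over_simps:
  "ph_over sum_phase c d \<longleftrightarrow> ecc_of d + 1 \<le> c" "ph_over broadcast_phase c d \<longleftrightarrow> ecc_of d + 1 \<le> c"
  "ph_over flag_phase c d \<longleftrightarrow> 1 \<le> c" "ph_over join_phase c d \<longleftrightarrow> 1 \<le> c"
  "ph_over bfs_phase c d \<longleftrightarrow> wave_len d \<le> c" "ph_over cover_phase c d \<longleftrightarrow> wave_len d \<le> c"
  "ph_over choose_phase c d \<longleftrightarrow> wave_len d \<le> c" "ph_over upcast_phase c d \<longleftrightarrow> wave_len d \<le> c"
  by (simp_all add: sum_phase_def broadcast_phase_def flag_phase_def join_phase_def bfs_phase_def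
      cover_phase_def choose_phase_def upcast_phase_def)

lemma phases_over:
  assumes "p < length phases" "0 < j" "j \<le> phase_len p" "v \<in> V"
  shows "ph_over (phases ! p) j (exec E (phases ! p) (exec_phases E phases phase_len d0 p) j v)
    \<longleftrightarrow> j = phase_len p"
proof -
  have wave: "settled v d \<Longrightarrow> wave_len d = len" for d using settled_flags(7)[OF assms(4)] .
  show ?thesis
    using phase_cases[OF assms(1)] assms(2-4)
    by (elim disjE)
      (auto simp: phase_starts phases_nth phase_len_nth over_simps wave leader_phase_over
        simp del: One_nat_def)
qed

lemma phase_len_pos: "p < length phases \<Longrightarrow> 0 < phase_len p"
  by (drule phase_cases) (auto simp: phase_len_def len_def)

lemma machine_result:
  assumes "card Origin \<le> slack * card S" "13 * radius + 4 * slack * card S + 11 \<le> t" "v \<in> V"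
  shows "mach_output spanner_machine (mach_run spanner_machine E S \<omega> t v) = Some (neighbors spanner v)"
proof -
  have nine: "length phases = 9" by (simp add: phases_def)
  \<comment> \<open>\<open>radius\<close> occurs \<open>3 + 1 + 1\<close> times in the first three
    phases and twice in each of the four waves; the constant is \<open>3 + 1 + 1 + 1 + 1\<close>
    plus \<open>1\<close> per wave.\<close>
  have "(\<Sum>q<length phases. phase_len q) = 13 * radius + 4 * slack * card S + 11"
    unfolding nine by (simp add: eval_nat_numeral phase_len_def len_def algebra_simps)
  then show ?thesis
    using phased_result[where phs = phases and len = phase_len and ini = init_node and S = S and \<omega> = \<omega>
        and out = result, OF phases_over[unfolded d0_def] phase_len_pos, of t v] assms
      result_eq[OF assms(1,3)] phase_starts(10)
    unfolding spanner_machine_def nine d0_def by simp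
qed

text \<open>Entries are identifiers, counts, levels, flags or tentative distances. The last are
  bounded by the round number, hence by \<open>len\<close>, for every outcome of the coins.\<close>

lemma machine_message:
  assumes "mach_sent spanner_machine (mach_run spanner_machine E S \<omega> t v) u = Some (p, q, r, s)" "v \<in> V"
  shows "\<forall>x \<in> {p, q, r, s}. x \<in> V \<or> x \<le> (slack + 3) * card V"
proof -
  have "\<exists>i < length phases. \<exists>j < phase_len i.
      ph_send (phases ! i) j (exec E (phases ! i) (exec_phases E phases phase_len d0 i) j v) u = Some (p, q, r, s)"
    using phased_sent[where phs = phases and len = phase_len and ini = init_node and S = S and \<omega> = \<omega>
        and out = result, OF phases_over[unfolded d0_def] phase_len_pos
        assms(1)[unfolded spanner_machine_def] assms(2)]
    unfolding d0_def by blast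
  then obtain i j where i: "i < length phases" and j: "j < phase_len i" and m:
    "ph_send (phases ! i) j (exec E (phases ! i) (exec_phases E phases phase_len d0 i) j v) u = Some (p, q, r, s)"
    by blast
  have n: "0 < card V" using V_nonempty by (simp add: card_gt_0_iff)
  have "radius < card V" using ex_at_radius dist_less_card[of leader] by fastforce
  moreover have "slack * card S \<le> slack * card V"
    using S_subset by (simp add: card_mono)
  ultimately have len: "len \<le> (slack + 3) * card V"
    unfolding len_def add_mult_distrib by linarith
  have small: "x \<le> card V \<Longrightarrow> x \<le> (slack + 3) * card V" for x by (simp add: algebra_simps)
  then have one: "x \<le> 1 \<Longrightarrow> x \<le> (slack + 3) * card V" for x using n small[of x] by linarith
  consider "p \<in> V \<and> q \<le> card V \<and> r \<le> 1 \<and> s \<le> card V" | "p \<le> card V \<and> q \<le> card V \<and> r = 0 \<and> s = 0"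
    | "p \<le> 1 \<and> q \<le> 1 \<and> r \<le> 1 \<and> s = 0" | "p \<in> V \<and> q \<le> len \<and> r \<le> 1 \<and> s = 0"
    using phase_cases[OF i]
  proof (elim disjE)
    assume "i = 0"
    with m j leader_phase_message[of d0 v j u p q r s] assms(2) that(1) show thesis
      by (simp add: phases_def)
  next
    assume "i = 1"
    with m sum_phase_message[of v j u p q r s] assms(2) that(2) show thesis
      using phase_starts by (simp add: phases_nth del: One_nat_def)
  next
    assume "i = 2"
    with m broadcast_phase_message[of v j u p q r s] assms(2) that(2) show thesis
      using phase_starts by (simp add: phases_nth del: One_nat_def)
  next
    assume i: "i = 3"
    show thesis using flag_phase_message m that(3) unfolding i phases_nth by blast
  next
    assume i: "i = 4"
    show thesis using join_phase_message m that(2) unfolding i phases_nth by blast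
  next
    assume "i = 5"
    with m j bfs_phase_message[of v j u p q r s] assms(2) that(4) show thesis
      using phase_starts by (simp add: phases_nth phase_len_nth del: One_nat_def)
  next
    assume "i = 6"
    with m j cover_phase_message[of v j u p q r s] assms(2) that(4) show thesis
      using phase_starts by (simp add: phases_nth phase_len_nth del: One_nat_def)
  next
    assume "i = 7"
    with m j choose_phase_message[of v j u p q r s] assms(2) that(4) show thesis
      using phase_starts by (simp add: phases_nth phase_len_nth del: One_nat_def)
  next
    assume "i = 8"
    with m j upcast_phase_message[of v j u p q r s] assms(2) that(4) show thesis
      using phase_starts by (simp add: phases_nth phase_len_nth del: One_nat_def)
  qed
  then show ?thesis
  proof cases
    case 4
    then show ?thesis using one le_trans[OF _ len] by auto
  qed (use small one in auto)
qed

lemma ctr_SomeD: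
  assumes "ctr v = Some u"
  shows "u \<in> N v" "Center u" "\<not> Low v"
proof -
  from assms have "\<exists>u. u \<in> N v \<and> Center u" "u = (LEAST u. u \<in> N v \<and> Center u)" "\<not> Low v"
    by (auto simp: ctr_def split: if_splits)
  then show "u \<in> N v" "Center u" "\<not> Low v" by (metis (no_types, lifting) LeastI_ex)+
qed

lemma spanner_subset: "spanner \<subseteq> E"
  by (auto simp: spanner_def neighbors_def)

section \<open>Walks in the spanner and additive stretch two\<close>

abbreviation walk :: "nat \<Rightarrow> nat \<Rightarrow> nat \<Rightarrow> bool" where
  "walk u k v \<equiv> (u, v) \<in> adjacency spanner ^^ k"

lemma walk_snoc: "walk u k v \<Longrightarrow> {v, w} \<in> spanner \<Longrightarrow> walk u (Suc k) w"
  by (auto simp: adjacency_def)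

lemma walk_sym: "walk u k v \<Longrightarrow> walk v k u"
proof (induction k arbitrary: u v)
  case (Suc k)
  then obtain w where "walk u k w" "(w, v) \<in> adjacency spanner" by auto
  with Suc.IH[of u w] have "walk w k u" "(v, w) \<in> adjacency spanner"
    by (auto simp: adjacency_def insert_commute)
  then show ?case by (metis relpow_Suc_I2)
qed simp

lemma walk_trans: "walk u k v \<Longrightarrow> walk v l w \<Longrightarrow> walk u (k + l) w"
  by (auto simp: relpow_add)

lemma bought_walk:
  assumes "x \<in> Origin"
  shows "v \<in> V \<Longrightarrow> (\<And>i. i < dist x v \<Longrightarrow> Buy x ((par x ^^ i) v)) \<Longrightarrow> walk x (dist x v) v"
proof (induction "dist x v" arbitrary: v)
  case 0
  then show ?case using assms Origin_subset dist_zero[of x v] by force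
next
  case (Suc k)
  have x: "x \<in> V" using assms Origin_subset by blast
  have ne: "x \<noteq> v" using Suc.hyps(2) by auto
  note p = par[OF x Suc.prems(1) ne]
  have "Buy x ((par x ^^ i) (par x v))" if "i < dist x (par x v)" for i
    using Suc.prems(2)[of "Suc i"] that p(2) by (simp add: funpow_swap1)
  then have "walk x (dist x (par x v)) (par x v)"
    using Suc.hyps p N_in_V by (intro Suc.hyps(1)) auto
  moreover have "{par x v, v} \<in> spanner"
    using Suc.prems(2)[of 0] p ne assms Suc.hyps(2) by (auto simp: edge_spanner_iff keeps_def)
  ultimately show ?case using walk_snoc p(2) by metis
qed

lemma full_walk: "x \<in> Full \<Longrightarrow> v \<in> V \<Longrightarrow> walk x (dist x v) v"
  using Full_subset by (intro bought_walk) (auto simp: Buy_def)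

lemma selected_walk:
  assumes "Sel x w" "w \<in> V"
  shows "walk x (dist x w) w"
proof (rule bought_walk)
  show "Buy x ((par x ^^ i) w)" if "i < dist x w" for i
    unfolding Buy_def using assms that by (intro disjI2 bexI[of _ w] conjI exI[of _ i]) auto
qed (use assms in \<open>auto simp: Sel_def\<close>)

lemma Choice_SomeD:
  assumes "Choice c x = Some z"
  shows "z \<in> Cand c x" "\<And>z'. z' \<in> Cand c x \<Longrightarrow> dist x z \<le> dist x z'" "x \<notin> Full"
proof -
  from assms have ne: "Cand c x \<noteq> {}" and full: "x \<notin> Full"
    and z: "z = (LEAST z. z \<in> Cand c x \<and> (\<forall>z' \<in> Cand c x. dist x z \<le> dist x z'))"
    by (auto simp: Choice_def split: if_splits)
  from ne obtain z' where "z' \<in> Cand c x" by blast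
  then have "\<exists>z. z \<in> Cand c x \<and> (\<forall>z' \<in> Cand c x. dist x z \<le> dist x z')"
    using ex_has_least_nat[of "\<lambda>z. z \<in> Cand c x" z' "dist x"] by blast
  from LeastI_ex[OF this] z show "z \<in> Cand c x" "\<And>z'. z' \<in> Cand c x \<Longrightarrow> dist x z \<le> dist x z'"
    by auto
  show "x \<notin> Full" by (rule full)
qed

text \<open>A root next to a path node \<open>w\<close> keeps its whole tree, and the route through
  it has length at most \<open>dist s w + 1 + 1 + dist w v = dist s v + 2\<close>.\<close>

lemma covered_walk:
  assumes "s \<in> V" "v \<in> V" "Cov s v"
  shows "\<exists>k \<le> dist s v + 2. walk s k v"
proof -
  from assms(3) obtain i r where i: "i \<le> dist s v" "r \<in> N ((par s ^^ i) v)" "Root r"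
    by (auto simp: Cov_def)
  let ?w = "(par s ^^ i) v"
  have w: "?w \<in> V" "dist s ?w = dist s v - i" "dist ?w v \<le> i"
    using par_iter[OF assms(1,2) i(1)] dist_par_iter[OF assms(1,2) i(1)] by auto
  have r: "r \<in> V" "r \<in> Full" using i N_in_V by (auto simp: Full_def)
  have "dist s r \<le> Suc (dist s ?w)" using dist_N[of ?w r s] i(2) N_sym assms(1) by blast
  moreover have "dist v r \<le> Suc (dist v ?w)" using dist_N[of ?w r v] i(2) N_sym assms(2) by blast
  moreover have "walk s (dist r s) r" using full_walk[OF r(2) assms(1)] walk_sym by blast
  then have "walk s (dist r s + dist r v) v" using full_walk[OF r(2) assms(2)] walk_trans by blast
  ultimately show ?thesis
    using w i(1) dist_sym[of r s] dist_sym[of r v] dist_sym[of v ?w] r(1) assms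
    by (intro exI[of _ "dist r s + dist r v"]) auto
qed

text \<open>Errors do not add up. If the last tree edge is kept, the walk to the parent is extended
  without further loss. Otherwise a walk is built from scratch: in the full tree of
  \<open>s\<close>, through a root, or through the center of \<open>v\<close>.\<close>

lemma short_walk:
  assumes s: "s \<in> S" and clustered: "\<And>v. v \<in> V \<Longrightarrow> s \<notin> Full \<Longrightarrow> \<not> Low v \<Longrightarrow> \<exists>c \<in> N v. Center c"
  shows "v \<in> V \<Longrightarrow> \<exists>k \<le> dist s v + 2. walk s k v"
proof (induction "dist s v" arbitrary: v)
  case 0
  then have "s = v" using s S_subset dist_zero by auto
  then have "walk s 0 v" by simp
  then show ?case by blast
next
  case (Suc d)
  have sV: "s \<in> V" using s S_subset by blast
  have sO: "s \<in> Origin" using s sV by (simp add: Origin_def)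
  have ne: "s \<noteq> v" using Suc.hyps(2) by auto
  note p = par[OF sV Suc.prems ne]
  have pV: "par s v \<in> V" using p N_in_V by blast
  consider "s \<in> Full" | "{par s v, v} \<in> spanner" | "s \<notin> Full" "\<not> Low v" "Cov s v"
    | "s \<notin> Full" "\<not> Low v" "\<not> Cov s v"
    using p(1) by (auto simp: edge_spanner_iff keeps_def)
  then show ?case
  proof cases
    case 1
    then show ?thesis using full_walk[OF 1 Suc.prems] by (intro exI[of _ "dist s v"]) auto
  next
    case 2
    have "\<exists>k \<le> dist s (par s v) + 2. walk s k (par s v)"
      using Suc.hyps p(2) pV by (intro Suc.hyps(1)) auto
    then obtain k where "k \<le> dist s (par s v) + 2" "walk s k (par s v)" by blast
    then show ?thesis using walk_snoc[OF _ 2] p(2) by (intro exI[of _ "Suc k"]) auto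
  next
    case 3
    then show ?thesis using covered_walk[OF sV Suc.prems] by blast
  next
    case 4
    then have "\<exists>c. ctr v = Some c" using clustered[OF Suc.prems] by (auto simp: ctr_def)
    then obtain c where c: "ctr v = Some c" by blast
    \<comment> \<open>Since \<open>v\<close> itself is a candidate, the selected \<open>z\<close> is
      no farther from \<open>s\<close> than \<open>v\<close>; the walk ends with \<open>z\<close>,
      \<open>c\<close>, \<open>v\<close>.\<close>
    have cand: "v \<in> Cand c s" using 4 c ctr_SomeD[OF c] N_sym by (auto simp: Cand_def)
    then obtain z where z: "Choice c s = Some z" using 4 by (cases "Choice c s") (auto simp: Choice_def split: if_splits)
    note z' = Choice_SomeD[OF z]
    have zc: "z \<in> N c" "ctr z = Some c" using z' by (auto simp: Cand_def)
    have zV: "z \<in> V" using N_in_V(1)[OF zc(1)] .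
    have "Sel s z" using sO z zc(1) N_sym by (auto simp: Sel_def)
    from selected_walk[OF this zV] have "walk s (dist s z) z" .
    moreover have "{z, c} \<in> spanner" "{c, v} \<in> spanner"
      using zc c ctr_SomeD[OF c] N_sym by (auto simp: edge_spanner_iff keeps_def)
    ultimately have "walk s (Suc (Suc (dist s z))) v" using walk_snoc by blast
    then show ?thesis using z'(2)[OF cand] by (intro exI[of _ "Suc (Suc (dist s z))"]) auto
  qed
qed

lemma spanner_correct:
  assumes "\<And>s v. s \<in> S \<Longrightarrow> s \<notin> Full \<Longrightarrow> v \<in> V \<Longrightarrow> \<not> Low v \<Longrightarrow> \<exists>c \<in> N v. Center c"
  shows "sourcewise_spanner2 V E S spanner"
  unfolding sourcewise_spanner2_def
proof (intro conjI ballI spanner_subset)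
  fix s v assume sv: "s \<in> S" "v \<in> V"
  obtain k where k: "k \<le> dist s v + 2" "walk s k v" using short_walk[OF sv(1) _ sv(2)] assms sv(1) by blast
  have "graph_dist spanner s v \<le> enat k" unfolding graph_dist_def by (rule INF_lower) (use k in simp)
  also have "\<dots> \<le> enat (dist s v + 2)" using k by simp
  also have "\<dots> = graph_dist E s v + 2"
    using graph_dist_eq sv S_subset by (auto simp: numeral_eq_enat)
  finally show "graph_dist spanner s v \<le> graph_dist E s v + 2" .
qed

text \<open>The index \<open>i\<close> stands for the edge from the \<open>i\<close>-th node of the tree path from \<open>z\<close> towards
  \<open>x\<close> to its parent.\<close>

definition missing :: "nat \<Rightarrow> nat \<Rightarrow> nat set" where
  "missing x z = {i. i < dist x z \<and> \<not> Low ((par x ^^ i) z)}"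

lemma finite_missing [simp]: "finite (missing x z)"
  unfolding missing_def by (rule finite_subset[of _ "{..<dist x z}"]) auto

text \<open>\<open>A\<close> collects the edges of low nodes and the center edges, \<open>C\<close>
  the trees of full origins, and \<open>D\<close> the bought paths, at most one per source and
  center. Edges kept by low nodes are already in \<open>A\<close>, so a path is charged only for its
  missing edges.\<close>

lemma card_spanner:
  fixes h \<beta> :: real
  assumes low: "\<And>v. v \<in> V \<Longrightarrow> Low v \<Longrightarrow> real (card (N v)) \<le> h" and "0 \<le> h" "0 \<le> \<beta>"
    and few: "\<And>x z. x \<in> S \<Longrightarrow> z \<in> V \<Longrightarrow> x \<notin> Full \<Longrightarrow> \<not> Cov x z \<Longrightarrow> real (card (missing x z)) \<le> \<beta>"
    and ctrs: "\<And>v. v \<in> V \<Longrightarrow> ctr v \<noteq> None \<Longrightarrow> 1 \<le> h"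
  shows "real (card spanner) \<le> real (card V) * h + real (card Full) * real (card V)
    + real (card S) * real (card {c \<in> V. Center c}) * \<beta>"
proof -
  let ?Z = "{c \<in> V. Center c}"
  \<comment> \<open>A node contributes either all its edges or at most one center edge;
    \<open>ctrs\<close> lets \<open>h\<close> pay for the latter too.\<close>
  define K where "K v = (if Low v then (\<lambda>u. {u, v}) ` N v else (\<lambda>u. {u, v}) ` set_option (ctr v))" for v
  define A where "A = (\<Union>v \<in> V. K v)"
  define C where "C = (\<lambda>(x, v). {par x v, v}) ` (Full \<times> V)"
  define P where "P = (\<lambda>(x, c). case Choice c x of None \<Rightarrow> {}
    | Some z \<Rightarrow> (\<lambda>i. {par x ((par x ^^ i) z), (par x ^^ i) z}) ` missing x z)"
  define D where "D = (\<Union>p \<in> (S - Full) \<times> ?Z. P p)"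
  have fin [simp]: "finite S" "finite Full"
    using finite_subset[OF S_subset finite_V] finite_subset[OF Full_subset finite_Origin] by auto
  have "spanner \<subseteq> A \<union> C \<union> D"
  proof
    fix e assume "e \<in> spanner"
    then obtain u v where e: "e = {u, v}" "u \<in> N v" "keeps v u" by (auto simp: spanner_def)
    then have v: "v \<in> V" using N_in_V by blast
    from e(3) consider "Low v" | "\<not> Low v" "ctr v = Some u"
      | x where "\<not> Low v" "x \<in> Origin" "x \<noteq> v" "Buy x v" "u = par x v"
      by (auto simp: keeps_def)
    then show "e \<in> A \<union> C \<union> D"
    proof cases
      case 1
      then show ?thesis using e v by (auto simp: A_def K_def intro!: bexI[of _ v])
    next
      case 2
      then show ?thesis using e v by (auto simp: A_def K_def intro!: bexI[of _ v])
    next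
      case (3 x)
      show ?thesis
      proof (cases "x \<in> Full")
        case True
        then show ?thesis using e v 3 by (auto simp: C_def)
      next
        case False
        with 3(4) obtain w i where w: "w \<in> V" "Sel x w" "i \<le> dist x w" "(par x ^^ i) w = v"
          by (auto simp: Buy_def)
        from w(2) obtain c where c: "c \<in> N w" "Choice c x = Some w" by (auto simp: Sel_def)
        have x: "x \<in> V" using 3 Origin_subset by blast
        \<comment> \<open>At the end \<open>x\<close> of the path there is no parent edge, so this
          index must not be counted.\<close>
        have "i \<noteq> dist x w" using par_iter[OF x w(1,3)] w(4) 3(3) dist_zero[OF x] by fastforce
        with w 3 have "i \<in> missing x w" by (simp add: missing_def)
        then have "e \<in> P (x, c)" using c w(4) 3 e by (auto simp: P_def)
        moreover have "x \<in> S" using 3(2) False by (auto simp: Origin_def Full_def)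
        moreover have "c \<in> ?Z" using Choice_SomeD(1)[OF c(2)] c(1) N_in_V ctr_SomeD(2) by (auto simp: Cand_def)
        ultimately show ?thesis using False unfolding D_def by blast
      qed
    qed
  qed
  moreover have finP: "finite (P p)" for p by (auto simp: P_def split: prod.splits option.splits)
  have finA: "finite A" unfolding A_def K_def by auto
  have finD: "finite D" unfolding D_def using finP by auto
  have finC: "finite C" unfolding C_def by auto
  ultimately have "card spanner \<le> card (A \<union> C \<union> D)" using finA finD by (intro card_mono) auto
  also have "\<dots> \<le> card A + card C + card D" by (meson add_le_mono card_Un_le le_refl le_trans)
  finally have "real (card spanner) \<le> real (card A) + real (card C) + real (card D)" by linarith
  moreover have "real (card A) \<le> real (card V) * h"
  proof -
    have "card A \<le> (\<Sum>v\<in>V. card (K v))"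
      unfolding A_def by (rule card_UN_le) simp
    then have "real (card A) \<le> (\<Sum>v\<in>V. real (card (K v)))"
      by (simp only: of_nat_sum[symmetric] of_nat_le_iff)
    also have "\<dots> \<le> (\<Sum>v\<in>V. h)"
    proof (rule sum_mono)
      fix v assume v: "v \<in> V"
      show "real (card (K v)) \<le> h"
      proof (cases "Low v")
        case True
        have "card ((\<lambda>u. {u, v}) ` N v) \<le> card (N v)" by (rule card_image_le) simp
        with low[OF v True] True show ?thesis by (simp add: K_def)
      next
        case False
        then show ?thesis unfolding K_def using ctrs[OF v] \<open>0 \<le> h\<close> by (cases "ctr v") auto
      qed
    qed
    finally show ?thesis by simp
  qed
  moreover have "real (card C) \<le> real (card Full) * real (card V)"
  proof -
    have "card C \<le> card (Full \<times> V)" unfolding C_def by (rule card_image_le) simp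
    then show ?thesis unfolding card_cartesian_product by (simp only: of_nat_mult[symmetric] of_nat_le_iff)
  qed
  moreover have "real (card D) \<le> real (card S) * real (card ?Z) * \<beta>"
  proof -
    have "real (card (P p)) \<le> \<beta>" if "p \<in> (S - Full) \<times> ?Z" for p
    proof -
      obtain x c where p: "p = (x, c)" "x \<in> S" "x \<notin> Full" using \<open>p \<in> _\<close> by auto
      show ?thesis
      proof (cases "Choice c x")
        case None
        then show ?thesis using p \<open>0 \<le> \<beta>\<close> by (simp add: P_def)
      next
        case (Some z)
        then have "z \<in> V" "\<not> Cov x z" using Choice_SomeD(1)[OF Some] N_in_V by (auto simp: Cand_def)
        from few[OF p(2) this(1) p(3) this(2)] have "real (card (missing x z)) \<le> \<beta>" .
        moreover have "card (P p) \<le> card (missing x z)"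
          using Some p by (auto simp: P_def intro: card_image_le)
        ultimately show ?thesis by linarith
      qed
    qed
    then have "(\<Sum>p \<in> (S - Full) \<times> ?Z. real (card (P p))) \<le> real (card ((S - Full) \<times> ?Z)) * \<beta>"
      by (intro sum_bounded_above)
    moreover have "card D \<le> (\<Sum>p \<in> (S - Full) \<times> ?Z. card (P p))"
      unfolding D_def by (rule card_UN_le) auto
    then have "real (card D) \<le> (\<Sum>p \<in> (S - Full) \<times> ?Z. real (card (P p)))"
      by (simp only: of_nat_sum[symmetric] of_nat_le_iff)
    moreover have "card ((S - Full) \<times> ?Z) \<le> card S * card ?Z"
      unfolding card_cartesian_product by (intro mult_le_mono1 card_mono) auto
    then have "real (card ((S - Full) \<times> ?Z)) * \<beta> \<le> real (card S * card ?Z) * \<beta>"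
      using \<open>0 \<le> \<beta>\<close> by (intro mult_right_mono) linarith+
    ultimately show ?thesis by simp
  qed
  ultimately show ?thesis by linarith
qed

end

section \<open>Random choices\<close>

text \<open>The rates depend on \<open>n\<close> and \<open>|S|\<close>, which are unknown when the
  coins are drawn. A geometric coin postpones the choice: comparing it later with any threshold
  \<open>j\<close> succeeds with probability \<open>(1 / 2) ^ j\<close>.\<close>

definition coins :: "nat set \<Rightarrow> (nat \<Rightarrow> nat) pmf" where
  "coins V = Pi_pmf V 0 (\<lambda>_. geometric_pmf (1 / 2))"

lemma prob_geometric_less: "measure_pmf.prob (geometric_pmf (1 / 2)) {..<j} = 1 - (1 / 2) ^ j"
proof -
  have "measure_pmf.prob (geometric_pmf (1 / 2)) {..<j} = (\<Sum>i<j. (1 / 2) ^ i * (1 / 2))"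
    by (simp add: measure_measure_pmf_finite)
  also have "\<dots> = 1 - (1 / 2) ^ j"
    by (induction j) (auto simp: field_simps)
  finally show ?thesis .
qed

lemma prob_all_less:
  assumes "finite V" "W \<subseteq> V"
  shows "measure_pmf.prob (coins V) {\<omega>. \<forall>u\<in>W. \<omega> u < j} = (1 - (1 / 2) ^ j) ^ card W"
proof -
  have "{\<omega>. \<forall>u\<in>W. \<omega> u < j} = Pi V (\<lambda>u. if u \<in> W then {..<j} else UNIV)"
    using assms(2) by (auto simp: Pi_def)
  then have "measure_pmf.prob (coins V) {\<omega>. \<forall>u\<in>W. \<omega> u < j}
      = (\<Prod>u\<in>V. measure_pmf.prob (geometric_pmf (1 / 2)) (if u \<in> W then {..<j} else UNIV))"
    using assms(1) by (simp add: coins_def measure_Pi_pmf_Pi)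
  also have "\<dots> = (\<Prod>u\<in>V. if u \<in> W then 1 - (1 / 2) ^ j else 1)"
    by (intro prod.cong) (auto simp: prob_geometric_less)
  also have "\<dots> = (\<Prod>u\<in>W. 1 - (1 / 2) ^ j)"
    using assms by (simp add: prod.If_cases Int_absorb1)
  finally show ?thesis by simp
qed

text \<open>Exponential Markov inequality, using \<open>E exp 1[j \<le> \<omega> v] = 1 + (e - 1) p \<le> exp (2 p)\<close>
  with \<open>p = 2\<^sup>-\<^sup>j\<close>.\<close>

lemma prob_many_large:
  assumes "finite V"
  shows "measure_pmf.prob (coins V) {\<omega>. t \<le> real (card {v \<in> V. j \<le> \<omega> v})}
    \<le> exp (2 * (1 / 2) ^ j * real (card V) - t)"
proof -
  let ?G = "measure_pmf (geometric_pmf (1 / 2))"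
  define p :: real where "p = (1 / 2) ^ j"
  define f :: "nat \<Rightarrow> real" where "f g = (if j \<le> g then exp 1 else 1)" for g
  have f_eq: "f g = 1 + (exp 1 - 1) * indicator (- {..<j}) g" for g
    by (simp add: f_def indicator_def)
  have prob: "measure ?G (- {..<j}) = p"
    using measure_pmf.prob_compl[of "{..<j}" "geometric_pmf (1 / 2)"]
    by (simp add: prob_geometric_less p_def Compl_eq_Diff_UNIV)
  have int: "integrable ?G f"
    by (rule measure_pmf.integrable_const_bound[where B = "exp 1"]) (auto simp: f_def)
  have Ef: "measure_pmf.expectation (geometric_pmf (1 / 2)) f = 1 + (exp 1 - 1) * p"
  proof -
    have "integrable ?G (indicator (- {..<j}) :: nat \<Rightarrow> real)"
      by (rule measure_pmf.integrable_const_bound[where B = 1]) auto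
    then show ?thesis unfolding f_eq by (subst Bochner_Integration.integral_add) (auto simp: prob simp flip: Compl_lessThan)
  qed
  have prod_f: "(\<Prod>v\<in>V. f (\<omega> v)) = exp (real (card {v \<in> V. j \<le> \<omega> v}))" for \<omega>
  proof -
    have "(\<Prod>v\<in>V. f (\<omega> v)) = (\<Prod>v | v \<in> V \<and> j \<le> \<omega> v. exp 1)"
      unfolding f_def by (rule prod.inter_filter[OF assms, symmetric])
    also have "\<dots> = exp (real (card {v \<in> V. j \<le> \<omega> v}))"
      by (simp flip: exp_of_nat_mult)
    finally show ?thesis .
  qed
  have E: "measure_pmf.expectation (coins V) (\<lambda>\<omega>. exp (real (card {v \<in> V. j \<le> \<omega> v})))
      = (1 + (exp 1 - 1) * p) ^ card V"
  proof -
    have "0 \<le> f g" for g by (simp add: f_def)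
    then have "measure_pmf.expectation (coins V) (\<lambda>\<omega>. \<Prod>v\<in>V. f (\<omega> v))
        = (\<Prod>v\<in>V. measure_pmf.expectation (geometric_pmf (1 / 2)) f)"
      unfolding coins_def using int by (intro expectation_prod_Pi_pmf[OF assms]) auto
    then show ?thesis by (simp add: prod_f Ef)
  qed
  have int': "integrable (measure_pmf (coins V)) (\<lambda>\<omega>. exp (real (card {v \<in> V. j \<le> \<omega> v})))"
    using assms by (intro measure_pmf.integrable_const_bound[where B = "exp (real (card V))"])
      (auto intro!: card_mono)
  have "measure_pmf.prob (coins V) {\<omega>. exp t \<le> exp (real (card {v \<in> V. j \<le> \<omega> v}))}
      \<le> (1 + (exp 1 - 1) * p) ^ card V / exp t"
    using integral_Markov_inequality_measure[OF int', of "{}" "exp t"] E by simp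
  also have "(1 + (exp 1 - 1) * p) ^ card V \<le> exp (2 * p) ^ card V"
  proof (rule power_mono)
    have "(exp 1 - 1) * p \<le> 2 * p" using exp_le by (intro mult_right_mono) (auto simp: p_def)
    then show "1 + (exp 1 - 1) * p \<le> exp (2 * p)" using exp_ge_add_one_self[of "2 * p"] by linarith
    show "0 \<le> 1 + (exp 1 - 1) * p" by (simp add: p_def)
  qed
  also have "exp (2 * p) ^ card V / exp t = exp (2 * p * real (card V) - t)"
    by (simp add: exp_diff mult_ac flip: exp_of_nat_mult)
  finally show ?thesis by (simp add: p_def divide_right_mono)
qed

text \<open>Rounds the rate \<open>y\<close> up to a power of \<open>1 / 2\<close>, losing at most a
  factor of two. Level \<open>0\<close> means \<open>1 / 2 \<le> y\<close> and selects every node,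
  so rates above \<open>1\<close> are harmless.\<close>

definition level :: "real \<Rightarrow> nat" where
  "level y = (LEAST j. (1 / 2) ^ j \<le> 2 * y)"

lemma level:
  assumes "0 < y"
  shows "(1 / 2) ^ level y \<le> 2 * y" "level y = 0 \<or> y \<le> (1 / 2) ^ level y"
proof -
  have "\<exists>j. (1 / 2) ^ j \<le> 2 * y"
    using real_arch_pow_inv[of "2 * y" "1 / 2"] assms by (auto intro: less_imp_le)
  from LeastI_ex[OF this] show "(1 / 2) ^ level y \<le> 2 * y" by (simp add: level_def)
  show "level y = 0 \<or> y \<le> (1 / 2) ^ level y"
  proof (cases "level y")
    case (Suc j)
    then have "\<not> (1 / 2) ^ j \<le> 2 * y" using not_less_Least[of j "\<lambda>j. (1 / 2) ^ j \<le> 2 * y"] by (simp add: level_def)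
    then show ?thesis using Suc by simp
  qed simp
qed

text \<open>The usual estimate of \<open>(1 - p) ^ m\<close> by \<open>exp (- p * m)\<close>. At
  level \<open>0\<close> all nodes are selected, and \<open>0 < x\<close> forces \<open>W\<close> to
  be nonempty.\<close>

lemma prob_not_hit:
  assumes "finite V" "W \<subseteq> V" "0 < y" "0 < x" "x \<le> y * real (card W)"
  shows "measure_pmf.prob (coins V) {\<omega>. \<forall>u\<in>W. \<omega> u < level y} \<le> exp (- x)"
proof (cases "level y = 0")
  case True
  have "W \<noteq> {}" using assms(4,5) by auto
  then have "card W \<noteq> 0" using assms(1,2) by (auto dest: finite_subset)
  with \<open>W \<noteq> {}\<close> show ?thesis using True by (simp add: prob_all_less[OF assms(1,2)] zero_power)
next
  case False
  define p :: real where "p = (1 / 2) ^ level y"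
  have p: "y \<le> p" "p \<le> 1" using level(2)[OF assms(3)] False by (auto simp: p_def power_le_one)
  have "(1 - p) ^ card W \<le> exp (- p) ^ card W"
    using exp_ge_add_one_self[of "- p"] p by (intro power_mono) auto
  also have "\<dots> = exp (- (p * real (card W)))" by (simp add: mult_ac flip: exp_of_nat_mult)
  also have "\<dots> \<le> exp (- x)" using assms(5) mult_right_mono[OF p(1), of "real (card W)"] by simp
  finally show ?thesis by (simp add: prob_all_less[OF assms(1,2)] p_def)
qed

text \<open>Rounding and the Markov bound each cost a factor of two. The factor \<open>6\<close>
  leaves the exponent \<open>4 y n - 6 y n = - 2 y n\<close> with \<open>n = card V\<close>.\<close>

lemma prob_large_set:
  assumes "finite V" "0 < y" "x \<le> 2 * y * real (card V)"
  shows "measure_pmf.prob (coins V) {\<omega>. 6 * y * real (card V) \<le> real (card {v \<in> V. level y \<le> \<omega> v})}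
    \<le> exp (- x)"
proof -
  have "2 * (1 / 2) ^ level y * real (card V) \<le> 2 * (2 * y) * real (card V)"
    using level(1)[OF assms(2)] by (intro mult_right_mono mult_left_mono) auto
  then have "exp (2 * (1 / 2) ^ level y * real (card V) - 6 * y * real (card V)) \<le> exp (- x)"
    unfolding exp_le_cancel_iff using assms(3) by (simp add: algebra_simps)
  with prob_many_large[OF assms(1), of "6 * y * real (card V)" "level y"] show ?thesis by linarith
qed

section \<open>Nodes next to a tree path\<close>

context spanner_run
begin

definition vicinity :: "nat \<Rightarrow> nat \<Rightarrow> nat set" where
  "vicinity x z = (\<Union>i \<in> missing x z. N ((par x ^^ i) z))"

lemma vicinity_subset: "vicinity x z \<subseteq> V"
  using N_subset_V by (auto simp: vicinity_def)

text \<open>Double counting: a node has neighbours on at most three levels of a breadth-first search tree,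
  hence is adjacent to at most three nodes of a path in the tree.\<close>

lemma card_vicinity:
  fixes h :: real
  assumes "x \<in> V" "z \<in> V" and high: "\<And>v. v \<in> V \<Longrightarrow> \<not> Low v \<Longrightarrow> h \<le> real (card (N v))"
  shows "h * real (card (missing x z)) \<le> 3 * real (card (vicinity x z))"
proof -
  let ?M = "missing x z" and ?W = "vicinity x z" and ?p = "\<lambda>i. (par x ^^ i) z"
  have fin: "finite ?W" using vicinity_subset finite_V by (rule finite_subset)
  have path: "?p i \<in> V \<and> dist x (?p i) = dist x z - i \<and> i < dist x z \<and> \<not> Low (?p i)" if "i \<in> ?M" for i
    using that par_iter[OF assms(1,2), of i] by (auto simp: missing_def)
  have "h * real (card ?M) = (\<Sum>i\<in>?M. h)" by simp
  also have "\<dots> \<le> (\<Sum>i\<in>?M. real (card (N (?p i))))"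
    using path high by (intro sum_mono) auto
  also have "\<dots> = real (\<Sum>i\<in>?M. card {u \<in> ?W. u \<in> N (?p i)})"
    by (simp, intro sum.cong refl arg_cong[where f = real] arg_cong[where f = card]) (auto simp: vicinity_def)
  also have "(\<Sum>i\<in>?M. card {u \<in> ?W. u \<in> N (?p i)}) = (\<Sum>u\<in>?W. card {i \<in> ?M. u \<in> N (?p i)})"
    using fin by (intro sum_multicount_gen) auto
  also have "\<dots> \<le> (\<Sum>u\<in>?W. 3)"
  proof (rule sum_mono)
    fix u assume "u \<in> ?W"
    have "{i \<in> ?M. u \<in> N (?p i)} \<subseteq> {dist x z - dist x u - 1 .. dist x z + 1 - dist x u}"
    proof
      fix i assume i: "i \<in> {i \<in> ?M. u \<in> N (?p i)}"
      then have "u \<in> N (?p i)" "?p i \<in> N u" using N_sym by auto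
      with path[of i] i dist_N[of u "?p i" x] dist_N[of "?p i" u x] assms(1)
      show "i \<in> {dist x z - dist x u - 1 .. dist x z + 1 - dist x u}" by auto
    qed
    then have "card {i \<in> ?M. u \<in> N (?p i)} \<le> card {dist x z - dist x u - 1 .. dist x z + 1 - dist x u}"
      by (rule card_mono[rotated]) simp
    also have "\<dots> \<le> 3" by simp
    finally show "card {i \<in> ?M. u \<in> N (?p i)} \<le> 3" .
  qed
  finally show ?thesis by simp
qed

lemma Cov_if_root_in_vicinity:
  assumes "u \<in> vicinity x z" "Root u"
  shows "Cov x z"
proof -
  from assms(1) obtain i where "i < dist x z" "u \<in> N ((par x ^^ i) z)"
    by (auto simp: vicinity_def missing_def)
  then show ?thesis unfolding Cov_def using assms(2) by (intro exI[of _ i] conjI bexI[of _ u]) auto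
qed

end

section \<open>The parameters\<close>

definition threshold :: "nat \<Rightarrow> nat \<Rightarrow> real" where
  "threshold n k = (real n * real k * ln (real n) ^ 3) powr (1 / 4)"

definition few_sources :: "nat \<Rightarrow> nat \<Rightarrow> bool" where
  "few_sources n k \<longleftrightarrow> real k \<le> threshold n k"

text \<open>A node whose degree reaches the threshold then expects at least \<open>a ln n\<close>
  adjacent centers, as long as the rate is at most \<open>1\<close>; \<open>a\<close> controls the
  failure probability.\<close>

definition center_rate :: "nat \<Rightarrow> nat \<Rightarrow> nat \<Rightarrow> real" where
  "center_rate a n k = real a * ln (real n) / threshold n k"

definition root_rate :: "nat \<Rightarrow> nat \<Rightarrow> nat \<Rightarrow> real" where
  "root_rate a n k = real a * threshold n k / real n"

text \<open>With few sources, this rule and the next two select nothing, and only the complete trees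
  of the sources remain.\<close>

definition low_rule :: "nat \<Rightarrow> nat \<Rightarrow> nat \<Rightarrow> bool" where
  "low_rule n k deg \<longleftrightarrow> \<not> few_sources n k \<and> real deg < threshold n k"

definition center_rule :: "nat \<Rightarrow> nat \<Rightarrow> nat \<Rightarrow> nat \<Rightarrow> bool" where
  "center_rule a n k g \<longleftrightarrow> \<not> few_sources n k \<and> level (center_rate a n k) \<le> g"

definition root_rule :: "nat \<Rightarrow> nat \<Rightarrow> nat \<Rightarrow> nat \<Rightarrow> bool" where
  "root_rule a n k g \<longleftrightarrow> \<not> few_sources n k \<and> level (root_rate a n k) \<le> g"

lemma threshold_eq:
  assumes "n \<ge> 1"
  shows "real n * threshold n k
    = real n powr (5 / 4) * real k powr (1 / 4) * ln (real n) powr (3 / 4)"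
proof -
  have "(ln (real n) ^ 3) powr (1 / 4) = ln (real n) powr (3 / 4)"
  proof (cases "ln (real n) = 0")
    case False
    then have "ln (real n) > 0" using assms by (simp add: order_less_le)
    then show ?thesis by (simp add: powr_powr flip: powr_numeral)
  qed simp
  then have "threshold n k = real n powr (1 / 4) * real k powr (1 / 4) * ln (real n) powr (3 / 4)"
    using assms by (simp add: threshold_def powr_mult)
  moreover have "real n * real n powr (1 / 4) = real n powr (5 / 4)"
    using assms powr_add[of "real n" 1 "1 / 4"] by simp
  ultimately show ?thesis by (simp flip: mult.assoc)
qed

text \<open>The slack \<open>6 * a + 1\<close> accounts for at most \<open>6 * a * card S\<close>
  roots and the sources themselves.\<close>

locale spanner_bounds =
  spanner_run V E "low_rule" "center_rule a" "root_rule a" few_sources "6 * a + 1" S \<omega>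
  for V E S \<omega> a
begin

abbreviation "hh \<equiv> threshold (card V) (card S)"
abbreviation "lam \<equiv> ln (real (card V))"
abbreviation "path_bound \<equiv> hh ^ 2 / (real (card S) * lam)"
abbreviation "crate \<equiv> center_rate a (card V) (card S)"
abbreviation "rrate \<equiv> root_rate a (card V) (card S)"

definition long_paths :: "(nat \<times> nat) set" where
  "long_paths = {p \<in> S \<times> V. path_bound < real (card (missing (fst p) (snd p)))}"

text \<open>Although the locale fixes one \<open>\<omega>\<close>, this set does not depend on it:
  low nodes, tree paths and rates are determined by the graph and the sources. This permits a union
  bound.\<close>

definition bad :: "(nat \<Rightarrow> nat) set" where
  "bad = (\<Union>v \<in> {v \<in> V. hh \<le> real (card (N v))}. {\<omega>. \<forall>u \<in> N v. \<omega> u < level crate})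
    \<union> (\<Union>p \<in> long_paths.
        {\<omega>. \<forall>u \<in> vicinity (fst p) (snd p). \<omega> u < level rrate})
    \<union> {\<omega>. 6 * crate * real (card V) \<le> real (card {v \<in> V. level crate \<le> \<omega> v})}
    \<union> {\<omega>. 6 * rrate * real (card V) \<le> real (card {v \<in> V. level rrate \<le> \<omega> v})}"

lemma few_sources_spanner:
  assumes "few_sources (card V) (card S)"
  shows "card Origin \<le> (6 * a + 1) * card S" "sourcewise_spanner2 V E S spanner"
    "real (card spanner) \<le> real (card V) * hh"
proof -
  have rules: "\<not> Low v" "\<not> Center v" "\<not> Root v" for v
    using assms by (auto simp: Low_def Center_def Root_def low_rule_def center_rule_def root_rule_def)
  then have sets: "Origin = S" "Full = S" using assms S_subset by (auto simp: Origin_def Full_def)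
  show "card Origin \<le> (6 * a + 1) * card S" by (simp add: sets)
  show "sourcewise_spanner2 V E S spanner" by (rule spanner_correct) (simp add: sets)
  have "ctr v = None" for v using rules by (simp add: ctr_def)
  then have "real (card spanner) \<le> real (card S) * real (card V)"
    using card_spanner[of 0 0] rules by (simp add: sets)
  also have "\<dots> \<le> hh * real (card V)"
    using assms by (intro mult_right_mono) (auto simp: few_sources_def)
  finally show "real (card spanner) \<le> real (card V) * hh" by (simp add: mult.commute)
qed

context
  assumes many: "\<not> few_sources (card V) (card S)" and n2: "2 \<le> card V" and a1: "1 \<le> a"
begin

lemma card_S: "card S \<le> card V" "1 \<le> card S"
proof -
  show "card S \<le> card V" using S_subset by (simp add: card_mono)
  show "1 \<le> card S" using many by (cases "card S = 0") (auto simp: few_sources_def threshold_def)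
qed

lemma lam: "1 / 2 \<le> lam" "lam \<le> real (card V)"
proof -
  have "ln (2 :: real) \<le> lam" using n2 by simp
  moreover have "1 / 2 \<le> ln (2 :: real)" using ln2_ge_two_thirds by simp
  ultimately show "1 / 2 \<le> lam" by linarith
  show "lam \<le> real (card V)" using ln_le_minus_one[of "real (card V)"] n2 by simp
qed

lemma hh4: "hh ^ 4 = real (card V) * real (card S) * lam ^ 3"
proof -
  have "0 < real (card V) * real (card S) * lam ^ 3" using n2 card_S lam by simp
  then show ?thesis by (simp add: threshold_def powr_powr flip: powr_numeral)
qed

lemma hh: "lam \<le> hh" "hh < real (card S)" "hh \<le> real (card V)" "0 < hh" "1 \<le> 2 * hh"
proof -
  have "lam ^ 4 = lam * 1 * lam ^ 3" by (simp add: eval_nat_numeral)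
  also have "\<dots> \<le> real (card V) * real (card S) * lam ^ 3"
    using lam card_S by (intro mult_right_mono mult_mono) auto
  finally have "lam ^ 4 \<le> hh ^ 4" by (simp add: hh4)
  then show l: "lam \<le> hh" by (rule power_le_imp_le_base[of _ 3, simplified]) (simp add: threshold_def)
  show k: "hh < real (card S)" using many by (simp add: few_sources_def)
  then show "hh \<le> real (card V)" using card_S by linarith
  show "0 < hh" "1 \<le> 2 * hh" using l lam by linarith+
qed

lemma rules:
  "Low v \<longleftrightarrow> real (card (N v)) < hh" "Center v \<longleftrightarrow> level (center_rate a (card V) (card S)) \<le> \<omega> v"
  "Root v \<longleftrightarrow> level (root_rate a (card V) (card S)) \<le> \<omega> v" "Full = {v \<in> V. Root v}"
  using many by (auto simp: Low_def Center_def Root_def low_rule_def center_rule_def root_rule_def Full_def)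

lemma many_sources_spanner:
  assumes centers: "\<And>v. v \<in> V \<Longrightarrow> hh \<le> real (card (N v)) \<Longrightarrow> \<exists>u \<in> N v. Center u"
    and roots: "\<And>x z. x \<in> S \<Longrightarrow> z \<in> V \<Longrightarrow> path_bound < real (card (missing x z)) \<Longrightarrow> \<exists>u \<in> vicinity x z. Root u"
    and few_centers: "real (card {v \<in> V. Center v}) \<le> 6 * center_rate a (card V) (card S) * real (card V)"
    and few_roots: "real (card {v \<in> V. Root v}) \<le> 6 * root_rate a (card V) (card S) * real (card V)"
  shows "card Origin \<le> (6 * a + 1) * card S" "sourcewise_spanner2 V E S spanner"
    "real (card spanner) \<le> real (12 * a + 2) * (real (card V) * hh)"
proof -
  have Full: "real (card Full) \<le> 6 * real a * hh"
    using few_roots n2 V_nonempty by (simp add: rules(4) root_rate_def)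
  also have "6 * real a * hh \<le> 6 * real a * real (card S)"
    using hh by (intro mult_left_mono) auto
  finally have "real (card Full) \<le> real (6 * a * card S)" by simp
  then have "card Full \<le> 6 * a * card S" by (simp only: of_nat_le_iff)
  moreover have "Origin \<subseteq> S \<union> Full" by (auto simp: Origin_def rules(4))
  then have "card Origin \<le> card (S \<union> Full)"
    using finite_subset[OF S_subset finite_V] finite_subset[OF Full_subset finite_Origin] by (intro card_mono) auto
  ultimately show "card Origin \<le> (6 * a + 1) * card S"
    using card_Un_le[of S Full] by (simp add: algebra_simps)
  show "sourcewise_spanner2 V E S spanner"
    by (rule spanner_correct) (use centers in \<open>auto simp: rules(1)\<close>)
  \<comment> \<open>Degrees are bounded by \<open>2 * hh\<close> here, so that one bound also covers
    a single center edge.\<close>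
  have "real (card spanner) \<le> real (card V) * (2 * hh) + real (card Full) * real (card V)
      + real (card S) * real (card {v \<in> V. Center v}) * path_bound"
  proof (rule card_spanner)
    show "real (card (N v)) \<le> 2 * hh" if "Low v" for v using that hh rules(1)[of v] by linarith
    show "0 \<le> 2 * hh" "1 \<le> 2 * hh" using hh by auto
    show "0 \<le> path_bound" using lam by simp
    show "real (card (missing x z)) \<le> path_bound" if "x \<in> S" "z \<in> V" "\<not> Cov x z" for x z
      using roots[OF that(1,2)] Cov_if_root_in_vicinity that(3) by fastforce
  qed
  also have "real (card Full) * real (card V) \<le> 6 * real a * hh * real (card V)"
    using Full by (intro mult_right_mono) auto
  also have "real (card S) * real (card {v \<in> V. Center v}) * path_bound
      \<le> real (card S) * (6 * (real a * lam / hh) * real (card V)) * path_bound"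
    using few_centers lam by (intro mult_right_mono mult_left_mono) (auto simp: center_rate_def)
  also have "\<dots> = 6 * real a * hh * real (card V)"
    using hh lam card_S n2 by (simp add: field_simps power2_eq_square)
  \<comment> \<open>The constant is \<open>2\<close> for \<open>A\<close> and \<open>6 * a\<close>
    each for the full trees and the bought paths.\<close>
  finally show "real (card spanner) \<le> real (12 * a + 2) * (real (card V) * hh)"
    by (simp add: algebra_simps)
qed

lemma good_spanner:
  assumes "\<omega> \<notin> bad"
  shows "card Origin \<le> (6 * a + 1) * card S" "sourcewise_spanner2 V E S spanner"
    "real (card spanner) \<le> real (12 * a + 2) * (real (card V) * hh)"
proof -
  have 1: "\<exists>u \<in> N v. Center u" if "v \<in> V" "hh \<le> real (card (N v))" for v
    using assms that by (auto simp: bad_def rules not_less)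
  have 2: "\<exists>u \<in> vicinity x z. Root u" if "x \<in> S" "z \<in> V" "path_bound < real (card (missing x z))" for x z
    using assms that by (force simp: bad_def long_paths_def rules not_less)
  have 3: "real (card {v \<in> V. Center v}) \<le> 6 * crate * real (card V)"
    "real (card {v \<in> V. Root v}) \<le> 6 * rrate * real (card V)"
    using assms by (auto simp: bad_def rules(2,3))
  note spanner = many_sources_spanner[OF 1 2 3]
  show "card Origin \<le> (6 * a + 1) * card S" by (rule spanner(1))
  show "sourcewise_spanner2 V E S spanner" by (rule spanner(2))
  show "real (card spanner) \<le> real (12 * a + 2) * (real (card V) * hh)" by (rule spanner(3))
qed

lemma prob_bad:
  assumes "0 < c" "6 * (c + 3) \<le> real a"
  shows "measure_pmf.prob (coins V) bad \<le> real (card V) powr (- c)"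
proof -
  let ?n = "real (card V)" and ?P = "measure_pmf.prob (coins V)"
  \<comment> \<open>A common lower bound for all four exponents. For paths the exponent is
    \<open>a * lam * lam / 3\<close>, and \<open>1 / 2 \<le> lam\<close> turns this into
    \<open>a * lam / 6\<close>.\<close>
  define x where "x = real a * lam / 6"
  have x: "0 < x" using a1 lam n2 by (simp add: x_def)
  have rates: "0 < crate" "0 < rrate"
    using a1 lam hh n2 by (auto simp: center_rate_def root_rate_def)
  have P1: "?P {\<omega>. \<forall>u \<in> N v. \<omega> u < level crate} \<le> exp (- x)" if v: "hh \<le> real (card (N v))" for v
  proof (rule prob_not_hit[OF finite_V N_subset_V rates(1) x])
    have "x \<le> real a * lam" using a1 lam by (simp add: x_def)
    also have "\<dots> = crate * hh" using hh by (simp add: center_rate_def)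
    also have "\<dots> \<le> crate * real (card (N v))" using v rates by (intro mult_left_mono) auto
    finally show "x \<le> crate * real (card (N v))" .
  qed
  have P2: "?P {\<omega>. \<forall>u \<in> vicinity (fst p) (snd p). \<omega> u < level rrate} \<le> exp (- x)"
    if p: "p \<in> long_paths" for p
  proof (rule prob_not_hit[OF finite_V vicinity_subset rates(2) x])
    have third: "r \<le> 3 * r' \<Longrightarrow> r / 3 \<le> r'" for r r' :: real by simp
    obtain s z where sz: "p = (s, z)" "s \<in> S" "z \<in> V" "path_bound < real (card (missing s z))"
      using p by (auto simp: long_paths_def)
    have "x \<le> real a * lam * lam / 3"
      using a1 lam mult_left_mono[of "1 / 2" lam "real a * lam"] by (simp add: x_def field_simps)
    also have "\<dots> = rrate * (hh * path_bound / 3)"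
    proof -
      have "rrate * (hh * path_bound / 3) = real a * hh ^ 4 / (3 * ?n * real (card S) * lam)"
        by (simp add: root_rate_def power2_eq_square eval_nat_numeral field_simps)
      also have "\<dots> = real a * lam * lam / 3"
        using n2 card_S lam unfolding hh4 by (simp add: field_simps eval_nat_numeral)
      finally show ?thesis by simp
    qed
    also have "rrate * (hh * path_bound / 3) \<le> rrate * real (card (vicinity s z))"
    proof (rule mult_left_mono)
      have "hh * path_bound \<le> hh * real (card (missing s z))" using sz hh by (intro mult_left_mono) auto
      also have "\<dots> \<le> 3 * real (card (vicinity s z))"
        using sz S_subset by (intro card_vicinity) (auto simp: rules(1))
      finally show "hh * path_bound / 3 \<le> real (card (vicinity s z))" by (rule third)
    qed (use rates in simp)
    finally show "x \<le> rrate * real (card (vicinity (fst p) (snd p)))" by (simp add: sz)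
  qed
  have P3: "?P {\<omega>. 6 * crate * ?n \<le> real (card {v \<in> V. level crate \<le> \<omega> v})} \<le> exp (- x)"
  proof (rule prob_large_set[OF finite_V rates(1)])
    have "x \<le> 2 * (real a * lam)" using a1 lam by (simp add: x_def)
    also have "real a * lam = crate * hh" using hh by (simp add: center_rate_def)
    also have "2 * (crate * hh) \<le> 2 * (crate * ?n)" using hh rates by (intro mult_left_mono) auto
    finally show "x \<le> 2 * crate * ?n" by simp
  qed
  have P4: "?P {\<omega>. 6 * rrate * ?n \<le> real (card {v \<in> V. level rrate \<le> \<omega> v})} \<le> exp (- x)"
  proof (rule prob_large_set[OF finite_V rates(2)])
    have "x \<le> 2 * (real a * lam)" using a1 lam by (simp add: x_def)
    also have "\<dots> \<le> 2 * (real a * hh)" using hh by (intro mult_left_mono) auto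
    also have "real a * hh = rrate * ?n" using n2 V_nonempty by (simp add: root_rate_def)
    finally show "x \<le> 2 * rrate * ?n" by simp
  qed
  have union: "?P (\<Union>i \<in> I. B i) \<le> real (card I) * exp (- x)"
    if "finite I" "\<And>i. i \<in> I \<Longrightarrow> ?P (B i) \<le> exp (- x)" for I and B :: "'i \<Rightarrow> (nat \<Rightarrow> nat) set"
  proof -
    have "?P (\<Union>i \<in> I. B i) \<le> (\<Sum>i\<in>I. ?P (B i))"
      using that(1) by (intro measure_pmf.finite_measure_subadditive_finite) auto
    also have "\<dots> \<le> real (card I) * exp (- x)" using that(2) by (intro sum_bounded_above)
    finally show ?thesis .
  qed
  have cards: "real (card {v \<in> V. hh \<le> real (card (N v))}) \<le> ?n"
    "real (card long_paths) \<le> ?n * ?n"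
  proof -
    have fS: "finite S" using S_subset finite_V by (rule finite_subset)
    show "real (card {v \<in> V. hh \<le> real (card (N v))}) \<le> ?n" by (simp add: card_mono)
    have "card long_paths \<le> card (S \<times> V)"
      using fS by (intro card_mono) (auto simp: long_paths_def)
    also have "\<dots> \<le> card V * card V" unfolding card_cartesian_product using card_S by (intro mult_le_mono1)
    finally show "real (card long_paths) \<le> ?n * ?n"
      by (simp only: of_nat_mult[symmetric] of_nat_le_iff)
  qed
  have split: "?P (A \<union> B \<union> C \<union> D) \<le> ?P A + ?P B + ?P C + ?P D" for A B C D
    using measure_Un_le[of "A \<union> B \<union> C" "measure_pmf (coins V)" D] measure_Un_le[of "A \<union> B" "measure_pmf (coins V)" C]
      measure_Un_le[of A "measure_pmf (coins V)" B] by simp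
  have fS: "finite S" using S_subset finite_V by (rule finite_subset)
  have "?P bad \<le> real (card {v \<in> V. hh \<le> real (card (N v))}) * exp (- x)
      + real (card long_paths) * exp (- x)
      + exp (- x) + exp (- x)"
    unfolding bad_def by (intro order_trans[OF split] add_mono union P1 P2 P3 P4)
      (use fS in \<open>auto simp: long_paths_def\<close>)
  also have "\<dots> \<le> ?n * exp (- x) + ?n * ?n * exp (- x) + exp (- x) + exp (- x)"
    using cards by (intro add_mono mult_right_mono) auto
  also have "\<dots> = (?n + ?n * ?n + 2) * exp (- x)" by (simp add: algebra_simps)
  \<comment> \<open>For \<open>2 \<le> n\<close>, the \<open>n\<close> nodes, \<open>n * n\<close>
    paths and two size events number at most \<open>n ^ 3\<close>, which the \<open>3\<close> in
    \<open>c + 3\<close> absorbs.\<close>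
  also have "\<dots> \<le> ?n powr 3 * ?n powr (- (c + 3))"
  proof (rule mult_mono)
    have "2 \<le> ?n" using n2 by simp
    then have "2 * (?n * ?n) \<le> ?n * (?n * ?n)" "2 * ?n \<le> ?n * ?n" by (auto intro!: mult_right_mono)
    then have "?n + ?n * ?n + 2 \<le> ?n * (?n * ?n)" using \<open>2 \<le> ?n\<close> by linarith
    then show "?n + ?n * ?n + 2 \<le> ?n powr 3" using n2 V_nonempty by (simp add: power3_eq_cube)
    have "(c + 3) * lam \<le> x" using assms lam mult_right_mono[of "6 * (c + 3)" "real a" lam]
      by (simp add: x_def algebra_simps)
    then show "exp (- x) \<le> ?n powr (- (c + 3))" using n2 V_nonempty by (simp add: powr_def algebra_simps)
  qed auto
  also have "\<dots> = ?n powr (- c)" unfolding powr_add[symmetric] by simp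
  finally show ?thesis .
qed

end

end

definition sparse_machine :: "nat \<Rightarrow> (nat \<times> nat \<times> node) machine" where
  "sparse_machine a = spanner_algorithm.spanner_machine low_rule (center_rule a) (root_rule a)
     few_sources (6 * a + 1)"

definition run_succeeds :: "nat \<Rightarrow> nat set \<Rightarrow> nat set set \<Rightarrow> nat set \<Rightarrow> (nat \<Rightarrow> nat) \<Rightarrow> nat \<Rightarrow> bool" where
  "run_succeeds a V E S \<omega> t \<longleftrightarrow> (\<exists>H. (\<forall>v\<in>V. mach_output (sparse_machine a)
      (mach_run (sparse_machine a) E S \<omega> t v) = Some (neighbors H v))
     \<and> sourcewise_spanner2 V E S H
     \<and> real (card H) \<le> real (12 * a + 2) * (real (card V) * threshold (card V) (card S)))"

section \<open>From coin vectors to runs of the distributed algorithm\<close>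

context net
begin

lemma prob_run_succeeds:
  assumes S: "S \<subseteq> V" and n2: "2 \<le> card V" and a: "0 < c" "6 * (c + 3) \<le> real a"
    and t: "13 * radius + 4 * (6 * a + 1) * card S + 11 \<le> t"
  shows "1 - real (card V) powr (- c) \<le> measure_pmf.prob (coins V) {\<omega>. run_succeeds a V E S \<omega> t}"
proof -
  interpret B: spanner_bounds V E S \<omega> a for \<omega>
    by unfold_locales (rule S)
  have a1: "1 \<le> a" using a by (cases a) auto
  have run: "run_succeeds a V E S \<omega> t"
    if "card (B.Origin \<omega>) \<le> (6 * a + 1) * card S" "sourcewise_spanner2 V E S (B.spanner \<omega>)"
      "real (card (B.spanner \<omega>)) \<le> real (12 * a + 2) * (real (card V) * threshold (card V) (card S))" for \<omega>
    unfolding run_succeeds_def sparse_machine_def using B.machine_result[OF that(1) t] that(2,3) by blast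
  show ?thesis
  proof (cases "few_sources (card V) (card S)")
    case True
    have "run_succeeds a V E S \<omega> t" for \<omega>
    proof (rule run)
      have "real (card (B.spanner \<omega>)) \<le> 1 * (real (card V) * threshold (card V) (card S))"
        using B.few_sources_spanner(3)[OF True] by simp
      also have "\<dots> \<le> real (12 * a + 2) * (real (card V) * threshold (card V) (card S))"
        by (intro mult_right_mono) (auto simp: threshold_def)
      finally show "real (card (B.spanner \<omega>)) \<le> real (12 * a + 2) * (real (card V) * threshold (card V) (card S))" .
    qed (use B.few_sources_spanner[OF True] in auto)
    then show ?thesis by simp
  next
    case False
    have "measure_pmf.prob (coins V) (- {\<omega>. run_succeeds a V E S \<omega> t}) \<le> measure_pmf.prob (coins V) B.bad"
      using run B.good_spanner[OF False n2 a1] by (intro measure_pmf.finite_measure_mono) auto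
    also have "\<dots> \<le> real (card V) powr (- c)" by (rule B.prob_bad[OF False n2 a1 a])
    finally show ?thesis
      using measure_pmf.prob_compl[of "{\<omega>. run_succeeds a V E S \<omega> t}" "coins V"]
      by (simp add: Compl_eq_Diff_UNIV)
  qed
qed

lemma radius_le_diameter: "graph_diameter V E = enat D \<Longrightarrow> radius \<le> D"
proof -
  assume D: "graph_diameter V E = enat D"
  obtain v where v: "v \<in> V" "dist leader v = radius" using ex_at_radius by blast
  have "enat radius \<le> (SUP v\<in>V. graph_dist E leader v)"
    using v graph_dist_eq[of leader v] by (intro SUP_upper2[of v]) auto
  also have "\<dots> \<le> graph_diameter V E"
    unfolding graph_diameter_def by (rule SUP_upper) simp
  finally show ?thesis using D by simp
qed

lemma diameter_pos: "graph_diameter V E = enat D \<Longrightarrow> 2 \<le> card V \<Longrightarrow> 1 \<le> D"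
proof -
  assume D: "graph_diameter V E = enat D" and n: "2 \<le> card V"
  obtain u v where uv: "u \<in> V" "v \<in> V" "u \<noteq> v"
    using n by (metis One_nat_def Suc_1 card_le_Suc0_iff_eq finite_V not_less_eq_eq)
  have "enat (dist u v) \<le> (SUP v\<in>V. graph_dist E u v)"
    using uv graph_dist_eq[of u v] by (intro SUP_upper2[of v]) auto
  also have "\<dots> \<le> graph_diameter V E"
    unfolding graph_diameter_def using uv by (intro SUP_upper) auto
  finally have "dist u v \<le> D" using D by simp
  moreover have "dist u v \<noteq> 0" using uv dist_zero by blast
  ultimately show ?thesis by simp
qed

text \<open>By \<open>k \<le> 2 ^ k\<close>, the factor \<open>k\<close> adds at most
  \<open>k\<close> bits. The absolute value admits a negative constant \<open>b\<close>.\<close>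

lemma floorlog_le_log_bits:
  assumes "short_identifiers b V" "x \<in> V \<or> x \<le> k * card V"
  shows "real (floorlog 2 x) \<le> (\<bar>b\<bar> + real k + 2) * log_bits (card V)"
proof -
  have n: "1 \<le> card V" using V_nonempty by (simp add: Suc_le_eq card_gt_0_iff)
  have lb: "1 \<le> log_bits (card V)" using n by (simp add: log_bits_def)
  have "real (floorlog 2 x) \<le> \<bar>b\<bar> * log_bits (card V) \<or> real (floorlog 2 x) \<le> (real k + 2) * log_bits (card V)"
    using assms(2)
  proof
    assume "x \<in> V"
    then have "real (floorlog 2 x) \<le> b * log_bits (card V)" using assms(1) by (simp add: short_identifiers_def)
    also have "\<dots> \<le> \<bar>b\<bar> * log_bits (card V)" using lb by (intro mult_right_mono) auto
    finally show ?thesis ..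
  next
    assume x: "x \<le> k * card V"
    show ?thesis
    proof (cases "x = 0")
      case True
      then show ?thesis using lb by (simp add: floorlog_def)
    next
      case False
      then have "2 ^ (floorlog 2 x - 1) \<le> x" using floorlog_bounds[of x 2] by simp
      also have "x \<le> k * card V" by (rule x)
      also have "\<dots> \<le> 2 ^ k * (card V + 1)" by (intro mult_mono) (auto intro: less_imp_le)
      finally have "real (2 ^ (floorlog 2 x - 1)) \<le> real (2 ^ k * (card V + 1))" by (simp only: of_nat_le_iff)
      then have "log 2 (2 ^ (floorlog 2 x - 1)) \<le> log 2 (2 ^ k * (real (card V) + 1))"
        by (subst log_le_cancel_iff) (auto simp: algebra_simps intro!: add_pos_nonneg)
      then have "real (floorlog 2 x) - 1 \<le> real k + log_bits (card V)"
        by (simp add: log_mult log_nat_power log_bits_def)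
      also have "\<dots> \<le> real k * log_bits (card V) + log_bits (card V)"
        using mult_left_mono[OF lb, of "real k"] by simp
      finally have "real (floorlog 2 x) \<le> (real k + 2) * log_bits (card V)"
        using lb by (simp add: algebra_simps)
      then show ?thesis ..
    qed
  qed
  moreover have "0 \<le> \<bar>b\<bar> * log_bits (card V)" "0 \<le> (real k + 2) * log_bits (card V)" using lb by auto
  ultimately show ?thesis by (auto simp: algebra_simps)
qed

text \<open>Every configuration in the support comes from a coin vector, and the word bound holds
  for each of them.\<close>

lemma sparse_machine_bandwidth:
  assumes S: "S \<subseteq> V" and ids: "short_identifiers b V"
  shows "respects_bandwidth (4 * (\<bar>b\<bar> + real (6 * a + 4) + 2) + 6) (realize \<mu> (sparse_machine a)) V E S"
  unfolding respects_bandwidth_def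
proof (intro allI ballI impI)
  fix t \<sigma> v u m
  assume \<sigma>: "\<sigma> \<in> set_pmf (congest_run (realize \<mu> (sparse_machine a)) V E S t)" and v: "v \<in> V"
    and m: "sent_message (realize \<mu> (sparse_machine a)) (\<sigma> v) u = Some m"
  from \<sigma> obtain \<omega> where \<omega>: "\<sigma> = code_run (sparse_machine a) V E S \<omega> t"
    by (auto simp: congest_run_realize)
  interpret B: spanner_bounds V E S \<omega> a by unfold_locales (rule S)
  from m obtain p q r s where w: "m = encode_word (p, q, r, s)"
    "mach_sent (sparse_machine a) (mach_run (sparse_machine a) E S \<omega> t v) u = Some (p, q, r, s)"
    by (auto simp: \<omega> sent_code_run[OF v])
  let ?x = "(\<bar>b\<bar> + real (6 * a + 4) + 2) * log_bits (card V)"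
  have "\<forall>x \<in> {p, q, r, s}. x \<in> V \<or> x \<le> (6 * a + 1 + 3) * card V"
    by (rule B.machine_message[OF w(2)[unfolded sparse_machine_def] v])
  then have fl: "\<forall>x \<in> {p, q, r, s}. real (floorlog 2 x) \<le> ?x"
    using floorlog_le_log_bits[OF ids, of _ "6 * a + 4"] by (simp add: algebra_simps)
  have "\<forall>x \<in> {p, q, r, s}. floorlog 2 x \<le> nat \<lfloor>?x\<rfloor>"
    using fl by (auto simp: le_nat_floor)
  then have "length m \<le> 4 * nat \<lfloor>?x\<rfloor> + 6"
    unfolding w(1) by (intro length_encode_word) auto
  then have "real (length m) \<le> 4 * real (nat \<lfloor>?x\<rfloor>) + 6" by linarith
  also have "0 \<le> ?x" using fl of_nat_0_le_iff[of "floorlog 2 p"] by (meson insertI1 order_trans)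
  then have "real (nat \<lfloor>?x\<rfloor>) \<le> ?x" by linarith
  moreover have "1 \<le> log_bits (card V)" using V_nonempty by (simp add: log_bits_def Suc_le_eq card_gt_0_iff)
  ultimately show "real (length m) \<le> (4 * (\<bar>b\<bar> + real (6 * a + 4) + 2) + 6) * log_bits (card V)"
    unfolding ring_distribs by linarith
qed

end

theorem theorem1:
  fixes a c :: real
  assumes "c > 0"
  shows "\<exists>(A :: nat congest_alg) (B :: real) (C :: real) (K :: nat).
    \<forall>(V :: nat set) (E :: nat set set) (S :: nat set) (D :: nat).
      connected_graph V E \<and> short_identifiers a V \<and> S \<subseteq> V \<and> graph_diameter V E = enat D \<longrightarrow>
        respects_bandwidth B A V E S \<and>
        measure_pmf.prob (congest_run A V E S (K * (card S + D)))
          {\<sigma>. \<exists>H. outputs_subgraph A V \<sigma> H \<and> sourcewise_spanner2 V E S H \<and>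
               real (card H) \<le> C * real (card V) powr (5 / 4) * real (card S) powr (1 / 4)
                                 * ln (real (card V)) powr (3 / 4)}
          \<ge> 1 - real (card V) powr (- c)"
proof -
  \<comment> \<open>The least natural number that meets the hypothesis of
    \<open>prob_bad\<close>.\<close>
  define q where "q = nat \<lceil>6 * (c + 3)\<rceil>"
  have q: "6 * (c + 3) \<le> real q" unfolding q_def by linarith
  define A where "A = realize (geometric_pmf (1 / 2)) (sparse_machine q)"
  \<comment> \<open>\<open>24 * q + 4\<close> per source from the four waves and \<open>24\<close>
    per unit of diameter: \<open>13\<close> from the phases and \<open>11\<close> for the additive
    constant, using \<open>1 \<le> D\<close>.\<close>
  define K where "K = 24 * q + 28"
  define C where "C = real (12 * q + 2)"
  show ?thesis
  proof (rule exI[of _ A], rule exI, rule exI[of _ C], rule exI[of _ K], intro allI impI conjI)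
    fix V :: "nat set" and E :: "nat set set" and S :: "nat set" and D :: nat
    assume asm: "connected_graph V E \<and> short_identifiers a V \<and> S \<subseteq> V \<and> graph_diameter V E = enat D"
    interpret net V E by unfold_locales (use asm in simp)
    show "respects_bandwidth (4 * (\<bar>a\<bar> + real (6 * q + 4) + 2) + 6) A V E S"
      unfolding A_def using asm by (intro sparse_machine_bandwidth) auto
    let ?n = "real (card V)" and ?t = "K * (card S + D)"
    let ?goal = "{\<sigma>. \<exists>H. outputs_subgraph A V \<sigma> H \<and> sourcewise_spanner2 V E S H \<and>
       real (card H) \<le> C * ?n powr (5 / 4) * real (card S) powr (1 / 4) * ln ?n powr (3 / 4)}"
    have n1: "1 \<le> card V" using V_nonempty by (simp add: Suc_le_eq card_gt_0_iff)
    show "1 - ?n powr (- c) \<le> measure_pmf.prob (congest_run A V E S ?t) ?goal"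
    proof (cases "card V = 1")
      case True
      \<comment> \<open>For a single node the required probability is
        \<open>1 - 1 = 0\<close>.\<close>
      then show ?thesis by simp
    next
      case False
      then have n2: "2 \<le> card V" using n1 by simp
      have D: "1 \<le> D" "radius \<le> D" using asm n2 diameter_pos radius_le_diameter by auto
      then have "13 * radius + 4 * (6 * q + 1) * card S + 11 \<le> 24 * D + 4 * (6 * q + 1) * card S" by linarith
      also have "\<dots> \<le> ?t" by (simp add: K_def algebra_simps)
      finally have t: "13 * radius + 4 * (6 * q + 1) * card S + 11 \<le> ?t" .
      have "{\<omega>. run_succeeds q V E S \<omega> ?t} \<subseteq> (\<lambda>\<omega>. code_run (sparse_machine q) V E S \<omega> ?t) -` ?goal"
        unfolding run_succeeds_def threshold_eq[OF n1]
        by (auto simp: outputs_subgraph_def A_def output_code_run C_def mult.assoc)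
      then have "measure_pmf.prob (coins V) {\<omega>. run_succeeds q V E S \<omega> ?t}
          \<le> measure_pmf.prob (coins V) ((\<lambda>\<omega>. code_run (sparse_machine q) V E S \<omega> ?t) -` ?goal)"
        by (intro measure_pmf.finite_measure_mono) auto
      also have "\<dots> = measure_pmf.prob (congest_run A V E S ?t) ?goal"
        unfolding A_def congest_run_realize coins_def by simp
      finally show ?thesis
        using prob_run_succeeds[OF _ n2 assms q t] asm by linarith
    qed
  qed
qed

end
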